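(* Any flat rank 2 distribution with growth vector $(2,1,2,\dots)$ (whether it is represented by a nondegenerate single Monge equation or by an underdetermined system of ODEs) is, locally, the result of successive integrable extensions of the Hilbert--Cartan equation $y'=(z'')^2$.
   Context: All considerations are local. For a distribution $\Delta\subset TM$ the weak derived flag is defined by $\Delta_1=\Delta$, $\Gamma(\Delta_{i+1})=[\Gamma(\Delta),\Gamma(\Delta_i)]$; it is assumed that all $\Delta_i$ have constant rank and that $\Delta$ is completely non-holonomic, i.e. $\Delta_s=TM$ for some $s$. The Carnot algebra of $\Delta$ at $x\in M$ is the graded nilpotent Lie algebra $\mathfrak{m}(x)=\bigoplus_{i<0}g_i$, $g_{-1}=\Delta_x$, $g_{-i}=(\Delta_i/\Delta_{i-1})_x$, with bracket induced by the commutator of vector fields. The growth vector is $(\dim g_{-1},\dim g_{-2},\dots)$. The distribution is flat if its Carnot algebra is (up to isomorphism) a fixed $\mathfrak{m}$ at all points and $(M,\Delta)$ is locally diffeomorphic to the simply connected nilpotent Lie group with Lie algebra $\mathfrak{m}$ equipped with the left-invariant distribution determined by $g_{-1}\subset\mathfrak{m}$. The Hilbert--Cartan equation is identified with the rank 2 distribution on $\mathbb{R}^5(x,y,z,z_1,z_2)$ spanned by $\partial_x+z_2^2\,\partial_y+z_1\,\partial_z+z_2\,\partial_{z_1}$ and $\partial_{z_2}$ (growth vector $(2,1,2)$). An integrable extension of $(M,\Delta)$ is a submersion $\pi:(\tilde M,\tilde\Delta)\to(M,\Delta)$ such that (i) $d_x\pi:\tilde\Delta_x\to\Delta_{\pi(x)}$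 is an isomorphism for all $x\in\tilde M$, and (ii) $\tilde\Delta_2\cap\operatorname{Ker}d\pi=0$. "Result of successive integrable extensions" means: there is a finite (possibly empty) chain of integrable extensions $(M_r,\Delta_r)\to\cdots\to(M_1,\Delta_1)\to(M_0,\Delta_0)$ starting from the Hilbert--Cartan equation $(M_0,\Delta_0)$ and with $(M_r,\Delta_r)$ locally equivalent to the given distribution (the subscripts here number the members of the chain). *)

theory Defs
  imports
    "HOL-Analysis.Analysis"
    "HOL-Algebra.Group"
    "HOL-Library.Function_Algebras"
    "HOL-Library.Set_Algebras"
begin

section \<open>Coordinate spaces of varying dimension\<close>

text \<open>
  All considerations are local, so a manifold of dimension \<open>n\<close> is an open subset of
  \<open>\<real>\<^sup>n\<close>. The dimension varies along a chain of extensions; therefore all \<open>\<real>\<^sup>n\<close> live in the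
  single type \<open>nat \<Rightarrow> real\<close> (with its product topology), \<open>\<real>\<^sup>n\<close> being the sequences that
  vanish from index \<open>n\<close> on. Tangent vectors at any point are elements of the same space.
\<close>

type_synonym rvec = "nat \<Rightarrow> real"

instantiation "fun" :: (type, real_vector) real_vector
begin

definition scaleR_fun :: "real \<Rightarrow> ('a \<Rightarrow> 'b) \<Rightarrow> 'a \<Rightarrow> 'b" where
  "scaleR_fun c f = (\<lambda>i. c *\<^sub>R f i)"

instance
  by standard (auto simp: scaleR_fun_def fun_eq_iff plus_fun_def scaleR_add_left scaleR_add_right)

end

definition Rn :: "nat \<Rightarrow> rvec set" where
  "Rn n = {x. \<forall>i\<ge>n. x i = 0}"

abbreviation open_in :: "nat \<Rightarrow> rvec set \<Rightarrow> bool" where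
  "open_in n U \<equiv> openin (top_of_set (Rn n)) U"

section \<open>Smooth maps and vector fields\<close>

definition partial :: "nat \<Rightarrow> (rvec \<Rightarrow> real) \<Rightarrow> rvec \<Rightarrow> real" where
  "partial i f x = deriv (\<lambda>t. f (x(i := t))) (x i)"

definition smooth_fun :: "nat \<Rightarrow> rvec set \<Rightarrow> (rvec \<Rightarrow> real) \<Rightarrow> bool" where
  "smooth_fun n U f \<longleftrightarrow>
     (\<forall>is. set is \<subseteq> {..<n} \<longrightarrow>
        continuous_on U (foldr partial is f) \<and>
        (\<forall>x\<in>U. \<forall>i<n. (\<lambda>t. foldr partial is f (x(i := t))) differentiable (at (x i))))"

definition smooth_map :: "nat \<Rightarrow> rvec set \<Rightarrow> nat \<Rightarrow> (rvec \<Rightarrow> rvec) \<Rightarrow> bool" where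
  "smooth_map n U m F \<longleftrightarrow> F ` U \<subseteq> Rn m \<and> (\<forall>j<m. smooth_fun n U (\<lambda>x. F x j))"

definition differential :: "nat \<Rightarrow> (rvec \<Rightarrow> rvec) \<Rightarrow> rvec \<Rightarrow> rvec \<Rightarrow> rvec" where
  "differential n F x v = (\<lambda>j. \<Sum>i<n. partial i (\<lambda>y. F y j) x * v i)"

definition commutator :: "nat \<Rightarrow> (rvec \<Rightarrow> rvec) \<Rightarrow> (rvec \<Rightarrow> rvec) \<Rightarrow> rvec \<Rightarrow> rvec" where
  "commutator n X Y x =
     (\<lambda>j. \<Sum>i<n. X x i * partial i (\<lambda>y. Y y j) x - Y x i * partial i (\<lambda>y. X y j) x)"

section \<open>Distributions and the weak derived flag\<close>

definition sections :: "nat \<Rightarrow> rvec set \<Rightarrow> (rvec \<Rightarrow> rvec set) \<Rightarrow> (rvec \<Rightarrow> rvec) set" where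
  "sections n W D = {X. smooth_map n W n X \<and> (\<forall>x\<in>W. X x \<in> D x)}"

text \<open>
  \<open>derived_flag n M D i\<close> is \<open>\<Delta>\<^sub>i\<close>, with the convention \<open>\<Delta>\<^sub>0 = 0\<close>. The modules of sections are
  understood as sheaves, i.e. brackets of local sections around the point are taken. The span
  includes \<open>\<Delta>\<^sub>i \<subseteq> \<Delta>\<^bsub>i+1\<^esub>\<close>, by the Leibniz rule, when \<open>\<Delta>\<close> has positive rank.
\<close>

fun derived_flag :: "nat \<Rightarrow> rvec set \<Rightarrow> (rvec \<Rightarrow> rvec set) \<Rightarrow> nat \<Rightarrow> rvec \<Rightarrow> rvec set" where
  "derived_flag n M D 0 x = {0}"
| "derived_flag n M D (Suc 0) x = D x"
| "derived_flag n M D (Suc (Suc i)) x =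
     span {commutator n X Y x | X Y W.
       open_in n W \<and> x \<in> W \<and> W \<subseteq> M \<and>
       X \<in> sections n W D \<and> Y \<in> sections n W (derived_flag n M D (Suc i))}"

definition smooth_subbundle :: "nat \<Rightarrow> nat \<Rightarrow> rvec set \<Rightarrow> (rvec \<Rightarrow> rvec set) \<Rightarrow> bool" where
  "smooth_subbundle k n M D \<longleftrightarrow>
     (\<forall>p\<in>M. \<exists>W X. open_in n W \<and> p \<in> W \<and> W \<subseteq> M \<and>
        (\<forall>j<k. smooth_map n W n (X j)) \<and>
        (\<forall>x\<in>W. D x = span ((\<lambda>j. X j x) ` {..<k}) \<and> dim (D x) = k))"

text \<open>Rank \<open>k\<close> distributions under the standing regularity assumptions.\<close>

definition distribution :: "nat \<Rightarrow> nat \<Rightarrow> rvec set \<Rightarrow> (rvec \<Rightarrow> rvec set) \<Rightarrow> bool" where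
  "distribution k n M D \<longleftrightarrow>
     open_in n M \<and> smooth_subbundle k n M D \<and>
     (\<forall>i. \<exists>r. \<forall>x\<in>M. dim (derived_flag n M D i x) = r) \<and>
     (\<exists>s. \<forall>x\<in>M. derived_flag n M D s x = Rn n)"

text \<open>\<open>growth n M D x i\<close> is \<open>dim g\<^bsub>-i\<^esub>\<close> for the Carnot algebra at \<open>x\<close> (\<open>i \<ge> 1\<close>).\<close>

definition growth :: "nat \<Rightarrow> rvec set \<Rightarrow> (rvec \<Rightarrow> rvec set) \<Rightarrow> rvec \<Rightarrow> nat \<Rightarrow> nat" where
  "growth n M D x i = dim (derived_flag n M D i x) - dim (derived_flag n M D (i - 1) x)"

section \<open>Carnot algebras\<close>

text \<open>
  Gradings are indexed by the positive numbers: \<open>g i\<close> stands for \<open>g\<^bsub>-i\<^esub>\<close>. A positive grading of a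
  finite-dimensional Lie algebra forces nilpotency.
\<close>

definition lie_algebra :: "nat \<Rightarrow> (rvec \<Rightarrow> rvec \<Rightarrow> rvec) \<Rightarrow> bool" where
  "lie_algebra n br \<longleftrightarrow>
     (\<forall>u\<in>Rn n. \<forall>v\<in>Rn n. br u v \<in> Rn n) \<and>
     (\<forall>a b. \<forall>u\<in>Rn n. \<forall>v\<in>Rn n. \<forall>w\<in>Rn n.
        br (a *\<^sub>R u + b *\<^sub>R v) w = a *\<^sub>R br u w + b *\<^sub>R br v w \<and>
        br w (a *\<^sub>R u + b *\<^sub>R v) = a *\<^sub>R br w u + b *\<^sub>R br w v) \<and>
     (\<forall>u\<in>Rn n. br u u = 0) \<and>
     (\<forall>u\<in>Rn n. \<forall>v\<in>Rn n. \<forall>w\<in>Rn n. br u (br v w) + br v (br w u) + br w (br u v) = 0)"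

definition graded_lie_algebra ::
    "nat \<Rightarrow> (nat \<Rightarrow> rvec set) \<Rightarrow> (rvec \<Rightarrow> rvec \<Rightarrow> rvec) \<Rightarrow> bool" where
  "graded_lie_algebra n g br \<longleftrightarrow>
     lie_algebra n br \<and>
     g 0 = {0} \<and> (\<forall>i. subspace (g i) \<and> g i \<subseteq> Rn n) \<and>
     (\<forall>v\<in>Rn n. \<exists>!y. (\<forall>i. y i \<in> g i) \<and> finite {i. y i \<noteq> 0} \<and> v = (\<Sum>i | y i \<noteq> 0. y i)) \<and>
     (\<forall>i j. \<forall>u\<in>g i. \<forall>v\<in>g j. br u v \<in> g (i + j))"

text \<open>
  The Carnot algebra at \<open>x\<close>: its homogeneous components are quotient spaces, whose elements are
  the cosets \<open>carnot_class n M D x i v\<close> of vectors \<open>v \<in> \<Delta>\<^sub>i\<close> modulo \<open>\<Delta>\<^bsub>i-1\<^esub>\<close>. In the bracket, the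
  union runs over all sections representing \<open>A\<close> and \<open>B\<close>; they all yield the same coset.
\<close>

definition carnot_class ::
    "nat \<Rightarrow> rvec set \<Rightarrow> (rvec \<Rightarrow> rvec set) \<Rightarrow> rvec \<Rightarrow> nat \<Rightarrow> rvec \<Rightarrow> rvec set" where
  "carnot_class n M D x i v = v +o derived_flag n M D (i - 1) x"

definition carnot_component ::
    "nat \<Rightarrow> rvec set \<Rightarrow> (rvec \<Rightarrow> rvec set) \<Rightarrow> rvec \<Rightarrow> nat \<Rightarrow> rvec set set" where
  "carnot_component n M D x i = carnot_class n M D x i ` derived_flag n M D i x"

definition carnot_bracket ::
    "nat \<Rightarrow> rvec set \<Rightarrow> (rvec \<Rightarrow> rvec set) \<Rightarrow> rvec \<Rightarrow> nat \<Rightarrow> nat \<Rightarrow> rvec set \<Rightarrow> rvec set \<Rightarrow> rvec set" where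
  "carnot_bracket n M D x i j A B =
     \<Union>{carnot_class n M D x (i + j) (commutator n X Y x) | X Y W.
         open_in n W \<and> x \<in> W \<and> W \<subseteq> M \<and>
         X \<in> sections n W (derived_flag n M D i) \<and> X x \<in> A \<and>
         Y \<in> sections n W (derived_flag n M D j) \<and> Y x \<in> B}"

text \<open>Isomorphism of graded Lie algebras between the Carnot algebra at \<open>x\<close> and \<open>(g, br)\<close>.\<close>

definition carnot_iso ::
    "nat \<Rightarrow> rvec set \<Rightarrow> (rvec \<Rightarrow> rvec set) \<Rightarrow> rvec \<Rightarrow>
     (nat \<Rightarrow> rvec set) \<Rightarrow> (rvec \<Rightarrow> rvec \<Rightarrow> rvec) \<Rightarrow> (nat \<Rightarrow> rvec set \<Rightarrow> rvec) \<Rightarrow> bool" where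
  "carnot_iso n M D x g br \<phi> \<longleftrightarrow>
     (\<forall>i\<ge>1. bij_betw (\<phi> i) (carnot_component n M D x i) (g i)) \<and>
     (\<forall>i\<ge>1. \<forall>a b. \<forall>u\<in>derived_flag n M D i x. \<forall>v\<in>derived_flag n M D i x.
        \<phi> i (carnot_class n M D x i (a *\<^sub>R u + b *\<^sub>R v)) =
          a *\<^sub>R \<phi> i (carnot_class n M D x i u) + b *\<^sub>R \<phi> i (carnot_class n M D x i v)) \<and>
     (\<forall>i\<ge>1. \<forall>j\<ge>1. \<forall>A\<in>carnot_component n M D x i. \<forall>B\<in>carnot_component n M D x j.
        \<phi> (i + j) (carnot_bracket n M D x i j A B) = br (\<phi> i A) (\<phi> j B))"

section \<open>Local equivalence\<close>

definition diffeo :: "nat \<Rightarrow> rvec set \<Rightarrow> nat \<Rightarrow> rvec set \<Rightarrow> (rvec \<Rightarrow> rvec) \<Rightarrow> bool" where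
  "diffeo n U m V f \<longleftrightarrow>
     bij_betw f U V \<and> smooth_map n U m f \<and> smooth_map m V n (inv_into U f)"

text \<open>Every point of \<open>M\<close> has a neighbourhood equivalent to an open part of \<open>(N, E)\<close>.\<close>

definition locally_equivalent ::
    "nat \<Rightarrow> rvec set \<Rightarrow> (rvec \<Rightarrow> rvec set) \<Rightarrow> nat \<Rightarrow> rvec set \<Rightarrow> (rvec \<Rightarrow> rvec set) \<Rightarrow> bool" where
  "locally_equivalent n M D m N E \<longleftrightarrow>
     (\<forall>p\<in>M. \<exists>U V f. open_in n U \<and> p \<in> U \<and> U \<subseteq> M \<and> open_in m V \<and> V \<subseteq> N \<and>
        diffeo n U m V f \<and> (\<forall>x\<in>U. differential n f x ` D x = E (f x)))"

section \<open>Flat distributions\<close>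

text \<open>
  A simply connected nilpotent Lie group of dimension \<open>n\<close> is diffeomorphic to \<open>\<real>\<^sup>n\<close> via its
  exponential map, so it is given by a smooth group structure on \<open>\<real>\<^sup>n\<close>. Smoothness of the
  multiplication is joint smoothness on \<open>\<real>\<^bsup>2n\<^esup>\<close>, the two arguments being the two halves.
\<close>

definition fst_half :: "nat \<Rightarrow> rvec \<Rightarrow> rvec" where
  "fst_half n z = (\<lambda>i. if i < n then z i else 0)"

definition snd_half :: "nat \<Rightarrow> rvec \<Rightarrow> rvec" where
  "snd_half n z = (\<lambda>i. if i < n then z (n + i) else 0)"

definition lie_group :: "nat \<Rightarrow> rvec monoid \<Rightarrow> bool" where
  "lie_group n G \<longleftrightarrow>
     group G \<and> carrier G = Rn n \<and>
     smooth_map (2 * n) (Rn (2 * n)) n (\<lambda>z. fst_half n z \<otimes>\<^bsub>G\<^esub> snd_half n z) \<and>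
     smooth_map n (Rn n) n (\<lambda>x. inv\<^bsub>G\<^esub> x)"

definition left_invariant_field :: "nat \<Rightarrow> rvec monoid \<Rightarrow> rvec \<Rightarrow> rvec \<Rightarrow> rvec" where
  "left_invariant_field n G v x = differential n (\<lambda>y. x \<otimes>\<^bsub>G\<^esub> y) \<one>\<^bsub>G\<^esub> v"

text \<open>The Lie bracket of \<open>G\<close> on the tangent space \<open>\<real>\<^sup>n\<close> at the unit.\<close>

definition lie_group_bracket :: "nat \<Rightarrow> rvec monoid \<Rightarrow> rvec \<Rightarrow> rvec \<Rightarrow> rvec" where
  "lie_group_bracket n G u v =
     commutator n (left_invariant_field n G u) (left_invariant_field n G v) \<one>\<^bsub>G\<^esub>"

text \<open>
  The fixed algebra \<open>\<mm>\<close> is \<open>(g, br)\<close>; \<open>\<psi>\<close> identifies it with the Lie algebra of \<open>G\<close>. Its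
  dimension is necessarily that of \<open>M\<close>, hence \<open>\<real>\<^sup>n\<close> serves as underlying vector space.
\<close>

definition flat :: "nat \<Rightarrow> rvec set \<Rightarrow> (rvec \<Rightarrow> rvec set) \<Rightarrow> bool" where
  "flat n M D \<longleftrightarrow>
     (\<exists>g br G \<psi>.
        graded_lie_algebra n g br \<and>
        (\<forall>x\<in>M. \<exists>\<phi>. carnot_iso n M D x g br \<phi>) \<and>
        lie_group n G \<and>
        bij_betw \<psi> (Rn n) (Rn n) \<and>
        (\<forall>a b. \<forall>u\<in>Rn n. \<forall>v\<in>Rn n. \<psi> (a *\<^sub>R u + b *\<^sub>R v) = a *\<^sub>R \<psi> u + b *\<^sub>R \<psi> v) \<and>
        (\<forall>u\<in>Rn n. \<forall>v\<in>Rn n. \<psi> (br u v) = lie_group_bracket n G (\<psi> u) (\<psi> v)) \<and>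
        locally_equivalent n M D n (Rn n)
          (\<lambda>x. (\<lambda>u. left_invariant_field n G (\<psi> u) x) ` g 1))"

section \<open>Integrable extensions of the Hilbert--Cartan equation\<close>

definition integrable_extension ::
    "nat \<Rightarrow> rvec set \<Rightarrow> (rvec \<Rightarrow> rvec set) \<Rightarrow> nat \<Rightarrow> rvec set \<Rightarrow> (rvec \<Rightarrow> rvec set) \<Rightarrow>
     (rvec \<Rightarrow> rvec) \<Rightarrow> bool" where
  "integrable_extension n' M' D' n M D \<pi> \<longleftrightarrow>
     smooth_map n' M' n \<pi> \<and> \<pi> ` M' \<subseteq> M \<and>
     (\<forall>x\<in>M'.
        differential n' \<pi> x ` Rn n' = Rn n \<and>
        bij_betw (differential n' \<pi> x) (D' x) (D (\<pi> x)) \<and>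
        derived_flag n' M' D' 2 x \<inter> {v \<in> Rn n'. differential n' \<pi> x v = 0} = {0})"

text \<open>
  The coordinates \<open>(x, y, z, z\<^sub>1, z\<^sub>2)\<close> on \<open>\<real>\<^sup>5\<close> have indices \<open>0, \<dots>, 4\<close>.
\<close>

definition hilbert_cartan :: "rvec \<Rightarrow> rvec set" where
  "hilbert_cartan p =
     span {(\<lambda>_. 0)(0 := 1, 1 := (p 4)\<^sup>2, 2 := p 3, 3 := p 4), (\<lambda>_. 0)(4 := 1)}"

definition result_of_extensions_of_hilbert_cartan ::
    "nat \<Rightarrow> rvec set \<Rightarrow> (rvec \<Rightarrow> rvec set) \<Rightarrow> bool" where
  "result_of_extensions_of_hilbert_cartan n M D \<longleftrightarrow>
     (\<exists>(r :: nat) d Ms Ds \<pi>.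
        d 0 = 5 \<and> Ms 0 = Rn 5 \<and> Ds 0 = hilbert_cartan \<and>
        (\<forall>k\<le>r. distribution 2 (d k) (Ms k) (Ds k)) \<and>
        (\<forall>k<r. integrable_extension (d (Suc k)) (Ms (Suc k)) (Ds (Suc k)) (d k) (Ms k) (Ds k) (\<pi> k)) \<and>
        locally_equivalent n M D (d r) (Ms r) (Ds r))"

end

theory Submission
  imports Defs
begin

text \<open>
  The reason for the theorem is that a graded nilpotent Lie algebra whose first three pieces have
  dimensions \<open>2, 1, 2\<close>, and which is generated by its first piece, is an extension of the free
  nilpotent Lie algebra of step 3 on two generators, and that the Hilbert--Cartan equation is the
  flat distribution of this free algebra.

  The second half of this is the observation that the vector fields
  \<open>X = \<partial>\<^sub>x + z\<^sub>2\<^sup>2 \<partial>\<^sub>y + z\<^sub>1 \<partial>\<^sub>z + z\<^sub>2 \<partial>\<^bsub>z\<^sub>1\<^esub>\<close>, \<open>Z = \<partial>\<^bsub>z\<^sub>2\<^esub>\<close>, \<open>W = [Z, X] = 2 z\<^sub>2 \<partial>\<^sub>y + \<partial>\<^bsub>z\<^sub>1\<^esub>\<close>, \<open>Y = \<partial>\<^sub>y\<close>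
  and \<open>T = \<partial>\<^sub>z\<close> form a frame on \<open>\<real>\<^sup>5\<close> with constant structure: \<open>[Z, X] = W\<close>, \<open>[Z, W] = 2 Y\<close>,
  \<open>[X, W] = - T\<close>, all other brackets being zero. For the first half, let \<open>\<mm>\<close> be the Lie algebra of the
  flat model \<open>G\<close>. Its quotient by the pieces of degree at least \<open>4\<close> is spanned by two generators
  \<open>e\<^sub>1, e\<^sub>2\<close>, by \<open>w = [e\<^sub>2, e\<^sub>1]\<close>, and by \<open>[e\<^sub>1, w]\<close> and \<open>[e\<^sub>2, w]\<close>, with no further relation because the
  dimensions add up to \<open>5\<close>. So there is a surjective homomorphism \<open>\<Lambda>\<close> from \<open>\<mm>\<close> onto the span of the
  frame (\<open>ex_hom_to_hc_bracket\<close>).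

  The homomorphism integrates to a submersion \<open>\<pi>\<close> from \<open>G\<close> onto \<open>\<real>\<^sup>5\<close> that maps the left-invariant field
  of \<open>v\<close> to the combination of frame fields with coefficients \<open>\<Lambda> v\<close> (\<open>ex_map_to_hilbert_cartan\<close>). The five
  components of \<open>\<pi>\<close> are found one after the other by the Poincare lemma. On \<open>\<mm>\<^sub>1\<close> the map \<open>\<Lambda>\<close> is an
  isomorphism onto the plane of the Hilbert--Cartan equation, and it is injective on \<open>\<mm>\<^sub>1 \<oplus> \<mm>\<^sub>2\<close>. These
  are the two conditions on an integrable extension, so a single extension leads from the
  Hilbert--Cartan equation to \<open>G\<close>, and by flatness \<open>G\<close> is locally equivalent to the given distribution.

  The hypotheses concern the derived flag of the given distribution, whereas the argument needs the
  algebra. The link is that the derived flag is invariant under diffeomorphisms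
  (\<open>derived_flag_diffeo\<close>) and that on a manifold with a frame of constant structure it is the translate of
  the flag of brackets in the algebra (\<open>derived_flag_parallel\<close>). Hence \<open>\<mm>\<close> is generated by \<open>\<mm>\<^sub>1\<close> and its
  flag of brackets has the dimensions given by the growth vector.
\<close>

section \<open>Smooth functions on coordinate spaces\<close>

lemma Rn_upd: "x \<in> Rn n \<Longrightarrow> i < n \<Longrightarrow> x(i := t) \<in> Rn n"
  by (auto simp: Rn_def)

lemma open_in_subset_Rn: "open_in n U \<Longrightarrow> x \<in> U \<Longrightarrow> x \<in> Rn n"
  using openin_imp_subset by blast

lemma open_in_Rn [simp]: "open_in n (Rn n)"
  by auto

lemma continuous_on_fun_upd:
  fixes f :: "'a::topological_space \<Rightarrow> rvec" and g :: "'a \<Rightarrow> real"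
  assumes "continuous_on S f" "continuous_on S g"
  shows "continuous_on S (\<lambda>t. (f t)(i := g t))"
proof (rule continuous_on_coordinatewise_then_product)
  fix k show "continuous_on S (\<lambda>t. ((f t)(i := g t)) k)"
    using assms by (cases "k = i") (auto intro: continuous_on_product_coordinates continuous_on_product_then_coordinatewise)
qed

lemma open_in_line:
  assumes "open_in n U" "x \<in> Rn n" "i < n"
  shows "open {t. x(i := t) \<in> U}"
proof -
  obtain T where T: "open T" "U = Rn n \<inter> T"
    using assms(1) by (auto simp: openin_open)
  have "{t. x(i := t) \<in> U} = (\<lambda>t. x(i := t)) -` T"
    using T Rn_upd[OF assms(2,3)] by auto
  moreover have "continuous_on UNIV (\<lambda>t. x(i := t))"
    by (intro continuous_on_fun_upd continuous_intros)
  ultimately show ?thesis using T(1) open_vimage by metis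
qed

text \<open>
  Points of \<open>Rn n\<close> agree from index \<open>n\<close> on, so a basic neighbourhood of the product topology only
  constrains the first \<open>n\<close> coordinates. All estimates below are made on such boxes, since the
  type of points carries no norm.
\<close>

lemma open_in_box:
  assumes "open_in n U" "x \<in> U"
  shows "\<exists>d>0. \<forall>y\<in>Rn n. (\<forall>j<n. \<bar>y j - x j\<bar> < d) \<longrightarrow> y \<in> U"
proof -
  obtain T where T: "open T" "U = Rn n \<inter> T"
    using assms(1) by (auto simp: openin_open)
  then obtain B where B: "x \<in> Pi\<^sub>E UNIV B" "\<And>i. open (B i)" "Pi\<^sub>E UNIV B \<subseteq> T"
    using product_topology_open_contains_basis[of "\<lambda>_. euclidean" UNIV T x] assms(2)
    by (auto simp: open_fun_def)
  have "\<exists>d. \<forall>j. 0 < d j \<and> (\<forall>s. \<bar>s - x j\<bar> < d j \<longrightarrow> s \<in> B j)"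
  proof (rule choice, rule allI)
    fix j show "\<exists>d. 0 < d \<and> (\<forall>s. \<bar>s - x j\<bar> < d \<longrightarrow> s \<in> B j)"
      using B(1) B(2)[of j] by (auto simp: open_dist dist_real_def PiE_def Pi_def)
  qed
  then obtain d where d: "\<And>j. 0 < d j" "\<And>j s. \<bar>s - x j\<bar> < d j \<Longrightarrow> s \<in> B j"
    by blast
  let ?e = "Min (insert 1 (d ` {..<n}))"
  have e: "?e > 0" using d(1) by (auto simp: Min_gr_iff)
  have "y \<in> U" if y: "y \<in> Rn n" "\<forall>j<n. \<bar>y j - x j\<bar> < ?e" for y
  proof -
    have "y j \<in> B j" for j
    proof (cases "j < n")
      case True
      then have "?e \<le> d j" by (intro Min_le) auto
      then show ?thesis using y(2) True d(2)[of "y j" j] by force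
    next
      case False
      then have "y j = x j" using y(1) assms open_in_subset_Rn[OF assms] by (auto simp: Rn_def)
      then show ?thesis using d by auto
    qed
    then show ?thesis using B(3) T(2) y(1) by auto
  qed
  then show ?thesis using e by blast
qed

lemma continuous_in_box:
  fixes g :: "rvec \<Rightarrow> real"
  assumes "open_in n U" "x \<in> U" "continuous_on U g" "e > 0"
  shows "\<exists>d>0. \<forall>y\<in>Rn n. (\<forall>j<n. \<bar>y j - x j\<bar> < d) \<longrightarrow> y \<in> U \<and> \<bar>g y - g x\<bar> < e"
proof -
  let ?U = "U \<inter> g -` ball (g x) e"
  have "openin (top_of_set U) ?U"
    using assms(3) by (intro continuous_openin_preimage_gen) auto
  then have "open_in n ?U" using assms(1) openin_trans by blast
  from open_in_box[OF this, of x] show ?thesis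
    using assms(2,4) by (auto simp: dist_real_def abs_minus_commute)
qed

lemma smooth_fun_continuous: "smooth_fun n U f \<Longrightarrow> continuous_on U f"
  unfolding smooth_fun_def by (drule spec[of _ "[]"]) auto

lemma smooth_fun_has_partial:
  assumes "smooth_fun n U f" "x \<in> U" "i < n"
  shows "((\<lambda>t. f (x(i := t))) has_real_derivative partial i f x) (at (x i))"
proof -
  have "(\<lambda>t. f (x(i := t))) differentiable (at (x i))"
    using assms unfolding smooth_fun_def by (auto dest: spec[of _ "[]"])
  then show ?thesis
    unfolding partial_def using DERIV_deriv_iff_real_differentiable by blast
qed

lemma smooth_fun_has_partial_line:
  assumes "smooth_fun n U f" "x(i := s) \<in> U" "i < n"
  shows "((\<lambda>t. f (x(i := t))) has_real_derivative partial i f (x(i := s))) (at s)"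
  using smooth_fun_has_partial[OF assms] by simp

lemma smooth_fun_partial:
  assumes "smooth_fun n U f" "i < n"
  shows "smooth_fun n U (partial i f)"
  unfolding smooth_fun_def
proof (intro allI impI)
  fix "is" assume "set is \<subseteq> {..<n}"
  then have "set (is @ [i]) \<subseteq> {..<n}" using assms(2) by auto
  then show "continuous_on U (foldr partial is (partial i f)) \<and>
    (\<forall>x\<in>U. \<forall>ia<n. (\<lambda>t. foldr partial is (partial i f) (x(ia := t))) differentiable at (x ia))"
    using assms(1)[unfolded smooth_fun_def, rule_format, of "is @ [i]"] by simp
qed

lemma smooth_fun_subset: "smooth_fun n U f \<Longrightarrow> V \<subseteq> U \<Longrightarrow> smooth_fun n V f"
  unfolding smooth_fun_def by (blast intro: continuous_on_subset)

lemma partial_eqI: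
  assumes "((\<lambda>t. f (x(i := t))) has_real_derivative D) (at (x i))"
  shows "partial i f x = D"
  using assms unfolding partial_def by (rule DERIV_imp_deriv)

lemma has_partial_cong:
  assumes "open_in n U" "x \<in> U" "i < n" "\<And>y. y \<in> U \<Longrightarrow> f y = g y"
    "((\<lambda>t. f (x(i := t))) has_real_derivative D) (at (x i))"
  shows "((\<lambda>t. g (x(i := t))) has_real_derivative D) (at (x i))"
  using assms(5)
proof (rule has_field_derivative_transform_within_open)
  show "open {t. x(i := t) \<in> U}"
    using open_in_line assms open_in_subset_Rn by blast
qed (use assms in auto)

lemma partial_cong:
  assumes "open_in n U" "x \<in> U" "i < n" "\<And>y. y \<in> U \<Longrightarrow> f y = g y"
  shows "partial i f x = partial i g x"
  unfolding partial_def
proof (rule deriv_cong_ev)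
  have "open {t. x(i := t) \<in> U}" "x i \<in> {t. x(i := t) \<in> U}"
    using open_in_line assms open_in_subset_Rn by auto
  then show "\<forall>\<^sub>F t in nhds (x i). f (x(i := t)) = g (x(i := t))"
    using assms(4) unfolding eventually_nhds by blast
qed simp

text \<open>
  Smoothness is a greatest fixed point: a set of continuous functions that contains the partial
  derivatives of all its members, up to equality on \<open>U\<close>, consists of smooth functions. Closure
  properties of smooth functions follow without computing any higher derivative.
\<close>

lemma smooth_fun_coinduct:
  assumes U: "open_in n U" and f: "f \<in> S"
    and cont: "\<And>f. f \<in> S \<Longrightarrow> continuous_on U f"
    and step: "\<And>f i. f \<in> S \<Longrightarrow> i < n \<Longrightarrow>
      \<exists>g\<in>S. \<forall>x\<in>U. ((\<lambda>t. f (x(i := t))) has_real_derivative g x) (at (x i))"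
  shows "smooth_fun n U f"
  unfolding smooth_fun_def
proof (intro allI impI)
  fix "is" assume "set is \<subseteq> {..<n}"
  then have "\<exists>g\<in>S. \<forall>x\<in>U. foldr partial is f x = g x"
  proof (induction "is")
    case Nil then show ?case using f by auto
  next
    case (Cons i "is")
    then obtain g where g: "g \<in> S" "\<And>x. x \<in> U \<Longrightarrow> foldr partial is f x = g x" by auto
    obtain h where h: "h \<in> S" "\<And>x. x \<in> U \<Longrightarrow> ((\<lambda>t. g (x(i := t))) has_real_derivative h x) (at (x i))"
      using step[OF g(1), of i] Cons.prems by auto
    have "foldr partial (i # is) f x = h x" if "x \<in> U" for x
      using partial_cong[OF U that _ g(2), of i] partial_eqI[OF h(2)[OF that]] Cons.prems by simp
    then show ?case using h(1) by blast
  qed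
  then obtain g where g: "g \<in> S" "\<And>x. x \<in> U \<Longrightarrow> foldr partial is f x = g x" by auto
  have "continuous_on U (foldr partial is f)"
    using cont[OF g(1)] g(2) continuous_on_cong by metis
  moreover have "(\<lambda>t. foldr partial is f (x(i := t))) differentiable at (x i)" if mem: "x \<in> U" "i < n" for x i
  proof -
    obtain h where "((\<lambda>t. g (x(i := t))) has_real_derivative h x) (at (x i))"
      using step[OF g(1) mem(2)] mem by blast
    then have "((\<lambda>t. foldr partial is f (x(i := t))) has_real_derivative h x) (at (x i))"
      using has_partial_cong[OF U mem] g(2) by metis
    then show ?thesis unfolding real_differentiable_def by blast
  qed
  ultimately show "continuous_on U (foldr partial is f) \<and>
      (\<forall>x\<in>U. \<forall>i<n. (\<lambda>t. foldr partial is f (x(i := t))) differentiable at (x i))"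
    by blast
qed

lemma smooth_fun_const: "open_in n U \<Longrightarrow> smooth_fun n U (\<lambda>_. c)"
  by (rule smooth_fun_coinduct[where S = "range (\<lambda>c _. c)"]) (auto intro!: exI[of _ 0])

lemma smooth_fun_coord:
  assumes "open_in n U" shows "smooth_fun n U (\<lambda>x. x k)"
proof (rule smooth_fun_coinduct[OF assms, where S = "insert (\<lambda>x. x k) (range (\<lambda>c _. c))"])
  fix f i assume f: "f \<in> insert (\<lambda>x::rvec. x k) (range (\<lambda>c _. c))" "i < n"
  show "\<exists>g\<in>insert (\<lambda>x::rvec. x k) (range (\<lambda>c _. c)).
        \<forall>x\<in>U. ((\<lambda>t. f (x(i := t))) has_real_derivative g x) (at (x i))"
    apply (rule bexI[of _ "\<lambda>_. if f = (\<lambda>x::rvec. x k) \<and> i = k then 1 else 0"])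
    using f by (auto intro!: derivative_eq_intros)
qed (auto intro: continuous_on_product_coordinates continuous_on_subset)

text \<open>
  The increment of \<open>f\<close> from \<open>x\<close> to \<open>y\<close> is a telescoping sum along the path that changes one coordinate
  at a time; the mean value theorem identifies each difference quotient \<open>q j y\<close> with a partial
  derivative at a point close to \<open>x\<close>.
\<close>

lemma first_order_expansion:
  assumes U: "open_in n U" and f: "smooth_fun n U f" and x: "x \<in> U"
  shows "\<exists>d>0. \<exists>q.
    (\<forall>y\<in>Rn n. (\<forall>j<n. \<bar>y j - x j\<bar> < d) \<longrightarrow> f y - f x = (\<Sum>j<n. q j y * (y j - x j))) \<and>
    (\<forall>j<n. \<forall>e>0. \<exists>d>0. \<forall>y\<in>Rn n. (\<forall>k<n. \<bar>y k - x k\<bar> < d) \<longrightarrow> \<bar>q j y - partial j f x\<bar> < e)"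
proof -
  define h :: "nat \<Rightarrow> rvec \<Rightarrow> rvec" where "h j y = (\<lambda>i. if i < j then y i else x i)" for j y
  define q where "q j y = (if y j = x j then partial j f x
     else (f (h (Suc j) y) - f (h j y)) / (y j - x j))" for j y
  have xR: "x \<in> Rn n" using U x open_in_subset_Rn by blast
  have hS: "h (Suc j) y = (h j y)(j := y j)" for j y
    by (auto simp: h_def fun_eq_iff less_Suc_eq)
  have hx: "(h j y)(j := x j) = h j y" for j y by (auto simp: h_def)
  have "f y - f x = (\<Sum>j<n. q j y * (y j - x j))" if y: "y \<in> Rn n" for y
  proof -
    have "h n y = y" using y xR by (auto simp: h_def Rn_def fun_eq_iff)
    moreover have "h 0 y = x" by (auto simp: h_def)
    moreover have "(\<Sum>j<n. f (h (Suc j) y) - f (h j y)) = f (h n y) - f (h 0 y)"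
      by (rule sum_lessThan_telescope)
    moreover have "q j y * (y j - x j) = f (h (Suc j) y) - f (h j y)" for j
      using hS[of j y] hx[of j y] by (auto simp: q_def)
    ultimately show ?thesis by simp
  qed
  moreover have "\<exists>d>0. \<forall>y\<in>Rn n. (\<forall>k<n. \<bar>y k - x k\<bar> < d) \<longrightarrow> \<bar>q j y - partial j f x\<bar> < e"
    if j: "j < n" and e: "e > 0" for j e
  proof -
    obtain d where d: "d > 0" "\<And>y. y \<in> Rn n \<Longrightarrow> (\<And>k. k < n \<Longrightarrow> \<bar>y k - x k\<bar> < d) \<Longrightarrow>
        y \<in> U \<and> \<bar>partial j f y - partial j f x\<bar> < e"
      using continuous_in_box[OF U x smooth_fun_continuous[OF smooth_fun_partial[OF f j]] e] by blast
    have "\<bar>q j y - partial j f x\<bar> < e" if y: "y \<in> Rn n" "\<forall>k<n. \<bar>y k - x k\<bar> < d" for y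
    proof (cases "y j = x j")
      case True then show ?thesis using e by (simp add: q_def)
    next
      case False
      have mem: "(h j y)(j := t) \<in> U \<and> \<bar>partial j f ((h j y)(j := t)) - partial j f x\<bar> < e"
        if "min (x j) (y j) \<le> t" "t \<le> max (x j) (y j)" for t
      proof (rule d(2))
        show "(h j y)(j := t) \<in> Rn n" using y(1) xR j by (auto simp: h_def Rn_def)
        fix k assume k: "k < n"
        show "\<bar>((h j y)(j := t)) k - x k\<bar> < d"
          using y(2)[rule_format, OF k] that d(1) by (auto simp: h_def)
      qed
      let ?F = "\<lambda>t. f ((h j y)(j := t))"
      have der: "(?F has_real_derivative partial j f ((h j y)(j := t))) (at t)"
        if "min (x j) (y j) \<le> t" "t \<le> max (x j) (y j)" for t
        using smooth_fun_has_partial_line[OF f _ j] mem[OF that] by blast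
      have "\<exists>z>min (x j) (y j). z < max (x j) (y j) \<and> ?F (max (x j) (y j)) - ?F (min (x j) (y j)) =
         (max (x j) (y j) - min (x j) (y j)) * partial j f ((h j y)(j := z))"
      proof (rule MVT2)
        show "min (x j) (y j) < max (x j) (y j)" using False by linarith
      qed (rule der)
      then obtain z where z: "min (x j) (y j) < z" "z < max (x j) (y j)" "?F (max (x j) (y j)) - ?F (min (x j) (y j)) =
         (max (x j) (y j) - min (x j) (y j)) * partial j f ((h j y)(j := z))" by blast
      have "?F (y j) - ?F (x j) = (y j - x j) * partial j f ((h j y)(j := z))"
        using z(3) by (cases "x j \<le> y j") (auto simp: max_def min_def algebra_simps)
      then have "q j y = partial j f ((h j y)(j := z))"
        using False hS[of j y] hx[of j y] by (simp add: q_def)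
      then show ?thesis using mem[of z] z by auto
    qed
    then show ?thesis using d(1) by blast
  qed
  ultimately show ?thesis by (intro exI[of _ 1] conjI exI[of _ q]) auto
qed

text \<open>
  Stated along curves, because the partial derivatives of a composite \<open>f \<circ> F\<close> are the derivatives of
  \<open>f\<close> along the images of coordinate lines.
\<close>

lemma chain_rule_curve:
  assumes U: "open_in n U" and f: "smooth_fun n U f" and x: "c s \<in> U"
    and cR: "\<forall>\<^sub>F t in at s. c t \<in> Rn n"
    and c: "\<And>j. j < n \<Longrightarrow> ((\<lambda>t. c t j) has_real_derivative c' j) (at s)"
  shows "((\<lambda>t. f (c t)) has_real_derivative (\<Sum>j<n. partial j f (c s) * c' j)) (at s)"
proof -
  obtain d q where q: "d > 0"
    "\<forall>y\<in>Rn n. (\<forall>j<n. \<bar>y j - c s j\<bar> < d) \<longrightarrow> f y - f (c s) = (\<Sum>j<n. q j y * (y j - c s j))"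
    "\<forall>j<n. \<forall>e>0. \<exists>d>0. \<forall>y\<in>Rn n. (\<forall>k<n. \<bar>y k - c s k\<bar> < d) \<longrightarrow> \<bar>q j y - partial j f (c s)\<bar> < e"
    using first_order_expansion[OF U f x] by blast
  have box: "\<forall>\<^sub>F t in at s. c t \<in> Rn n \<and> (\<forall>k<n. \<bar>c t k - c s k\<bar> < d)" if "d > 0" for d
  proof -
    have "\<forall>\<^sub>F t in at s. \<forall>k\<in>{..<n}. \<bar>c t k - c s k\<bar> < d"
    proof (intro eventually_ball_finite ballI)
      fix k assume "k \<in> {..<n}"
      then have "isCont (\<lambda>t. c t k) s" using c DERIV_isCont by blast
      then have "((\<lambda>t. c t k) \<longlongrightarrow> c s k) (at s)" by (simp add: isCont_def)
      then show "\<forall>\<^sub>F t in at s. \<bar>c t k - c s k\<bar> < d"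
        using that tendstoD by (fastforce simp: dist_real_def)
    qed simp
    with cR show ?thesis by eventually_elim auto
  qed
  have qlim: "((\<lambda>t. q j (c t)) \<longlongrightarrow> partial j f (c s)) (at s)" if "j < n" for j
  proof (rule tendstoI)
    fix e :: real assume "e > 0"
    then obtain d where "d > 0" "\<forall>y\<in>Rn n. (\<forall>k<n. \<bar>y k - c s k\<bar> < d) \<longrightarrow> \<bar>q j y - partial j f (c s)\<bar> < e"
      using q(3) \<open>j < n\<close> by blast
    then show "\<forall>\<^sub>F t in at s. dist (q j (c t)) (partial j f (c s)) < e"
      using box[of d] by (auto simp: dist_real_def elim: eventually_mono)
  qed
  have "((\<lambda>t. \<Sum>j<n. q j (c t) * ((c t j - c s j) / (t - s))) \<longlongrightarrow> (\<Sum>j<n. partial j f (c s) * c' j)) (at s)"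
    using qlim c by (intro tendsto_sum tendsto_mult) (auto simp: has_field_derivative_iff)
  moreover have "\<forall>\<^sub>F t in at s. (\<Sum>j<n. q j (c t) * ((c t j - c s j) / (t - s))) = (f (c t) - f (c s)) / (t - s)"
    using box[OF q(1)] by eventually_elim (use q(2) in \<open>simp add: sum_divide_distrib\<close>)
  ultimately show ?thesis
    unfolding has_field_derivative_iff by (rule Lim_transform_eventually)
qed

lemma smooth_map_in_Rn: "smooth_map n U m F \<Longrightarrow> x \<in> U \<Longrightarrow> F x \<in> Rn m"
  by (auto simp: smooth_map_def)

lemma smooth_fun_cong:
  assumes U: "open_in n U" and f: "smooth_fun n U f" and eq: "\<And>x. x \<in> U \<Longrightarrow> f x = g x"
  shows "smooth_fun n U g"
proof (rule smooth_fun_coinduct[OF U, where S = "insert g {f. smooth_fun n U f}"])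
  fix h assume h: "h \<in> insert g {f. smooth_fun n U f}"
  have *: "\<exists>k. smooth_fun n U k \<and> (\<forall>x\<in>U. k x = h x)"
    using h f eq by auto
  then show "continuous_on U h" using smooth_fun_continuous continuous_on_cong by (metis (no_types, lifting))
  fix i assume i: "i < n"
  obtain k where k: "smooth_fun n U k" "\<forall>x\<in>U. k x = h x" using * by blast
  show "\<exists>g\<in>insert g {f. smooth_fun n U f}. \<forall>x\<in>U. ((\<lambda>t. h (x(i := t))) has_real_derivative g x) (at (x i))"
  proof (rule bexI[of _ "partial i k"], rule ballI)
    fix x assume x: "x \<in> U"
    show "((\<lambda>t. h (x(i := t))) has_real_derivative partial i k x) (at (x i))"
      using k(2) smooth_fun_has_partial[OF k(1) x i] by (intro has_partial_cong[OF U x i, of k h]) auto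
  qed (use smooth_fun_partial[OF k(1) i] in auto)
qed simp

lemma smooth_map_component:
  assumes "smooth_map n U m F" "open_in n U" shows "smooth_fun n U (\<lambda>x. F x j)"
proof (cases "j < m")
  case False
  have "smooth_fun n U (\<lambda>_. 0)" using assms smooth_fun_const by blast
  moreover have "F x j = 0" if "x \<in> U" for x using smooth_map_in_Rn[OF assms(1) that] False by (simp add: Rn_def)
  ultimately show ?thesis using smooth_fun_cong[OF assms(2), of "\<lambda>_. 0"] by auto
qed (use assms in \<open>auto simp: smooth_map_def\<close>)

lemma chain_rule_partial:
  assumes U: "open_in n U" and V: "open_in m V" and F: "smooth_map n U m F" and FV: "F ` U \<subseteq> V"
    and h: "smooth_fun m V h" and x: "x \<in> U" and i: "i < n"
  shows "((\<lambda>t. h (F (x(i := t)))) has_real_derivative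
     (\<Sum>j<m. partial j h (F x) * partial i (\<lambda>y. F y j) x)) (at (x i))"
proof -
  have xR: "x \<in> Rn n" using open_in_subset_Rn U x by blast
  have "x i \<in> {t. x(i := t) \<in> U}" using x by simp
  then have ev: "\<forall>\<^sub>F t in at (x i). x(i := t) \<in> U"
    using eventually_at_in_open'[OF open_in_line[OF U xR i]] by simp
  have "((\<lambda>t. h (F (x(i := t)))) has_real_derivative
     (\<Sum>j<m. partial j h (F (x(i := x i))) * partial i (\<lambda>y. F y j) x)) (at (x i))"
  proof (rule chain_rule_curve[OF V h])
    show "F (x(i := x i)) \<in> V" using x FV by auto
    show "\<forall>\<^sub>F t in at (x i). F (x(i := t)) \<in> Rn m"
      using ev by eventually_elim (use smooth_map_in_Rn[OF F] in blast)
    fix j assume "j < m"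
    then show "((\<lambda>t. F (x(i := t)) j) has_real_derivative partial i (\<lambda>y. F y j) x) (at (x i))"
      using F smooth_fun_has_partial[OF _ x i] by (auto simp: smooth_map_def)
  qed
  then show ?thesis by simp
qed

text \<open>
  The functions that arise when a composite \<open>h \<circ> F\<close> is differentiated repeatedly. By the chain rule
  this set contains the partial derivatives of its members, so \<open>smooth_fun_coinduct\<close> yields closure
  of smoothness under composition, sums and products at the same time.
\<close>

inductive_set smooth_closure :: "nat \<Rightarrow> rvec set \<Rightarrow> nat \<Rightarrow> rvec set \<Rightarrow> (rvec \<Rightarrow> rvec) \<Rightarrow> (rvec \<Rightarrow> real) set"
  for n U m V F where
  base: "smooth_fun n U f \<Longrightarrow> f \<in> smooth_closure n U m V F"
| comp: "smooth_fun m V h \<Longrightarrow> (\<lambda>x. h (F x)) \<in> smooth_closure n U m V F"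
| add: "f \<in> smooth_closure n U m V F \<Longrightarrow> g \<in> smooth_closure n U m V F \<Longrightarrow> (\<lambda>x. f x + g x) \<in> smooth_closure n U m V F"
| mult: "f \<in> smooth_closure n U m V F \<Longrightarrow> g \<in> smooth_closure n U m V F \<Longrightarrow> (\<lambda>x. f x * g x) \<in> smooth_closure n U m V F"

lemma smooth_closure_smooth:
  assumes U: "open_in n U" and V: "open_in m V" and F: "smooth_map n U m F" and FV: "F ` U \<subseteq> V"
    and f: "f \<in> smooth_closure n U m V F"
  shows "smooth_fun n U f"
proof (rule smooth_fun_coinduct[OF U f])
  have contF: "continuous_on U F"
  proof (rule continuous_on_coordinatewise_then_product)
    fix j show "continuous_on U (\<lambda>x. F x j)"
      using smooth_fun_continuous[OF smooth_map_component[OF F U]] .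
  qed
  fix f assume "f \<in> smooth_closure n U m V F"
  then show "continuous_on U f"
  proof induction
    case (comp h)
    then show ?case using contF FV smooth_fun_continuous continuous_on_compose2 by blast
  qed (auto intro: continuous_intros smooth_fun_continuous)
next
  have sum_in: "(\<lambda>x. \<Sum>j\<in>J. g j x) \<in> smooth_closure n U m V F"
    if "finite J" "\<And>j. j \<in> J \<Longrightarrow> g j \<in> smooth_closure n U m V F" for J :: "nat set" and g
    using that
  proof (induction J rule: finite_induct)
    case empty
    then show ?case using smooth_closure.base[OF smooth_fun_const[OF U, of 0]] by simp
  next
    case (insert a J)
    then show ?case using smooth_closure.add[of "g a" n U m V F "\<lambda>x. \<Sum>j\<in>J. g j x"] by simp
  qed
  fix f i assume f: "f \<in> smooth_closure n U m V F" and i: "i < n"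
  from f show "\<exists>g\<in>smooth_closure n U m V F. \<forall>x\<in>U. ((\<lambda>t. f (x(i := t))) has_real_derivative g x) (at (x i))"
  proof induction
    case (base f)
    then show ?case using smooth_fun_has_partial[OF base _ i] smooth_fun_partial[OF base i] smooth_closure.base by blast
  next
    case (comp h)
    have "(\<lambda>x. \<Sum>j<m. partial j h (F x) * partial i (\<lambda>y. F y j) x) \<in> smooth_closure n U m V F"
      using F by (intro sum_in smooth_closure.mult smooth_closure.comp smooth_closure.base smooth_fun_partial[OF comp]
          smooth_fun_partial[OF _ i]) (auto simp: smooth_map_def)
    then show ?case using chain_rule_partial[OF U V F FV comp _ i] by (intro bexI ballI)
  next
    case (add f g)
    then obtain f' g' where *: "f' \<in> smooth_closure n U m V F" "g' \<in> smooth_closure n U m V F"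
       "\<forall>x\<in>U. ((\<lambda>t. f (x(i := t))) has_real_derivative f' x) (at (x i))"
       "\<forall>x\<in>U. ((\<lambda>t. g (x(i := t))) has_real_derivative g' x) (at (x i))" by blast
    show ?case
      by (rule bexI[OF _ smooth_closure.add[OF *(1,2)]], rule ballI, rule DERIV_add) (use *(3,4) in blast)+
  next
    case (mult f g)
    then obtain f' g' where *: "f' \<in> smooth_closure n U m V F" "g' \<in> smooth_closure n U m V F"
       "\<forall>x\<in>U. ((\<lambda>t. f (x(i := t))) has_real_derivative f' x) (at (x i))"
       "\<forall>x\<in>U. ((\<lambda>t. g (x(i := t))) has_real_derivative g' x) (at (x i))" by blast
    show ?case
    proof (rule bexI[OF _ smooth_closure.add[OF smooth_closure.mult[OF mult.hyps(1) *(2)]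
        smooth_closure.mult[OF *(1) mult.hyps(2)]]], rule ballI)
      fix x assume x: "x \<in> U"
      show "((\<lambda>t. f (x(i := t)) * g (x(i := t))) has_real_derivative f x * g' x + f' x * g x) (at (x i))"
        using DERIV_mult'[OF *(3)[rule_format, OF x] *(4)[rule_format, OF x]] by simp
    qed
  qed
qed

lemma smooth_fun_comp:
  assumes "open_in n U" "open_in m V" "smooth_map n U m F" "F ` U \<subseteq> V" "smooth_fun m V h"
  shows "smooth_fun n U (\<lambda>x. h (F x))"
  by (rule smooth_closure_smooth[OF assms(1-4) smooth_closure.comp[OF assms(5)]])

lemma smooth_map_id: "open_in n U \<Longrightarrow> smooth_map n U n (\<lambda>x. x)"
  using openin_imp_subset by (auto simp: smooth_map_def intro: smooth_fun_coord)

lemma smooth_map_const: "open_in n W \<Longrightarrow> v \<in> Rn m \<Longrightarrow> smooth_map n W m (\<lambda>_. v)"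
  by (auto simp: smooth_map_def intro: smooth_fun_const)

lemma smooth_fun_add:
  assumes "open_in n U" "smooth_fun n U f" "smooth_fun n U g" shows "smooth_fun n U (\<lambda>x. f x + g x)"
  using smooth_closure_smooth[OF assms(1) assms(1) smooth_map_id[OF assms(1)] _
      smooth_closure.add[OF smooth_closure.base[OF assms(2)] smooth_closure.base[OF assms(3)]]] by simp

lemma smooth_fun_mult:
  assumes "open_in n U" "smooth_fun n U f" "smooth_fun n U g" shows "smooth_fun n U (\<lambda>x. f x * g x)"
  using smooth_closure_smooth[OF assms(1) assms(1) smooth_map_id[OF assms(1)] _
      smooth_closure.mult[OF smooth_closure.base[OF assms(2)] smooth_closure.base[OF assms(3)]]] by simp

lemma smooth_fun_sum:
  assumes "open_in n U" "\<And>j. j \<in> J \<Longrightarrow> smooth_fun n U (f j)"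
  shows "smooth_fun n U (\<lambda>x. \<Sum>j\<in>J. f j x)"
  using assms(2) by (induction J rule: infinite_finite_induct) (auto intro: smooth_fun_const smooth_fun_add assms(1))

lemma smooth_fun_diff:
  assumes "open_in n U" "smooth_fun n U f" "smooth_fun n U g" shows "smooth_fun n U (\<lambda>x. f x - g x)"
  using smooth_fun_add[OF assms(1,2) smooth_fun_mult[OF assms(1) smooth_fun_const[OF assms(1), of "-1"] assms(3)]]
  by simp

lemma smooth_map_comp:
  assumes "open_in n U" "open_in m V" "smooth_map n U m F" "F ` U \<subseteq> V" "smooth_map m V k H"
  shows "smooth_map n U k (\<lambda>x. H (F x))"
  using assms smooth_fun_comp[OF assms(1-4)] unfolding smooth_map_def by fastforce

lemma smooth_map_subset: "smooth_map n U m f \<Longrightarrow> V \<subseteq> U \<Longrightarrow> smooth_map n V m f"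
  unfolding smooth_map_def by (blast intro: smooth_fun_subset)

lemma smooth_map_cong:
  assumes U: "open_in n U" and f: "smooth_map n U m f" and eq: "\<And>x. x \<in> U \<Longrightarrow> f x = g x"
  shows "smooth_map n U m g"
proof -
  have "smooth_fun n U (\<lambda>x. g x j)" if "j < m" for j
    using smooth_fun_cong[OF U, of "\<lambda>x. f x j" "\<lambda>x. g x j"] f eq that by (auto simp: smooth_map_def)
  then show ?thesis using f eq by (auto simp: smooth_map_def)
qed

text \<open>
  Differentials and brackets are defined componentwise; each component is an expression in this
  real-valued derivation, which obeys the Leibniz and chain rules.
\<close>

definition dir_deriv :: "nat \<Rightarrow> (rvec \<Rightarrow> real) \<Rightarrow> rvec \<Rightarrow> rvec \<Rightarrow> real" where
  "dir_deriv n f x v = (\<Sum>i<n. partial i f x * v i)"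

lemma differential_dir_deriv: "differential n F x v j = dir_deriv n (\<lambda>y. F y j) x v"
  by (simp add: differential_def dir_deriv_def)

lemma commutator_dir_deriv:
  "commutator n X Y x j = dir_deriv n (\<lambda>y. Y y j) x (X x) - dir_deriv n (\<lambda>y. X y j) x (Y x)"
  by (simp add: commutator_def dir_deriv_def sum_subtractf mult.commute)

lemma dir_deriv_add: "dir_deriv n f x (v + w) = dir_deriv n f x v + dir_deriv n f x w"
  by (simp add: dir_deriv_def algebra_simps sum.distrib)

lemma dir_deriv_scale: "dir_deriv n f x (c *\<^sub>R v) = c * dir_deriv n f x v"
  by (simp add: dir_deriv_def sum_distrib_left scaleR_fun_def mult_ac)

lemma dir_deriv_cong:
  assumes "open_in n U" "x \<in> U" "\<And>y. y \<in> U \<Longrightarrow> f y = g y"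
  shows "dir_deriv n f x v = dir_deriv n g x v"
  unfolding dir_deriv_def using partial_cong[OF assms(1,2) _ assms(3)] by simp

lemma dir_deriv_chain:
  assumes U: "open_in n U" and V: "open_in m V" and F: "smooth_map n U m F" and FV: "F ` U \<subseteq> V"
    and h: "smooth_fun m V h" and x: "x \<in> U"
  shows "dir_deriv n (\<lambda>y. h (F y)) x v = dir_deriv m h (F x) (differential n F x v)"
proof -
  have "dir_deriv n (\<lambda>y. h (F y)) x v = (\<Sum>i<n. (\<Sum>j<m. partial j h (F x) * partial i (\<lambda>y. F y j) x) * v i)"
    unfolding dir_deriv_def using partial_eqI[OF chain_rule_partial[OF assms]] by simp
  also have "\<dots> = (\<Sum>j<m. \<Sum>i<n. partial j h (F x) * partial i (\<lambda>y. F y j) x * v i)"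
    by (subst sum.swap) (simp add: sum_distrib_right)
  finally show ?thesis by (simp add: dir_deriv_def differential_def sum_distrib_left mult_ac)
qed

lemma partial_mult:
  assumes "smooth_fun n U f" "smooth_fun n U g" "x \<in> U" "i < n"
  shows "partial i (\<lambda>y. f y * g y) x = partial i f x * g x + partial i g x * f x"
  by (rule partial_eqI)
     (auto intro!: derivative_eq_intros smooth_fun_has_partial[OF assms(1,3,4)] smooth_fun_has_partial[OF assms(2,3,4)])

lemma partial_add:
  assumes "smooth_fun n U f" "smooth_fun n U g" "x \<in> U" "i < n"
  shows "partial i (\<lambda>y. f y + g y) x = partial i f x + partial i g x"
  by (rule partial_eqI)
     (auto intro!: derivative_eq_intros smooth_fun_has_partial[OF assms(1,3,4)] smooth_fun_has_partial[OF assms(2,3,4)])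

lemma partial_const [simp]: "partial i (\<lambda>_. c) x = 0"
  by (rule partial_eqI) simp

lemma partial_coord: "partial i (\<lambda>y. y k) x = (if i = k then 1 else 0)"
  by (rule partial_eqI) (auto intro!: derivative_eq_intros)

lemma dir_deriv_mult:
  assumes "smooth_fun n U f" "smooth_fun n U g" "x \<in> U"
  shows "dir_deriv n (\<lambda>y. f y * g y) x v = dir_deriv n f x v * g x + f x * dir_deriv n g x v"
  unfolding dir_deriv_def using partial_mult[OF assms]
  by (simp add: sum.distrib sum_distrib_left sum_distrib_right algebra_simps)

lemma dir_deriv_plus:
  assumes "smooth_fun n U f" "smooth_fun n U g" "x \<in> U"
  shows "dir_deriv n (\<lambda>y. f y + g y) x v = dir_deriv n f x v + dir_deriv n g x v"
  unfolding dir_deriv_def using partial_add[OF assms] by (simp add: sum.distrib algebra_simps)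

lemma dir_deriv_diff:
  assumes "smooth_fun n U f" "smooth_fun n U g" "x \<in> U"
  shows "dir_deriv n (\<lambda>y. f y - g y) x v = dir_deriv n f x v - dir_deriv n g x v"
proof -
  have "partial i (\<lambda>y. f y - g y) x = partial i f x - partial i g x" if "i < n" for i
    by (rule partial_eqI DERIV_diff smooth_fun_has_partial[OF assms(1,3) that] smooth_fun_has_partial[OF assms(2,3) that])+
  then show ?thesis unfolding dir_deriv_def by (simp add: left_diff_distrib sum_subtractf)
qed

lemma dir_deriv_const [simp]: "dir_deriv n (\<lambda>_. c) x v = 0"
  by (simp add: dir_deriv_def)

lemma dir_deriv_coord: "k < n \<Longrightarrow> dir_deriv n (\<lambda>y. y k) x v = v k"
  by (simp add: dir_deriv_def partial_coord if_distrib [of "\<lambda>z. z * _"] cong: if_cong)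

lemma dir_deriv_fun_sum:
  assumes "open_in n U" "\<And>j. j \<in> J \<Longrightarrow> smooth_fun n U (f j)" "x \<in> U"
  shows "dir_deriv n (\<lambda>y. \<Sum>j\<in>J. f j y) x v = (\<Sum>j\<in>J. dir_deriv n (f j) x v)"
  using assms(2)
proof (induction J rule: infinite_finite_induct)
  case (insert a J)
  have "smooth_fun n U (\<lambda>y. \<Sum>j\<in>J. f j y)" using insert.prems by (intro smooth_fun_sum assms(1)) auto
  then show ?case using insert dir_deriv_plus[of n U "f a" "\<lambda>y. \<Sum>j\<in>J. f j y" x v] assms(3) by simp
qed auto

lemma smooth_fun_dir_deriv:
  assumes "open_in n U" "smooth_fun n U f" "smooth_map n U n X"
  shows "smooth_fun n U (\<lambda>x. dir_deriv n f x (X x))"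
  unfolding dir_deriv_def using assms
  by (intro smooth_fun_sum smooth_fun_mult smooth_fun_partial) (auto simp: smooth_map_def)

section \<open>Lie brackets of vector fields\<close>

text \<open>
  Two applications of the mean value theorem, to the increment in direction \<open>j\<close> as a function of
  coordinate \<open>i\<close> and to \<open>\<partial>\<^sub>i f\<close> as a function of coordinate \<open>j\<close>. The left-hand side is symmetric in
  \<open>i\<close> and \<open>j\<close>, which is the reason why partial derivatives commute.
\<close>

lemma second_difference:
  assumes f: "smooth_fun n U f" and ij: "i < n" "j < n" "i \<noteq> j" and h: "h > 0"
    and box: "\<And>s t. a \<le> s \<Longrightarrow> s \<le> a + h \<Longrightarrow> b \<le> t \<Longrightarrow> t \<le> b + h \<Longrightarrow> x(i := s, j := t) \<in> U"
  shows "\<exists>s t. a \<le> s \<and> s \<le> a + h \<and> b \<le> t \<and> t \<le> b + h \<and>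
    f (x(i := a + h, j := b + h)) - f (x(i := a + h, j := b)) - f (x(i := a, j := b + h)) + f (x(i := a, j := b))
      = h * h * partial j (partial i f) (x(i := s, j := t))"
proof -
  let ?p = "\<lambda>s t. x(i := s, j := t)"
  have tw: "?p s t = x(j := t, i := s)" for s t using ij(3) by (simp add: fun_upd_twist)
  have di: "((\<lambda>s. f (?p s t)) has_real_derivative partial i f (?p s t)) (at s)"
    if "a \<le> s" "s \<le> a + h" "b \<le> t" "t \<le> b + h" for s t
    using smooth_fun_has_partial_line[OF f, of "x(j := t)" i s] box[OF that] ij(1) by (simp add: tw)
  have dj: "(partial i f \<circ> ?p s has_real_derivative partial j (partial i f) (?p s t)) (at t)"
    if "a \<le> s" "s \<le> a + h" "b \<le> t" "t \<le> b + h" for s t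
    using smooth_fun_has_partial_line[OF smooth_fun_partial[OF f ij(1)], of "x(i := s)" j t] box[OF that] ij(2)
    by (simp add: o_def)
  have "\<exists>z>a. z < a + h \<and> (f (?p (a + h) (b + h)) - f (?p (a + h) b)) - (f (?p a (b + h)) - f (?p a b)) =
     (a + h - a) * (partial i f (?p z (b + h)) - partial i f (?p z b))"
    using h by (intro MVT2[where f = "\<lambda>s. f (?p s (b + h)) - f (?p s b)"] DERIV_diff di) auto
  then obtain s where s: "a < s" "s < a + h"
    "(f (?p (a + h) (b + h)) - f (?p (a + h) b)) - (f (?p a (b + h)) - f (?p a b)) =
     (a + h - a) * (partial i f (?p s (b + h)) - partial i f (?p s b))" by blast
  have "\<exists>z>b. z < b + h \<and> (partial i f \<circ> ?p s) (b + h) - (partial i f \<circ> ?p s) b =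
     (b + h - b) * partial j (partial i f) (?p s z)"
    using h s by (intro MVT2 dj) auto
  then obtain t where t: "b < t" "t < b + h" "(partial i f \<circ> ?p s) (b + h) - (partial i f \<circ> ?p s) b =
     (b + h - b) * partial j (partial i f) (?p s t)" by blast
  show ?thesis
    using s t by (intro exI[of _ s] exI[of _ t]) (simp add: algebra_simps)
qed

lemma partial_commute:
  assumes U: "open_in n U" and f: "smooth_fun n U f" and x: "x \<in> U" and ij: "i < n" "j < n"
  shows "partial i (partial j f) x = partial j (partial i f) x"
proof (rule ccontr)
  let ?A = "partial i (partial j f)" and ?B = "partial j (partial i f)"
  assume ne: "?A x \<noteq> ?B x"
  define e where "e = \<bar>?A x - ?B x\<bar> / 2"
  have e: "e > 0" using ne by (simp add: e_def)
  have xR: "x \<in> Rn n" using U x open_in_subset_Rn by blast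
  obtain d1 where d1: "d1 > 0" "\<And>y. y \<in> Rn n \<Longrightarrow> \<forall>k<n. \<bar>y k - x k\<bar> < d1 \<Longrightarrow> y \<in> U \<and> \<bar>?A y - ?A x\<bar> < e"
    using continuous_in_box[OF U x smooth_fun_continuous[OF smooth_fun_partial[OF smooth_fun_partial[OF f ij(2)] ij(1)]] e] by blast
  obtain d2 where d2: "d2 > 0" "\<And>y. y \<in> Rn n \<Longrightarrow> \<forall>k<n. \<bar>y k - x k\<bar> < d2 \<Longrightarrow> y \<in> U \<and> \<bar>?B y - ?B x\<bar> < e"
    using continuous_in_box[OF U x smooth_fun_continuous[OF smooth_fun_partial[OF smooth_fun_partial[OF f ij(1)] ij(2)]] e] by blast
  define h where "h = min d1 d2 / 2"
  have h: "h > 0" "h < d1" "h < d2" using d1(1) d2(1) by (auto simp: h_def)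
  have box: "x(i := s, j := t) \<in> U \<and> \<bar>?A (x(i := s, j := t)) - ?A x\<bar> < e \<and> \<bar>?B (x(i := s, j := t)) - ?B x\<bar> < e"
    if "x i \<le> s" "s \<le> x i + h" "x j \<le> t" "t \<le> x j + h" for s t
  proof -
    have "x(i := s, j := t) \<in> Rn n" using xR ij by (auto simp: Rn_def)
    moreover have "\<forall>k<n. \<bar>(x(i := s, j := t)) k - x k\<bar> < d1" "\<forall>k<n. \<bar>(x(i := s, j := t)) k - x k\<bar> < d2"
      using that h d1(1) d2(1) by auto
    ultimately show ?thesis using d1(2) d2(2) by blast
  qed
  have neq: "i \<noteq> j" using ne by auto
  have tw: "x(i := s, j := t) = x(j := t, i := s)" for s t using neq by (simp add: fun_upd_twist)
  obtain s t where st: "x i \<le> s" "s \<le> x i + h" "x j \<le> t" "t \<le> x j + h"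
    "f (x(i := x i + h, j := x j + h)) - f (x(i := x i + h, j := x j)) - f (x(i := x i, j := x j + h)) + f (x(i := x i, j := x j))
      = h * h * ?B (x(i := s, j := t))"
    using second_difference[OF f ij neq h(1), of "x i" "x j" x] box by blast
  obtain s' t' where st': "x j \<le> s'" "s' \<le> x j + h" "x i \<le> t'" "t' \<le> x i + h"
    "f (x(j := x j + h, i := x i + h)) - f (x(j := x j + h, i := x i)) - f (x(j := x j, i := x i + h)) + f (x(j := x j, i := x i))
      = h * h * ?A (x(j := s', i := t'))"
    using second_difference[OF f ij(2,1) neq[symmetric] h(1), of "x j" "x i" x] box tw by (metis (no_types, lifting))
  have "h * h * ?A (x(i := t', j := s')) = h * h * ?B (x(i := s, j := t))"
    using st(5) st'(5) unfolding tw by linarith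
  then have "?A (x(i := t', j := s')) = ?B (x(i := s, j := t))" using h(1) by simp
  moreover have "\<bar>?A (x(i := t', j := s')) - ?A x\<bar> < e" using box[OF st'(3,4,1,2)] by blast
  moreover have "\<bar>?B (x(i := s, j := t)) - ?B x\<bar> < e" using box[OF st(1-4)] by blast
  ultimately have "\<bar>?A x - ?B x\<bar> < 2 * e" by linarith
  then show False by (simp add: e_def)
qed

text \<open>
  The bracket of vector fields, defined here in coordinates, is the commutator of derivations: the
  terms with second derivatives of \<open>f\<close> cancel by \<open>partial_commute\<close>.
\<close>

lemma dir_deriv_commutator:
  assumes U: "open_in n U" and f: "smooth_fun n U f" and X: "smooth_map n U n X" and Y: "smooth_map n U n Y" and x: "x \<in> U"
  shows "dir_deriv n f x (commutator n X Y x) = dir_deriv n (\<lambda>y. dir_deriv n f y (Y y)) x (X x) - dir_deriv n (\<lambda>y. dir_deriv n f y (X y)) x (Y x)"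
proof -
  have *: "dir_deriv n (\<lambda>y. dir_deriv n f y (B y)) x v =
     (\<Sum>j<n. dir_deriv n (partial j f) x v * B x j) + (\<Sum>j<n. partial j f x * dir_deriv n (\<lambda>y. B y j) x v)"
    if B: "smooth_map n U n B" for B v
  proof -
    have "dir_deriv n (\<lambda>y. \<Sum>j<n. partial j f y * B y j) x v = (\<Sum>j<n. dir_deriv n (\<lambda>y. partial j f y * B y j) x v)"
      using f B by (intro dir_deriv_fun_sum[OF U _ x] smooth_fun_mult[OF U] smooth_fun_partial) (auto simp: smooth_map_def)
    also have "\<dots> = (\<Sum>j<n. dir_deriv n (partial j f) x v * B x j + partial j f x * dir_deriv n (\<lambda>y. B y j) x v)"
      using dir_deriv_mult[OF smooth_fun_partial[OF f] _ x] B by (intro sum.cong refl) (auto simp: smooth_map_def)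
    finally show ?thesis by (simp add: dir_deriv_def [of n f] sum.distrib)
  qed
  have "(\<Sum>j<n. dir_deriv n (partial j f) x (X x) * Y x j) = (\<Sum>j<n. \<Sum>i<n. partial i (partial j f) x * X x i * Y x j)"
    by (simp add: dir_deriv_def sum_distrib_right)
  also have "\<dots> = (\<Sum>j<n. \<Sum>i<n. partial j (partial i f) x * X x i * Y x j)"
    using partial_commute[OF U f x] by simp
  also have "\<dots> = (\<Sum>i<n. \<Sum>j<n. partial j (partial i f) x * X x i * Y x j)"
    by (rule sum.swap)
  also have "\<dots> = (\<Sum>j<n. dir_deriv n (partial j f) x (Y x) * X x j)"
    by (simp add: dir_deriv_def sum_distrib_right sum_distrib_left mult_ac)
  finally have sym: "(\<Sum>j<n. dir_deriv n (partial j f) x (X x) * Y x j) = (\<Sum>j<n. dir_deriv n (partial j f) x (Y x) * X x j)" .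
  have "dir_deriv n f x (commutator n X Y x) = (\<Sum>j<n. partial j f x * dir_deriv n (\<lambda>y. Y y j) x (X x)) -
      (\<Sum>j<n. partial j f x * dir_deriv n (\<lambda>y. X y j) x (Y x))"
    unfolding dir_deriv_def[of n f] commutator_dir_deriv by (simp only: right_diff_distrib sum_subtractf)
  then show ?thesis
    using *[OF X, of "Y x"] *[OF Y, of "X x"] sym by linarith
qed

text \<open>
  Brackets of \<open>f\<close>-related vector fields are \<open>f\<close>-related. This is used for diffeomorphisms, in the
  invariance of the derived flag, and for left translations, in the invariance of brackets of
  left-invariant fields.
\<close>

lemma commutator_related:
  assumes U: "open_in n U" and V: "open_in m V" and f: "smooth_map n U m f" and fV: "f ` U \<subseteq> V"
    and X: "smooth_map n U n X" and Y: "smooth_map n U n Y"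
    and X': "smooth_map m V m X'" and Y': "smooth_map m V m Y'"
    and rX: "\<And>x. x \<in> U \<Longrightarrow> differential n f x (X x) = X' (f x)"
    and rY: "\<And>x. x \<in> U \<Longrightarrow> differential n f x (Y x) = Y' (f x)"
    and x: "x \<in> U"
  shows "differential n f x (commutator n X Y x) = commutator m X' Y' (f x)"
proof
  fix j
  have eq: "dir_deriv n (\<lambda>y. dir_deriv n (\<lambda>z. f z j) y (B y)) x v = dir_deriv m (\<lambda>y. B' y j) (f x) (differential n f x v)"
    if B': "smooth_map m V m B'" and r: "\<And>x. x \<in> U \<Longrightarrow> differential n f x (B x) = B' (f x)" for B B' v
  proof -
    have "dir_deriv n (\<lambda>z. f z j) y (B y) = B' (f y) j" if "y \<in> U" for y
      using r[OF that] differential_dir_deriv[of n f y "B y" j] by simp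
    then have "dir_deriv n (\<lambda>y. dir_deriv n (\<lambda>z. f z j) y (B y)) x v = dir_deriv n (\<lambda>y. B' (f y) j) x v"
      by (rule dir_deriv_cong[OF U x])
    then show ?thesis using dir_deriv_chain[OF U V f fV smooth_map_component[OF B' V] x] by simp
  qed
  have "differential n f x (commutator n X Y x) j =
     dir_deriv n (\<lambda>y. dir_deriv n (\<lambda>z. f z j) y (Y y)) x (X x) - dir_deriv n (\<lambda>y. dir_deriv n (\<lambda>z. f z j) y (X y)) x (Y x)"
    unfolding differential_dir_deriv by (rule dir_deriv_commutator[OF U smooth_map_component[OF f U] X Y x])
  also have "\<dots> = commutator m X' Y' (f x) j"
    using eq[of X' X "Y x", OF X' rX] eq[of Y' Y "X x", OF Y' rY]
    by (simp only: commutator_dir_deriv rX[OF x] rY[OF x])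
  finally show "differential n f x (commutator n X Y x) j = commutator m X' Y' (f x) j" .
qed

lemma differential_cong:
  assumes "open_in n U" "x \<in> U" "\<And>y. y \<in> U \<Longrightarrow> F y = H y"
  shows "differential n F x v = differential n H x v"
proof
  fix j show "differential n F x v j = differential n H x v j"
    unfolding differential_dir_deriv by (rule dir_deriv_cong[OF assms(1,2)]) (simp add: assms(3))
qed

lemma differential_chain:
  assumes U: "open_in n U" and V: "open_in m V" and F: "smooth_map n U m F" and FV: "F ` U \<subseteq> V"
    and h: "smooth_map m V k H" and x: "x \<in> U"
  shows "differential n (\<lambda>y. H (F y)) x v = differential m H (F x) (differential n F x v)"
  using dir_deriv_chain[OF U V F FV smooth_map_component[OF h V] x] by (auto simp: differential_dir_deriv fun_eq_iff)

lemma differential_ident: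
  assumes U: "open_in n U" and x: "x \<in> U" and F: "\<And>y. y \<in> U \<Longrightarrow> F y = y" and v: "v \<in> Rn n"
  shows "differential n F x v = v"
proof
  fix j
  have "differential n F x v j = dir_deriv n (\<lambda>y. y j) x v"
    unfolding differential_dir_deriv by (rule dir_deriv_cong[OF U x]) (simp add: F)
  also have "\<dots> = v j"
    using v by (cases "j < n") (auto simp: dir_deriv_coord Rn_def, auto simp: dir_deriv_def partial_coord)
  finally show "differential n F x v j = v j" .
qed

lemma linear_differential: "linear (differential n F x)"
proof (rule linearI)
  show "differential n F x (v + w) = differential n F x v + differential n F x w" for v w
    by (rule ext) (simp add: differential_dir_deriv dir_deriv_add)
  show "differential n F x (c *\<^sub>R v) = c *\<^sub>R differential n F x v" for c v
    by (rule ext) (simp only: differential_dir_deriv dir_deriv_scale scaleR_fun_def[where f = "differential n F x v"] real_scaleR_def)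
qed

lemma subspace_Rn: "subspace (Rn n)"
  by (auto simp: subspace_def Rn_def scaleR_fun_def)

lemma differential_in_Rn:
  assumes "open_in n U" "smooth_map n U m F" "x \<in> U"
  shows "differential n F x v \<in> Rn m"
proof -
  have "differential n F x v j = 0" if "j \<ge> m" for j
  proof -
    have "dir_deriv n (\<lambda>y. F y j) x v = dir_deriv n (\<lambda>y. 0) x v"
      using assms smooth_map_in_Rn[OF assms(2)] that by (intro dir_deriv_cong[OF assms(1,3)]) (auto simp: Rn_def)
    then show ?thesis by (simp add: differential_dir_deriv)
  qed
  then show ?thesis by (simp add: Rn_def)
qed

lemma commutator_in_Rn:
  assumes "open_in n U" "smooth_map n U n X" "smooth_map n U n Y" "x \<in> U"
  shows "commutator n X Y x \<in> Rn n"
proof -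
  have "commutator n X Y x j = differential n Y x (X x) j - differential n X x (Y x) j" for j
    by (simp add: commutator_dir_deriv differential_dir_deriv)
  then show ?thesis using differential_in_Rn[OF assms(1)] assms by (simp add: Rn_def)
qed

lemma smooth_map_differential:
  assumes U: "open_in n U" and F: "smooth_map n U m F" and X: "smooth_map n U n X"
  shows "smooth_map n U m (\<lambda>x. differential n F x (X x))"
  unfolding smooth_map_def
proof (intro conjI allI impI)
  show "(\<lambda>x. differential n F x (X x)) ` U \<subseteq> Rn m" using differential_in_Rn[OF U F] by blast
  fix j assume "j < m"
  then show "smooth_fun n U (\<lambda>x. differential n F x (X x) j)"
    unfolding differential_dir_deriv by (intro smooth_fun_dir_deriv[OF U _ X] smooth_map_component[OF F U])
qed

lemma smooth_map_continuous:
  assumes "open_in n U" "smooth_map n U m F" shows "continuous_on U F"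
proof (rule continuous_on_coordinatewise_then_product)
  fix j show "continuous_on U (\<lambda>x. F x j)"
    using smooth_fun_continuous[OF smooth_map_component[OF assms(2,1)]] .
qed

section \<open>Invariance of the derived flag\<close>

text \<open>
  A diffeomorphism pushes local sections forward to local sections, and by \<open>commutator_related\<close> it
  respects their brackets. Applied to the inverse as well, this gives the equality in
  \<open>derived_flag_diffeo\<close>.
\<close>

lemma derived_flag_push:
  assumes U: "open_in n U" "U \<subseteq> M" and V: "open_in m V" "V \<subseteq> N"
    and f: "smooth_map n U m f" "f ` U \<subseteq> V" and g: "smooth_map m V n g" "g ` V \<subseteq> U"
    and gf: "\<And>x. x \<in> U \<Longrightarrow> g (f x) = x" and fg: "\<And>y. y \<in> V \<Longrightarrow> f (g y) = y"
    and DE: "\<And>x. x \<in> U \<Longrightarrow> differential n f x ` D x \<subseteq> E (f x)"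
  shows "x \<in> U \<Longrightarrow> v \<in> derived_flag n M D i x \<Longrightarrow> differential n f x v \<in> derived_flag m N E i (f x)"
proof (induction i arbitrary: x v rule: induct_nat_012)
  case 0
  then have "v = 0" by simp
  then show ?case using linear_0[OF linear_differential] unfolding derived_flag.simps by blast
next
  case 1
  then show ?case using DE by auto
next
  case (ge2 i)
  define S where "S = {commutator n X Y x | X Y W.
       open_in n W \<and> x \<in> W \<and> W \<subseteq> M \<and>
       X \<in> sections n W D \<and> Y \<in> sections n W (derived_flag n M D (Suc i))}"
  define T where "T = {commutator m X Y (f x) | X Y W.
       open_in m W \<and> f x \<in> W \<and> W \<subseteq> N \<and>
       X \<in> sections m W E \<and> Y \<in> sections m W (derived_flag m N E (Suc i))}"
  have "differential n f x ` S \<subseteq> T"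
  proof safe
    fix s assume "s \<in> S"
    then obtain X Y W where W: "open_in n W" "x \<in> W" "W \<subseteq> M" and
      XY: "X \<in> sections n W D" "Y \<in> sections n W (derived_flag n M D (Suc i))" and s: "s = commutator n X Y x"
      unfolding S_def by blast
    define W' where "W' = V \<inter> g -` (W \<inter> U)"
    have oWU: "open_in n (W \<inter> U)" using W U by blast
    have oW': "open_in m W'"
    proof -
      have "openin (top_of_set V) W'"
        unfolding W'_def using smooth_map_continuous[OF V(1) g(1)] smooth_map_in_Rn[OF g(1)] oWU
        by (intro continuous_openin_preimage[of _ _ "Rn n"]) auto
      then show ?thesis using V(1) openin_trans by blast
    qed
    define push where "push Z y = differential n f (g y) (Z (g y))" for Z y
    have gW': "smooth_map m W' n g" "g ` W' \<subseteq> W \<inter> U"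
      using smooth_map_subset[OF g(1)] by (auto simp: W'_def)
    have fWU: "smooth_map n (W \<inter> U) m f" using smooth_map_subset[OF f(1)] by auto
    have sm: "smooth_map m W' m (push Z)" if "smooth_map n W n Z" for Z
      unfolding push_def
      using smooth_map_comp[OF oW' oWU gW' smooth_map_differential[OF oWU fWU smooth_map_subset[OF that]]] by auto
    have XYs: "smooth_map n W n X" "smooth_map n W n Y" using XY by (auto simp: sections_def)
    have "push X \<in> sections m W' E"
      unfolding sections_def using sm[OF XYs(1)] DE XY(1) gW'(2) fg
      by (fastforce simp: push_def sections_def W'_def)
    moreover have "push Y \<in> sections m W' (derived_flag m N E (Suc i))"
    proof -
      have "push Y y \<in> derived_flag m N E (Suc i) y" if "y \<in> W'" for y
        using ge2.IH(2)[of "g y" "Y (g y)"] XY(2) gW'(2) fg that by (auto simp: push_def sections_def W'_def)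
      then show ?thesis unfolding sections_def using sm[OF XYs(2)] by auto
    qed
    moreover have "f x \<in> W'" "W' \<subseteq> N" using ge2.prems(1) f(2) gf W V by (auto simp: W'_def)
    moreover have "differential n f x (commutator n X Y x) = commutator m (push X) (push Y) (f x)"
    proof (rule commutator_related[OF oWU oW' fWU])
      show "f ` (W \<inter> U) \<subseteq> W'" using f(2) gf by (auto simp: W'_def)
    qed (use gf sm XYs smooth_map_subset ge2.prems(1) W(2) in \<open>auto simp: push_def\<close>)
    ultimately show "differential n f x s \<in> T"
      unfolding T_def s using oW' by blast
  qed
  then have "differential n f x ` span S \<subseteq> span T"
    using linear_span_image[OF linear_differential] span_mono by metis
  then show ?case using ge2.prems(2) by (auto simp: S_def T_def)
qed

lemma derived_flag_in_Rn:
  assumes "D x \<subseteq> Rn n" shows "derived_flag n M D i x \<subseteq> Rn n"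
proof -
  consider "i = 0" | "i = Suc 0" | k where "i = Suc (Suc k)" by (metis not0_implies_Suc)
  then show ?thesis
  proof cases
    case 1 then show ?thesis using subspace_0[OF subspace_Rn] by simp
  next
    case 2 then show ?thesis using assms by simp
  next
    case 3
    show ?thesis unfolding 3 derived_flag.simps
    proof (rule span_minimal[OF _ subspace_Rn], rule subsetI, elim CollectE exE conjE)
      fix c X Y W
      assume "c = commutator n X Y x" "open_in n W" "x \<in> W" "X \<in> sections n W D" "Y \<in> sections n W (derived_flag n M D (Suc k))"
      then show "c \<in> Rn n" using commutator_in_Rn by (auto simp: sections_def)
    qed
  qed
qed

lemma derived_flag_diffeo:
  assumes U: "open_in n U" "U \<subseteq> M" and V: "open_in m V" "V \<subseteq> N" and f: "diffeo n U m V f"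
    and DE: "\<And>x. x \<in> U \<Longrightarrow> differential n f x ` D x = E (f x)"
    and DR: "\<And>x. x \<in> U \<Longrightarrow> D x \<subseteq> Rn n" and ER: "\<And>y. y \<in> V \<Longrightarrow> E y \<subseteq> Rn m" and x: "x \<in> U"
  shows "differential n f x ` derived_flag n M D i x = derived_flag m N E i (f x)"
    and "inj_on (differential n f x) (Rn n)" and "differential n f x ` Rn n = Rn m"
proof -
  define h where "h = inv_into U f"
  have bij: "bij_betw f U V" and sf: "smooth_map n U m f" and sh: "smooth_map m V n h"
    using f by (auto simp: diffeo_def h_def)
  have fU: "f ` U = V" "h ` V = U" using bij bij_betw_inv_into[OF bij] by (auto simp: bij_betw_def h_def)
  have hf: "h (f x) = x" if "x \<in> U" for x using bij that by (simp add: h_def bij_betw_inv_into_left)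
  have fh: "f (h y) = y" if "y \<in> V" for y using bij that by (simp add: h_def bij_betw_inv_into_right)
  have dhf: "differential m h (f x) (differential n f x v) = v" if "x \<in> U" "v \<in> Rn n" for x v
  proof -
    have "differential n (\<lambda>y. h (f y)) x v = differential m h (f x) (differential n f x v)"
      using fU by (intro differential_chain[OF U(1) V(1) sf _ sh that(1)]) auto
    then show ?thesis using differential_ident[OF U(1) that(1) hf that(2)] by simp
  qed
  have fx: "f x \<in> V" using x fU by blast
  have dfh: "differential n f x (differential m h (f x) w) = w" if "w \<in> Rn m" for w
  proof -
    have "differential m (\<lambda>y. f (h y)) (f x) w = differential n f (h (f x)) (differential m h (f x) w)"
      using fU by (intro differential_chain[OF V(1) U(1) sh _ sf fx]) auto
    then show ?thesis using differential_ident[OF V(1) fx fh that] hf[OF x] by simp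
  qed
  have ED: "differential m h y ` E y \<subseteq> D (h y)" if y: "y \<in> V" for y
  proof -
    have hy: "h y \<in> U" using fU y by blast
    have "E y = differential n f (h y) ` D (h y)" using DE[OF hy] fh[OF y] by simp
    then show ?thesis using dhf[OF hy] fh[OF y] DR[OF hy] by (auto simp: subset_iff)
  qed
  have 1: "differential n f x v \<in> derived_flag m N E i (f x)" if "v \<in> derived_flag n M D i x" for v
    using derived_flag_push[OF U V sf _ sh _ hf fh _ x that] fU DE by auto
  have 2: "differential m h (f x) w \<in> derived_flag n M D i x" if "w \<in> derived_flag m N E i (f x)" for w
    using derived_flag_push[OF V U sh _ sf _ fh hf ED fx that] fU hf[OF x] by auto
  show "differential n f x ` derived_flag n M D i x = derived_flag m N E i (f x)"
  proof (rule subset_antisym)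
    show "derived_flag m N E i (f x) \<subseteq> differential n f x ` derived_flag n M D i x"
    proof
      fix w assume w: "w \<in> derived_flag m N E i (f x)"
      then have "w \<in> Rn m" using derived_flag_in_Rn[of E "f x" m N i] ER[OF fx] by blast
      then show "w \<in> differential n f x ` derived_flag n M D i x"
        using 2[OF w] dfh[of w] imageI[of _ _ "differential n f x"] by metis
    qed
  qed (use 1 in blast)
  show "inj_on (differential n f x) (Rn n)" by (rule inj_on_inverseI[of _ "differential m h (f x)"]) (rule dhf[OF x])
  show "differential n f x ` Rn n = Rn m"
  proof (rule subset_antisym)
    show "Rn m \<subseteq> differential n f x ` Rn n"
    proof
      fix w assume "w \<in> Rn m"
      then show "w \<in> differential n f x ` Rn n"
        using differential_in_Rn[OF V(1) sh fx, of w] dfh[of w] imageI[of _ _ "differential n f x"] by metis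
    qed
  qed (use differential_in_Rn[OF U(1) sf x] in blast)
qed

lemma subbundle_in_Rn:
  assumes "smooth_subbundle k n M D" "x \<in> M"
  shows "subspace (D x)" "D x \<subseteq> Rn n" "dim (D x) = k"
proof -
  from assms(1)[unfolded smooth_subbundle_def, THEN bspec, OF assms(2)]
  obtain W X where "open_in n W \<and> x \<in> W \<and> W \<subseteq> M \<and> (\<forall>j<k. smooth_map n W n (X j)) \<and>
    (\<forall>x\<in>W. D x = span ((\<lambda>j. X j x) ` {..<k}) \<and> dim (D x) = k)"
    by (elim exE) (rule that)
  then have W: "x \<in> W" "\<forall>j<k. smooth_map n W n (X j)"
    "\<forall>x\<in>W. D x = span ((\<lambda>j. X j x) ` {..<k}) \<and> dim (D x) = k" by - (elim conjE, assumption)+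
  then have D: "D x = span ((\<lambda>j. X j x) ` {..<k})" by blast
  show "subspace (D x)" unfolding D by (rule subspace_span)
  show "dim (D x) = k" using W by blast
  show "D x \<subseteq> Rn n"
    unfolding D by (rule span_minimal[OF _ subspace_Rn]) (use W smooth_map_in_Rn in blast)
qed

lemma derived_flag_subspace:
  assumes "subspace (D x)" shows "subspace (derived_flag n M D i x)"
proof -
  consider "i = 0" | "i = Suc 0" | k where "i = Suc (Suc k)" by (metis not0_implies_Suc)
  then show ?thesis by cases (use assms in auto)
qed

section \<open>Parallelisms\<close>

definition unit :: "nat \<Rightarrow> rvec" where "unit i = (\<lambda>_. 0)(i := 1)"

lemma unit_apply: "unit i j = (if j = i then 1 else 0)" by (simp add: unit_def)

lemma unit_in_Rn [simp]: "i < n \<Longrightarrow> unit i \<in> Rn n" by (simp add: Rn_def unit_apply)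

lemma sum_fun_apply: "(\<Sum>i\<in>I. f i) x = (\<Sum>i\<in>I. f i x)"
  by (induction I rule: infinite_finite_induct) auto

lemma Rn_expand: assumes "v \<in> Rn n" shows "(\<Sum>i<n. v i *\<^sub>R unit i) = v"
proof
  fix k
  have "(\<Sum>i<n. v i *\<^sub>R unit i) k = (\<Sum>i<n. if i = k then v k else 0)"
    unfolding sum_fun_apply by (intro sum.cong) (auto simp: scaleR_fun_def unit_apply)
  then show "(\<Sum>i<n. v i *\<^sub>R unit i) k = v k" using assms by (simp add: Rn_def)
qed

lemma linear_Rn_expand:
  fixes L :: "rvec \<Rightarrow> 'b::real_vector"
  assumes "linear L" "v \<in> Rn n" shows "L v = (\<Sum>i<n. v i *\<^sub>R L (unit i))"
proof -
  have "L v = L (\<Sum>i<n. v i *\<^sub>R unit i)" using Rn_expand[OF assms(2)] by simp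
  then show ?thesis using assms(1) by (simp add: linear_sum linear_scale)
qed

lemma dim_linear_image:
  fixes L :: "'a::real_vector \<Rightarrow> 'b::real_vector"
  assumes L: "linear L" and S: "subspace S" and inj: "inj_on L S"
  shows "dim (L ` S) = dim S"
proof -
  obtain B where B: "B \<subseteq> S" "independent B" "S \<subseteq> span B" "card B = dim S"
    using basis_exists[of S] by metis
  have sB: "span B = S" using B S by (metis span_minimal subset_antisym)
  have "independent (L ` B)"
    by (intro linear_independent_injective_image[OF L B(2)]) (simp add: sB inj)
  moreover have "span (L ` B) = L ` S" using linear_span_image[OF L, of B] sB by simp
  ultimately have "dim (L ` S) = card (L ` B)" by (metis dim_span_eq_card_independent)
  also have "\<dots> = card B" using inj B(1) by (meson card_image inj_on_subset)
  finally show ?thesis using B(4) by simp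
qed

text \<open>
  Membership in a subspace becomes the equation \<open>P v = v\<close>, which can be differentiated.
\<close>

lemma ex_projection:
  fixes S :: "'a::real_vector set"
  assumes "subspace S"
  obtains P :: "'a \<Rightarrow> 'a" where "linear P" "\<And>v. P v \<in> S" "\<And>v. v \<in> S \<Longrightarrow> P v = v"
proof -
  obtain B where B: "B \<subseteq> S" "independent B" "S \<subseteq> span B" using basis_exists[of S] by metis
  have sB: "span B = S" using B assms by (metis span_minimal subset_antisym)
  let ?P = "construct B (\<lambda>b. b)"
  have lin: "linear ?P" by (rule linear_construct[OF B(2)])
  moreover have "?P v \<in> S" for v using construct_in_span[OF B(2), of "\<lambda>b. b" v] sB by simp
  moreover have "?P v = v" if "v \<in> S" for v
    using linear_eq_on[OF lin linear_ident, of v B] construct_basis[OF B(2)] that B(3) by blast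
  ultimately show ?thesis using that by blast
qed

text \<open>
  Differentiate \<open>P (b y) = b y\<close> for a projection \<open>P\<close> onto \<open>S\<close>.
\<close>

lemma differential_in_subspace:
  assumes W: "open_in n W" and b: "smooth_map n W m b" and S: "subspace S" and bS: "\<And>y. y \<in> W \<Longrightarrow> b y \<in> S" and x: "x \<in> W"
  shows "differential n b x w \<in> S"
proof -
  obtain P where P: "linear P" "\<And>v. P v \<in> S" "\<And>v. v \<in> S \<Longrightarrow> P v = v" using ex_projection[OF S] by metis
  have "differential n b x w = P (differential n b x w)"
  proof
    fix j
    have Pj: "P v j = (\<Sum>i<m. v i * P (unit i) j)" if "v \<in> Rn m" for v
      using linear_Rn_expand[OF P(1) that] by (simp add: sum_fun_apply scaleR_fun_def)
    have "differential n b x w j = dir_deriv n (\<lambda>y. \<Sum>i<m. b y i * P (unit i) j) x w"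
      unfolding differential_dir_deriv
      using Pj smooth_map_in_Rn[OF b] P(3) bS by (intro dir_deriv_cong[OF W x]) metis
    also have "\<dots> = (\<Sum>i<m. dir_deriv n (\<lambda>y. b y i * P (unit i) j) x w)"
      by (intro dir_deriv_fun_sum[OF W _ x] smooth_fun_mult smooth_fun_const smooth_map_component[OF b] W)
    also have "\<dots> = (\<Sum>i<m. differential n b x w i * P (unit i) j)"
      using dir_deriv_mult[OF smooth_map_component[OF b W] smooth_fun_const[OF W] x] by (simp add: differential_dir_deriv)
    also have "\<dots> = P (differential n b x w) j"
      using Pj[OF differential_in_Rn[OF W b x]] by simp
    finally show "differential n b x w j = P (differential n b x w) j" .
  qed
  then show ?thesis using P(2) by metis
qed

text \<open>
  The algebraic counterpart of the weak derived flag, indexed in the same way, for the distribution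
  of the fields with constant coefficients in \<open>V\<close>.
\<close>

fun bracket_flag :: "(rvec \<Rightarrow> rvec \<Rightarrow> rvec) \<Rightarrow> rvec set \<Rightarrow> nat \<Rightarrow> rvec set" where
  "bracket_flag br V 0 = {0}"
| "bracket_flag br V (Suc 0) = V"
| "bracket_flag br V (Suc (Suc i)) = span (bracket_flag br V (Suc i) \<union> {br u v |u v. u \<in> V \<and> v \<in> bracket_flag br V (Suc i)})"

text \<open>
  A global frame on \<open>Rn n\<close> with constant structure. The frame is used in a form free of indices: \<open>X v\<close>
  is the vector field with constant coefficients \<open>v\<close>, \<open>coframe x\<close> is the inverse of
  \<open>v \<mapsto> X v x\<close>, and \<open>br\<close> is the bracket of coefficients. Smoothness of the coframe is stated through
  its effect on vector fields, which is how it is used: it turns a local section into smooth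
  coefficients. The two instances are the left-invariant fields of a Lie group and the frame of
  the Hilbert--Cartan equation.
\<close>

locale parallelism =
  fixes n :: nat and X :: "rvec \<Rightarrow> rvec \<Rightarrow> rvec" and coframe :: "rvec \<Rightarrow> rvec \<Rightarrow> rvec"
    and br :: "rvec \<Rightarrow> rvec \<Rightarrow> rvec"
  assumes lin_X: "linear (\<lambda>v. X v x)"
    and smooth_X: "v \<in> Rn n \<Longrightarrow> smooth_map n (Rn n) n (X v)"
    and smooth_coframe: "open_in n W \<Longrightarrow> smooth_map n W n Z \<Longrightarrow> smooth_map n W n (\<lambda>x. coframe x (Z x))"
    and X_coframe: "x \<in> Rn n \<Longrightarrow> w \<in> Rn n \<Longrightarrow> X (coframe x w) x = w"
    and coframe_X: "x \<in> Rn n \<Longrightarrow> v \<in> Rn n \<Longrightarrow> coframe x (X v x) = v"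
    and br_Rn: "u \<in> Rn n \<Longrightarrow> v \<in> Rn n \<Longrightarrow> br u v \<in> Rn n"
    and commutator_X: "u \<in> Rn n \<Longrightarrow> v \<in> Rn n \<Longrightarrow> x \<in> Rn n \<Longrightarrow>
      commutator n (X u) (X v) x = X (br u v) x"
begin

lemma X_add: "X (u + v) x = X u x + X v x"
  using linear_add[OF lin_X] .

lemma X_diff: "X (u - v) x = X u x - X v x"
  using linear_diff[OF lin_X] .

lemma X_zero: "X 0 x = 0"
  using linear_0[OF lin_X] .

lemma X_in_Rn: "v \<in> Rn n \<Longrightarrow> x \<in> Rn n \<Longrightarrow> X v x \<in> Rn n"
  using smooth_map_in_Rn[OF smooth_X] .

lemma coframe_in_Rn: "w \<in> Rn n \<Longrightarrow> x \<in> Rn n \<Longrightarrow> coframe x w \<in> Rn n"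
  using smooth_map_in_Rn[OF smooth_coframe[OF open_in_Rn smooth_map_const[OF open_in_Rn]]] .

lemma inj_X: "x \<in> Rn n \<Longrightarrow> inj_on (\<lambda>v. X v x) (Rn n)"
  using coframe_X by (intro inj_on_inverseI)

lemma image_X: "x \<in> Rn n \<Longrightarrow> (\<lambda>v. X v x) ` Rn n = Rn n"
  using X_in_Rn X_coframe coframe_in_Rn by (auto simp: image_iff) metis

lemma X_component:
  assumes "v \<in> Rn n" shows "X v x j = (\<Sum>i<n. v i * X (unit i) x j)"
  using linear_Rn_expand[OF lin_X assms, of x] by (simp add: sum_fun_apply scaleR_fun_def)

lemma smooth_frame_field:
  assumes W: "open_in n W" and b: "smooth_map n W n b"
  shows "smooth_map n W n (\<lambda>y. X (b y) y)"
  unfolding smooth_map_def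
proof (intro conjI allI impI)
  have WR: "W \<subseteq> Rn n" using W openin_imp_subset by blast
  show "(\<lambda>y. X (b y) y) ` W \<subseteq> Rn n" using X_in_Rn smooth_map_in_Rn[OF b] WR by blast
  fix j assume "j < n"
  have "smooth_fun n W (\<lambda>y. \<Sum>i<n. b y i * X (unit i) y j)"
    using smooth_fun_subset[OF smooth_map_component[OF smooth_X open_in_Rn] WR]
    by (intro smooth_fun_sum smooth_fun_mult smooth_map_component[OF b] W) auto
  then show "smooth_fun n W (\<lambda>y. X (b y) y j)"
    by (rule smooth_fun_cong[OF W]) (use X_component smooth_map_in_Rn[OF b] in simp)
qed

lemma dir_deriv_frame_field:
  assumes W: "open_in n W" and b: "smooth_map n W n b" and x: "x \<in> W"
  shows "dir_deriv n (\<lambda>y. X (b y) y j) x w = X (differential n b x w) x j + dir_deriv n (\<lambda>y. X (b x) y j) x w"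
proof -
  have WR: "W \<subseteq> Rn n" using W openin_imp_subset by blast
  have sX: "smooth_fun n W (\<lambda>y. X (unit i) y j)" if "i < n" for i
    using smooth_fun_subset[OF smooth_map_component[OF smooth_X open_in_Rn] WR] that by simp
  note sb = smooth_map_component[OF b W]
  have cst: "dir_deriv n (\<lambda>y. X (b x) y j) x w = (\<Sum>i<n. b x i * dir_deriv n (\<lambda>y. X (unit i) y j) x w)"
  proof -
    have "dir_deriv n (\<lambda>y. X (b x) y j) x w = dir_deriv n (\<lambda>y. \<Sum>i<n. b x i * X (unit i) y j) x w"
      using X_component[OF smooth_map_in_Rn[OF b x]] by simp
    also have "\<dots> = (\<Sum>i<n. dir_deriv n (\<lambda>y. b x i * X (unit i) y j) x w)"
      using sX by (intro dir_deriv_fun_sum[OF W _ x] smooth_fun_mult smooth_fun_const W) auto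
    also have "\<dots> = (\<Sum>i<n. b x i * dir_deriv n (\<lambda>y. X (unit i) y j) x w)"
      using dir_deriv_mult[OF smooth_fun_const[OF W] sX x] by (intro sum.cong) auto
    finally show ?thesis .
  qed
  have "dir_deriv n (\<lambda>y. X (b y) y j) x w = dir_deriv n (\<lambda>y. \<Sum>i<n. b y i * X (unit i) y j) x w"
    using X_component smooth_map_in_Rn[OF b] by (intro dir_deriv_cong[OF W x]) auto
  also have "\<dots> = (\<Sum>i<n. dir_deriv n (\<lambda>y. b y i * X (unit i) y j) x w)"
    using sX sb by (intro dir_deriv_fun_sum[OF W _ x] smooth_fun_mult W) auto
  also have "\<dots> = (\<Sum>i<n. differential n b x w i * X (unit i) x j + b x i * dir_deriv n (\<lambda>y. X (unit i) y j) x w)"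
    using dir_deriv_mult[OF sb sX x] by (intro sum.cong) (auto simp: differential_dir_deriv)
  also have "\<dots> = X (differential n b x w) x j + dir_deriv n (\<lambda>y. X (b x) y j) x w"
    using cst X_component[OF differential_in_Rn[OF W b x]] by (simp add: sum.distrib)
  finally show ?thesis .
qed

text \<open>
  The Leibniz rule. The coefficient functions may be differentiated separately, after which the
  bracket of the fields with the coefficients frozen at \<open>x\<close> remains.
\<close>

lemma commutator_frame_fields:
  assumes W: "open_in n W" and a: "smooth_map n W n a" and b: "smooth_map n W n b" and x: "x \<in> W"
  shows "commutator n (\<lambda>y. X (a y) y) (\<lambda>y. X (b y) y) x =
    X (differential n b x (X (a x) x)) x - X (differential n a x (X (b x) x)) x + X (br (a x) (b x)) x"
proof -
  have xR: "x \<in> Rn n" using W x open_in_subset_Rn by blast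
  have *: "commutator n (\<lambda>y. X (a y) y) (\<lambda>y. X (b y) y) x =
    X (differential n b x (X (a x) x)) x - X (differential n a x (X (b x) x)) x + commutator n (X (a x)) (X (b x)) x"
    by (rule ext) (simp add: commutator_dir_deriv dir_deriv_frame_field[OF W a x] dir_deriv_frame_field[OF W b x])
  then show ?thesis
    using commutator_X[OF smooth_map_in_Rn[OF a x] smooth_map_in_Rn[OF b x] xR] by simp
qed

lemma bracket_flag_Suc: "V \<subseteq> bracket_flag br V (Suc i)" "bracket_flag br V i \<subseteq> bracket_flag br V (Suc i)" if "subspace V"
proof -
  show "bracket_flag br V i \<subseteq> bracket_flag br V (Suc i)" for i
    using subspace_0[OF that] by (cases i) (auto intro: span_base)
  then show "V \<subseteq> bracket_flag br V (Suc i)"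
    by (induction i) (auto simp del: bracket_flag.simps(3))
qed

lemma bracket_flag_subspace: "subspace V \<Longrightarrow> subspace (bracket_flag br V i)"
  by (induction i rule: induct_nat_012) auto

lemma bracket_flag_Rn:
  assumes "V \<subseteq> Rn n" shows "bracket_flag br V i \<subseteq> Rn n"
proof (induction i rule: induct_nat_012)
  case 0 show ?case using subspace_0[OF subspace_Rn] by simp
next
  case (ge2 i)
  show ?case unfolding bracket_flag.simps
    by (rule span_minimal[OF _ subspace_Rn]) (use ge2 assms br_Rn in blast)
qed (use assms in simp)

text \<open>
  In a parallelism the weak derived flag of a distribution with constant coefficients is the flag
  of brackets, because the Leibniz terms of \<open>commutator_frame_fields\<close> lie in the previous member of
  the flag.
\<close>

lemma derived_flag_parallel:
  assumes V: "subspace V" "V \<subseteq> Rn n" "V \<noteq> {0}" and x: "x \<in> Rn n"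
  shows "derived_flag n (Rn n) (\<lambda>x. (\<lambda>u. X u x) ` V) i x = (\<lambda>u. X u x) ` bracket_flag br V i"
  using x
proof (induction i arbitrary: x rule: induct_nat_012)
  case (0 x)
  show ?case by (simp only: derived_flag.simps bracket_flag.simps image_insert image_empty linear_0[OF lin_X])
next
  case (1 x)
  then show ?case by simp
next
  case (ge2 i x)
  let ?E = "\<lambda>x. (\<lambda>u. X u x) ` V" and ?F = "bracket_flag br V (Suc i)"
  define C where "C = {commutator n Y Z x | Y Z W.
       open_in n W \<and> x \<in> W \<and> W \<subseteq> Rn n \<and>
       Y \<in> sections n W ?E \<and> Z \<in> sections n W (derived_flag n (Rn n) ?E (Suc i))}"
  note x = ge2.prems and IH = ge2.IH(2)
  have FR: "?F \<subseteq> Rn n" by (rule bracket_flag_Rn[OF V(2)])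
  have F: "subspace ?F" by (rule bracket_flag_subspace[OF V(1)])
  have secE: "X u \<in> sections n (Rn n) ?E" if "u \<in> V" for u
    using smooth_X that V(2) by (auto simp: sections_def)
  have secF: "(\<lambda>y. X (b y) y) \<in> sections n (Rn n) (derived_flag n (Rn n) ?E (Suc i))"
    if "smooth_map n (Rn n) n b" "\<And>y. y \<in> Rn n \<Longrightarrow> b y \<in> ?F" for b
    using smooth_frame_field[OF open_in_Rn that(1)] that(2) IH by (auto simp: sections_def)
  (* Brackets of sections: the coframe gives the coefficients of the two sections. *)
  have "C \<subseteq> (\<lambda>u. X u x) ` bracket_flag br V (Suc (Suc i))"
  proof
    fix c assume "c \<in> C"
    then obtain Y Z W where W: "open_in n W" "x \<in> W" "W \<subseteq> Rn n" and YZ: "Y \<in> sections n W ?E"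
       "Z \<in> sections n W (derived_flag n (Rn n) ?E (Suc i))" and c: "c = commutator n Y Z x"
      unfolding C_def by blast
    define a b where "a y = coframe y (Y y)" and "b y = coframe y (Z y)" for y
    have YZs: "smooth_map n W n Y" "smooth_map n W n Z" using YZ by (auto simp: sections_def)
    have sab: "smooth_map n W n a" "smooth_map n W n b"
      unfolding a_def b_def using smooth_coframe[OF W(1)] YZs by auto
    have aV: "a y \<in> V" if y: "y \<in> W" for y
      using YZ(1) coframe_X V(2) y W(3) by (fastforce simp: sections_def a_def)
    have bF: "b y \<in> ?F" if y: "y \<in> W" for y
    proof -
      have "Z y \<in> derived_flag n (Rn n) ?E (Suc i) y" using YZ(2) y by (auto simp: sections_def)
      moreover have "y \<in> Rn n" using y W(3) by blast
      ultimately have "Z y \<in> (\<lambda>u. X u y) ` ?F" using IH[of y] by argo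
      then show ?thesis using coframe_X FR y W(3) by (auto simp: b_def subset_iff)
    qed
    have eq: "Y y = X (a y) y" "Z y = X (b y) y" if y: "y \<in> W" for y
      using X_coframe smooth_map_in_Rn[OF YZs(1) y] smooth_map_in_Rn[OF YZs(2) y] W(3) y by (auto simp: a_def b_def)
    have "c = commutator n (\<lambda>y. X (a y) y) (\<lambda>y. X (b y) y) x"
    proof
      fix j
      have "dir_deriv n (\<lambda>y. Y y j) x v = dir_deriv n (\<lambda>y. X (a y) y j) x v" "dir_deriv n (\<lambda>y. Z y j) x v = dir_deriv n (\<lambda>y. X (b y) y j) x v" for v
        using eq by (auto intro!: dir_deriv_cong[OF W(1,2)])
      then show "c j = commutator n (\<lambda>y. X (a y) y) (\<lambda>y. X (b y) y) x j"
        unfolding c commutator_dir_deriv using eq[OF W(2)] by simp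
    qed
    also have "\<dots> = X (differential n b x (X (a x) x) - differential n a x (X (b x) x) + br (a x) (b x)) x"
      unfolding commutator_frame_fields[OF W(1) sab W(2)] by (simp only: X_add X_diff)
    finally have c: "c = X (differential n b x (X (a x) x) - differential n a x (X (b x) x) + br (a x) (b x)) x" .
    have "differential n b x (X (a x) x) \<in> ?F"
      by (rule differential_in_subspace[OF W(1) sab(2) F bF W(2)])
    moreover have "differential n a x (X (b x) x) \<in> ?F"
      using differential_in_subspace[OF W(1) sab(1) V(1) aV W(2)] bracket_flag_Suc(1)[OF V(1)] by blast
    moreover have "br (a x) (b x) \<in> bracket_flag br V (Suc (Suc i))"
      using aV[OF W(2)] bF[OF W(2)] by (auto intro: span_base)
    ultimately have "differential n b x (X (a x) x) - differential n a x (X (b x) x) + br (a x) (b x) \<in> bracket_flag br V (Suc (Suc i))"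
      using bracket_flag_Suc(2)[OF V(1), of "Suc i"] by (intro subspace_add subspace_diff bracket_flag_subspace[OF V(1)]) blast+
    then show "c \<in> (\<lambda>u. X u x) ` bracket_flag br V (Suc (Suc i))" unfolding c by blast
  qed
  then have sub: "span C \<subseteq> (\<lambda>u. X u x) ` bracket_flag br V (Suc (Suc i))"
    by (rule span_minimal) (rule linear_subspace_image[OF lin_X bracket_flag_subspace[OF V(1)]])
  have C_I: "commutator n Y Z x \<in> C"
    if "Y \<in> sections n (Rn n) ?E" "Z \<in> sections n (Rn n) (derived_flag n (Rn n) ?E (Suc i))" for Y Z
    unfolding C_def by (rule CollectI, intro exI[of _ Y] exI[of _ Z] exI[of _ "Rn n"]) (use that x in simp)
  have XC: "X u x \<in> C" if u: "u \<in> ?F" for u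
  proof -
    obtain v where v: "v \<in> V" "v \<noteq> 0" using V(1,3) subspace_0 by blast
    have vR: "v \<in> Rn n" using v V by blast
    have uR: "u \<in> Rn n" using u FR by blast
    have "X v x \<noteq> 0"
      using inj_onD[OF inj_X[OF x], of v 0] vR v(2) subspace_0[OF subspace_Rn] linear_0[OF lin_X] by auto
    then obtain j where j: "X v x j \<noteq> 0" by (auto simp: fun_eq_iff)
    then have jn: "j < n" using X_in_Rn[OF vR x] by (auto simp: Rn_def not_less[symmetric])
    (* The flag is increasing: if phi vanishes at x and has derivative 1 along X v, then the bracket
       of X v with phi times X u is X u at x. *)
    define \<phi> where "\<phi> y = (y j - x j) * (1 / X v x j)" for y :: rvec
    have s\<phi>: "smooth_fun n (Rn n) \<phi>"
      unfolding \<phi>_def by (intro smooth_fun_mult smooth_fun_diff smooth_fun_coord smooth_fun_const open_in_Rn)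
    define b where "b y = \<phi> y *\<^sub>R u" for y
    have sb: "smooth_map n (Rn n) n b"
      unfolding smooth_map_def
    proof (intro conjI allI impI)
      show "b ` Rn n \<subseteq> Rn n" using uR subspace_scale[OF subspace_Rn] by (auto simp: b_def)
      show "smooth_fun n (Rn n) (\<lambda>x. b x j)" for j
        using smooth_fun_mult[OF open_in_Rn s\<phi> smooth_fun_const[OF open_in_Rn, of n "u j"]] by (simp add: b_def scaleR_fun_def)
    qed
    have "dir_deriv n \<phi> x (X v x) = 1"
    proof -
      have "dir_deriv n (\<lambda>y. y j - x j) x (X v x) = X v x j"
        using dir_deriv_diff[OF smooth_fun_coord[OF open_in_Rn] smooth_fun_const[OF open_in_Rn] x] jn by (simp add: dir_deriv_coord)
      moreover have "smooth_fun n (Rn n) (\<lambda>y. y j - x j)"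
        by (intro smooth_fun_diff smooth_fun_coord smooth_fun_const open_in_Rn)
      ultimately show ?thesis
        using dir_deriv_mult[OF _ smooth_fun_const[OF open_in_Rn] x, of "\<lambda>y. y j - x j" "1 / X v x j"] j
        by (simp add: \<phi>_def[abs_def])
    qed
    then have db: "differential n b x (X v x) = u"
      using dir_deriv_mult[OF s\<phi> smooth_fun_const[OF open_in_Rn] x]
      by (auto simp: fun_eq_iff differential_dir_deriv b_def scaleR_fun_def)
    have dv: "differential n (\<lambda>_. v) x w = 0" for w by (auto simp: differential_dir_deriv fun_eq_iff)
    have b0: "b x = 0" by (simp add: b_def \<phi>_def)
    have X0: "X 0 y = 0" for y using linear_0[OF lin_X] .
    have "X (br v 0) x = commutator n (X v) (X 0) x"
      using commutator_X[OF vR subspace_0[OF subspace_Rn] x] by simp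
    also have "\<dots> = 0" unfolding commutator_dir_deriv fun_eq_iff by (simp add: X0, simp add: dir_deriv_def)
    finally have cm: "commutator n (X v) (\<lambda>y. X (b y) y) x = X u x"
      using commutator_frame_fields[OF open_in_Rn smooth_map_const[OF open_in_Rn vR] sb x]
      by (simp add: db dv b0 X0)
    have "b y \<in> ?F" for y using u F by (simp only: b_def subspace_scale)
    then show ?thesis using C_I[OF secE[OF v(1)] secF[OF sb]] unfolding cm by blast
  qed
  have bC: "X (br u v) x \<in> C" if uv: "u \<in> V" "v \<in> ?F" for u v
  proof -
    have "commutator n (X u) (X v) x = X (br u v) x"
      using commutator_X x uv FR V(2) by blast
    moreover have "X v \<in> sections n (Rn n) (derived_flag n (Rn n) ?E (Suc i))"
      using secF[of "\<lambda>_. v"] uv FR smooth_map_const[OF open_in_Rn] by blast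
    ultimately show ?thesis using C_I[OF secE[OF uv(1)]] by metis
  qed
  from XC bC have "(\<lambda>u. X u x) ` (?F \<union> {br u v |u v. u \<in> V \<and> v \<in> ?F}) \<subseteq> C" by blast
  then have "(\<lambda>u. X u x) ` bracket_flag br V (Suc (Suc i)) \<subseteq> span C"
    unfolding bracket_flag.simps linear_span_image[OF lin_X, symmetric] by (rule span_mono)
  then show ?case
    using sub unfolding derived_flag.simps C_def by (rule subset_antisym[rotated])
qed

end

section \<open>The Poincare lemma\<close>

lemma continuous_scaled_point:
  fixes f :: "'a::topological_space \<Rightarrow> rvec" and g :: "'a \<Rightarrow> real"
  assumes "continuous_on S f" "continuous_on S g"
  shows "continuous_on S (\<lambda>p. g p *\<^sub>R f p)"
proof (rule continuous_on_coordinatewise_then_product)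
  fix i
  show "continuous_on S (\<lambda>p. (g p *\<^sub>R f p) i)"
    using continuous_on_mult[OF assms(2) continuous_on_product_then_coordinatewise[OF assms(1)]]
    by (simp add: scaleR_fun_def)
qed

text \<open>
  The potential is \<open>f(x) = \<integral>\<^sub>0\<^sup>1 \<Sum>\<^sub>j x\<^sub>j \<omega>\<^sub>j(t x) dt\<close>. Closedness makes the derivative of the integrand by
  \<open>x\<^sub>k\<close> equal to \<open>d/dt (t \<omega>\<^sub>k(t x))\<close>.
\<close>

lemma poincare:
  assumes sm: "\<And>i. i < n \<Longrightarrow> smooth_fun n (Rn n) (\<omega> i)"
    and closed: "\<And>i j x. i < n \<Longrightarrow> j < n \<Longrightarrow> x \<in> Rn n \<Longrightarrow> partial i (\<omega> j) x = partial j (\<omega> i) x"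
  obtains f where "smooth_fun n (Rn n) f" "\<And>i x. i < n \<Longrightarrow> x \<in> Rn n \<Longrightarrow> partial i f x = \<omega> i x"
proof -
  define G where "G x t = (\<Sum>j<n. x j * \<omega> j (t *\<^sub>R x))" for x :: rvec and t :: real
  define f where "f x = integral (cbox 0 1) (G x)" for x
  have scR: "t *\<^sub>R x \<in> Rn n" if "x \<in> Rn n" for t x using subspace_scale[OF subspace_Rn that] .
  have cont: "continuous_on S (\<lambda>p. \<eta> (g p *\<^sub>R y p))"
    if "smooth_fun n (Rn n) \<eta>" "continuous_on S g" "continuous_on S y" "\<And>p. p \<in> S \<Longrightarrow> y p \<in> Rn n"
    for \<eta> and S :: "'c::topological_space set" and g y
    by (rule continuous_on_compose2[OF smooth_fun_continuous[OF that(1)] continuous_scaled_point[OF that(3,2)]])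
       (use scR that(4) in auto)
  have coord: "continuous_on S (\<lambda>p. y p j)" if "continuous_on S y" for S :: "'c::topological_space set" and y :: "'c \<Rightarrow> rvec" and j
    using continuous_on_product_then_coordinatewise[OF that] .
  have contG: "continuous_on S (\<lambda>p. G (y p) (g p))"
    if "continuous_on S g" "continuous_on S y" "\<And>p. p \<in> S \<Longrightarrow> y p \<in> Rn n"
    for S :: "'c::topological_space set" and g y
    unfolding G_def using that by (intro continuous_on_sum continuous_on_mult coord[OF that(2)] cont sm) auto
  (* Joint continuity is not implied by the existence of the partial derivatives; it comes from the
     integral. *)
  have contf: "continuous_on (Rn n) f"
    unfolding f_def
  proof (rule integral_continuous_on_param)
    show "continuous_on (Rn n \<times> cbox 0 1) (\<lambda>(x, t). G x t)"
      unfolding case_prod_unfold by (rule contG) (auto intro: continuous_intros)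
  qed
  have der: "((\<lambda>s. f (x(k := s))) has_real_derivative \<omega> k x) (at (x k))"
    if x: "x \<in> Rn n" and k: "k < n" for x k
  proof -
    let ?y = "\<lambda>s. x(k := s)"
    have yR: "?y s \<in> Rn n" for s using Rn_upd[OF x k] .
    define H where "H s t = \<omega> k (t *\<^sub>R ?y s) + t * (\<Sum>j<n. ?y s j * partial j (\<omega> k) (t *\<^sub>R ?y s))" for s t
    have sumk: "(\<Sum>i<n. p i * (if i = k then t else 0)) = t * p k" for p :: "nat \<Rightarrow> real" and t
    proof -
      have "(\<Sum>i<n. p i * (if i = k then t else 0)) = (\<Sum>i<n. if i = k then t * p k else 0)"
        by (rule sum.cong) auto
      then show ?thesis using k by simp
    qed
    have dG: "((\<lambda>s. G (?y s) t) has_real_derivative H s t) (at s)" for s t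
    proof -
      have "((\<lambda>s. \<omega> j (t *\<^sub>R ?y s)) has_real_derivative (\<Sum>i<n. partial i (\<omega> j) (t *\<^sub>R ?y s) * (if i = k then t else 0))) (at s)"
        if "j < n" for j
      proof (rule chain_rule_curve[OF open_in_Rn sm[OF that]])
        show "t *\<^sub>R ?y s \<in> Rn n" by (rule scR[OF yR])
        show "\<forall>\<^sub>F s in at s. t *\<^sub>R ?y s \<in> Rn n" by (intro always_eventually allI scR yR)
        show "((\<lambda>s. (t *\<^sub>R ?y s) i) has_real_derivative (if i = k then t else 0)) (at s)" for i
          by (auto simp: scaleR_fun_def intro!: derivative_eq_intros)
      qed
      then have d\<omega>: "((\<lambda>s. \<omega> j (t *\<^sub>R ?y s)) has_real_derivative t * partial k (\<omega> j) (t *\<^sub>R ?y s)) (at s)"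
        if "j < n" for j
        using that unfolding sumk by blast
      have dy: "((\<lambda>s. ?y s j) has_real_derivative (if j = k then 1 else 0)) (at s)" for j
        by (auto intro!: derivative_eq_intros)
      have "((\<lambda>s. G (?y s) t) has_real_derivative
        (\<Sum>j<n. ?y s j * (t * partial k (\<omega> j) (t *\<^sub>R ?y s)) + (if j = k then 1 else 0) * \<omega> j (t *\<^sub>R ?y s))) (at s)"
        unfolding G_def by (rule DERIV_sum, rule DERIV_mult'[OF dy d\<omega>]) simp
      also have "(\<Sum>j<n. ?y s j * (t * partial k (\<omega> j) (t *\<^sub>R ?y s)) + (if j = k then 1 else 0) * \<omega> j (t *\<^sub>R ?y s))
        = (\<Sum>j<n. ?y s j * (t * partial j (\<omega> k) (t *\<^sub>R ?y s))) + (\<Sum>j<n. if j = k then \<omega> k (t *\<^sub>R ?y s) else 0)"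
        unfolding sum.distrib using closed[OF k _ scR[OF yR]] by (intro arg_cong2[of _ _ _ _ "(+)"] sum.cong) auto
      also have "\<dots> = H s t"
        using k by (simp add: H_def sum_distrib_left mult_ac)
      finally show ?thesis .
    qed
    have int: "((H s) has_integral \<omega> k (?y s)) (cbox 0 1)" for s
    proof -
      have "((\<lambda>t. t * \<omega> k (t *\<^sub>R ?y s)) has_real_derivative H s t) (at t)" for t
      proof -
        have "((\<lambda>t. \<omega> k (t *\<^sub>R ?y s)) has_real_derivative (\<Sum>j<n. partial j (\<omega> k) (t *\<^sub>R ?y s) * ?y s j)) (at t)"
        proof (rule chain_rule_curve[OF open_in_Rn sm[OF k]])
          show "t *\<^sub>R ?y s \<in> Rn n" by (rule scR[OF yR])
          show "\<forall>\<^sub>F t in at t. t *\<^sub>R ?y s \<in> Rn n" by (intro always_eventually allI scR yR)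
          show "((\<lambda>t. (t *\<^sub>R ?y s) j) has_real_derivative ?y s j) (at t)" for j
            by (auto simp: scaleR_fun_def intro!: derivative_eq_intros)
        qed
        from DERIV_mult'[OF DERIV_ident this] show ?thesis by (simp add: H_def mult.commute add.commute)
      qed
      then have "((\<lambda>t. t * \<omega> k (t *\<^sub>R ?y s)) has_vector_derivative H s t) (at t within {0..1})" for t
        unfolding has_real_derivative_iff_has_vector_derivative[symmetric] by (rule has_field_derivative_at_within)
      then have "(H s has_integral (1 * \<omega> k (1 *\<^sub>R ?y s) - 0 * \<omega> k (0 *\<^sub>R ?y s))) {0..1}"
        using fundamental_theorem_of_calculus[of 0 1 "\<lambda>t. t * \<omega> k (t *\<^sub>R ?y s)" "H s"] by simp
      then show ?thesis unfolding cbox_interval mult_1 scaleR_one mult_zero_left diff_zero .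
    qed
    have "((\<lambda>s. integral (cbox 0 1) (G (?y s))) has_real_derivative integral (cbox 0 1) (H (x k))) (at (x k) within UNIV)"
    proof (rule leibniz_rule_field_derivative)
      show "G (?y s) integrable_on cbox 0 1" for s
        by (rule integrable_continuous, rule contG) (auto intro: continuous_intros yR)
      have cy: "continuous_on S (\<lambda>p. ?y (fst p))" for S :: "(real \<times> real) set"
        by (intro continuous_on_fun_upd continuous_intros)
      show "continuous_on (UNIV \<times> cbox 0 1) (\<lambda>(s, t). H s t)"
        unfolding H_def case_prod_unfold
        using yR k by (intro continuous_on_add continuous_on_mult continuous_on_sum coord[OF cy] cont[OF _ _ cy] sm smooth_fun_partial continuous_on_snd continuous_on_id) auto
    qed (use dG in auto)
    then show ?thesis using integral_unique[OF int[of "x k"]] by (simp add: f_def)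
  qed
  have "smooth_fun n (Rn n) f"
  proof (rule smooth_fun_coinduct[OF open_in_Rn, where S = "insert f {g. smooth_fun n (Rn n) g}"])
    fix g i assume g: "g \<in> insert f {g. smooth_fun n (Rn n) g}" and i: "i < n"
    show "\<exists>h\<in>insert f {g. smooth_fun n (Rn n) g}. \<forall>x\<in>Rn n. ((\<lambda>t. g (x(i := t))) has_real_derivative h x) (at (x i))"
    proof (cases "g = f")
      case True then show ?thesis using der[OF _ i] sm[OF i] by blast
    next
      case False
      then have "smooth_fun n (Rn n) g" using g by blast
      then show ?thesis using smooth_fun_has_partial[OF _ _ i] smooth_fun_partial[OF _ i] by blast
    qed
  qed (use contf smooth_fun_continuous in auto)
  moreover have "partial k f x = \<omega> k x" if "k < n" "x \<in> Rn n" for k x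
    using partial_eqI der that by blast
  ultimately show ?thesis using that by blast
qed

lemma dir_deriv_unit: "i < n \<Longrightarrow> dir_deriv n f x (unit i) = partial i f x"
  by (simp add: dir_deriv_def unit_apply if_distrib[of "\<lambda>z. _ * z"] cong: if_cong)

lemma sum_unit: "k < n \<Longrightarrow> (\<Sum>j<n. c j * unit k j) = (c k :: real)"
  by (simp add: unit_apply if_distrib[of "\<lambda>z. _ * z"] cong: if_cong)

context parallelism begin

lemma coframe_expand:
  assumes "x \<in> Rn n" "w \<in> Rn n"
  shows "coframe x w = (\<Sum>j<n. w j *\<^sub>R coframe x (unit j))"
proof -
  let ?s = "\<Sum>j<n. w j *\<^sub>R coframe x (unit j)"
  have "X ?s x = (\<Sum>j<n. w j *\<^sub>R X (coframe x (unit j)) x)"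
    by (simp add: linear_sum[OF lin_X] linear_scale[OF lin_X])
  also have "\<dots> = w" using X_coframe assms Rn_expand by simp
  finally have "X ?s x = w" .
  moreover have "?s \<in> Rn n"
    using coframe_in_Rn assms by (intro subspace_sum[OF subspace_Rn] subspace_scale[OF subspace_Rn]) auto
  ultimately show ?thesis using coframe_X assms by metis
qed

text \<open>
  The Poincare lemma for the one-form with \<open>\<omega>(X v) = h v\<close>. The hypothesis on \<open>h\<close> is the formula
  \<open>d\<omega>(A, B) = A \<omega>(B) - B \<omega>(A) - \<omega>([A, B])\<close> with left-hand side zero, evaluated on the frame.
\<close>

lemma frame_poincare:
  assumes lin: "\<And>x. linear (\<lambda>v. h v x)"
    and sm: "\<And>v. v \<in> Rn n \<Longrightarrow> smooth_fun n (Rn n) (h v)"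
    and closed: "\<And>u v x. u \<in> Rn n \<Longrightarrow> v \<in> Rn n \<Longrightarrow> x \<in> Rn n \<Longrightarrow>
      dir_deriv n (h v) x (X u x) - dir_deriv n (h u) x (X v x) = h (br u v) x"
  shows "\<exists>f. smooth_fun n (Rn n) f \<and> (\<forall>v\<in>Rn n. \<forall>x\<in>Rn n. dir_deriv n f x (X v x) = h v x)"
proof -
  define \<omega> where "\<omega> j x = h (coframe x (unit j)) x" for j x
  have \<omega>_eq: "(\<Sum>j<n. \<omega> j x * w j) = h (coframe x w) x" if "x \<in> Rn n" "w \<in> Rn n" for x w
  proof -
    have "h (coframe x w) x = h (\<Sum>j<n. w j *\<^sub>R coframe x (unit j)) x" using coframe_expand[OF that] by simp
    also have "\<dots> = (\<Sum>j<n. w j * h (coframe x (unit j)) x)"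
      by (simp add: linear_sum[OF lin[of x]] linear_scale[OF lin[of x]])
    finally show ?thesis by (simp add: \<omega>_def mult.commute)
  qed
  have \<omega>_X: "(\<Sum>j<n. \<omega> j x * X v x j) = h v x" if "x \<in> Rn n" "v \<in> Rn n" for x v
    using \<omega>_eq[OF that(1) X_in_Rn[OF that(2,1)]] coframe_X[OF that] by simp
  have s\<omega>: "smooth_fun n (Rn n) (\<omega> j)" if "j < n" for j
  proof -
    have sc: "smooth_map n (Rn n) n (\<lambda>x. coframe x (unit j))"
      by (rule smooth_coframe[OF open_in_Rn smooth_map_const]) (use that in auto)
    have "smooth_fun n (Rn n) (\<lambda>x. \<Sum>i<n. coframe x (unit j) i * h (unit i) x)"
      by (intro smooth_fun_sum smooth_fun_mult smooth_map_component[OF sc] sm open_in_Rn) auto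
    moreover have "(\<Sum>i<n. coframe x (unit j) i * h (unit i) x) = \<omega> j x" if "x \<in> Rn n" for x
      unfolding \<omega>_def
      using linear_Rn_expand[OF lin[of x] coframe_in_Rn, of "unit j" x] that \<open>j < n\<close> by simp
    ultimately show ?thesis by (rule smooth_fun_cong[OF open_in_Rn])
  qed
  have \<omega>_closed: "partial i (\<omega> k) x = partial k (\<omega> i) x" if ik: "i < n" "k < n" and x: "x \<in> Rn n" for i k x
  proof -
    (* Differentiate h v = sum of omega_j times the components of X v. *)
    have d: "dir_deriv n (h v) x w = (\<Sum>j<n. dir_deriv n (\<omega> j) x w * X v x j) + (\<Sum>j<n. \<omega> j x * dir_deriv n (\<lambda>y. X v y j) x w)"
      if v: "v \<in> Rn n" for v w
    proof -
      note sX = smooth_map_component[OF smooth_X[OF v] open_in_Rn]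
      have "dir_deriv n (h v) x w = dir_deriv n (\<lambda>y. \<Sum>j<n. \<omega> j y * X v y j) x w"
        using \<omega>_X v by (intro dir_deriv_cong[OF open_in_Rn x]) simp
      also have "\<dots> = (\<Sum>j<n. dir_deriv n (\<lambda>y. \<omega> j y * X v y j) x w)"
        by (intro dir_deriv_fun_sum[OF open_in_Rn _ x] smooth_fun_mult sX s\<omega> open_in_Rn) auto
      also have "\<dots> = (\<Sum>j<n. dir_deriv n (\<omega> j) x w * X v x j + \<omega> j x * dir_deriv n (\<lambda>y. X v y j) x w)"
        using dir_deriv_mult[OF s\<omega> sX x] by (intro sum.cong) auto
      finally show ?thesis by (simp add: sum.distrib)
    qed
    let ?u = "coframe x (unit i)" and ?v = "coframe x (unit k)"
    have uv: "?u \<in> Rn n" "?v \<in> Rn n" using coframe_in_Rn ik x by auto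
    have X: "X ?u x = unit i" "X ?v x = unit k" using X_coframe x ik by auto
    (* The frame fields with coefficients ?u and ?v are the coordinate fields i and k at x. *)
    have "(\<Sum>j<n. \<omega> j x * X (br ?u ?v) x j) = (\<Sum>j<n. \<omega> j x * (dir_deriv n (\<lambda>y. X ?v y j) x (X ?u x) - dir_deriv n (\<lambda>y. X ?u y j) x (X ?v x)))"
      using commutator_X[OF uv x] by (simp add: commutator_dir_deriv flip: commutator_X[OF uv x])
    moreover have "(\<Sum>j<n. \<omega> j x * X (br ?u ?v) x j) = dir_deriv n (h ?v) x (X ?u x) - dir_deriv n (h ?u) x (X ?v x)"
      using closed[OF uv x] \<omega>_X[OF x br_Rn[OF uv]] by simp
    ultimately have "(\<Sum>j<n. dir_deriv n (\<omega> j) x (unit i) * unit k j) = (\<Sum>j<n. dir_deriv n (\<omega> j) x (unit k) * unit i j)"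
      unfolding d[OF uv(1)] d[OF uv(2)] X by (simp add: right_diff_distrib sum_subtractf)
    then show ?thesis using ik by (simp add: sum_unit dir_deriv_unit)
  qed
  obtain f where f: "smooth_fun n (Rn n) f" "\<And>i x. i < n \<Longrightarrow> x \<in> Rn n \<Longrightarrow> partial i f x = \<omega> i x"
    using poincare[OF s\<omega> \<omega>_closed] by blast
  have "dir_deriv n f x (X v x) = h v x" if "v \<in> Rn n" "x \<in> Rn n" for v x
    using f(2)[OF _ that(2)] \<omega>_X[OF that(2,1)] by (simp add: dir_deriv_def)
  then show ?thesis using f(1) by blast
qed

lemma dim_derived_flag_parallel:
  assumes "subspace V" "V \<subseteq> Rn n" "V \<noteq> {0}" "x \<in> Rn n"
  shows "dim (derived_flag n (Rn n) (\<lambda>x. (\<lambda>u. X u x) ` V) i x) = dim (bracket_flag br V i)"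
  unfolding derived_flag_parallel[OF assms]
  by (rule dim_linear_image[OF lin_X bracket_flag_subspace[OF assms(1)] inj_on_subset[OF inj_X[OF assms(4)] bracket_flag_Rn[OF assms(2)]]])

lemma distribution_parallel:
  assumes V: "subspace V" "V \<subseteq> Rn n" "dim V = 2" and s: "bracket_flag br V s = Rn n"
  shows "distribution 2 n (Rn n) (\<lambda>x. (\<lambda>u. X u x) ` V)"
proof -
  have V0: "V \<noteq> {0}"
  proof
    assume "V = {0}"
    then have "dim V \<le> card ({} :: rvec set)" by (intro dim_le_card) auto
    then show False using V(3) by simp
  qed
  obtain B where B: "B \<subseteq> V" "independent B" "V \<subseteq> span B" "card B = 2"
    using basis_exists[of V] V(3) by metis
  then obtain b c where bc: "B = {b, c}" by (meson card_2_iff)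
  have sB: "span B = V" using B V(1) by (metis span_minimal subset_antisym)
  define F where "F j = (if j = 0 then X b else X c)" for j :: nat
  have sub: "smooth_subbundle 2 n (Rn n) (\<lambda>x. (\<lambda>u. X u x) ` V)"
    unfolding smooth_subbundle_def
  proof (intro ballI, intro exI[of _ "Rn n"] exI[of _ F] conjI allI impI ballI)
    show "smooth_map n (Rn n) n (F j)" for j
      using smooth_X B(1) V(2) bc by (auto simp: F_def)
    fix x assume x: "x \<in> Rn n"
    have "(\<lambda>j. F j x) ` {..<2} = (\<lambda>u. X u x) ` B"
      by (auto simp: F_def bc lessThan_Suc numeral_2_eq_2)
    then show "(\<lambda>u. X u x) ` V = span ((\<lambda>j. F j x) ` {..<2})"
      using linear_span_image[OF lin_X, of x B] sB by simp
    show "dim ((\<lambda>u. X u x) ` V) = 2"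
      using dim_linear_image[OF lin_X V(1) inj_on_subset[OF inj_X[OF x] V(2)]] V(3) by simp
  qed auto
  show ?thesis
    unfolding distribution_def
  proof (intro conjI allI sub)
    show "\<exists>r. \<forall>x\<in>Rn n. dim (derived_flag n (Rn n) (\<lambda>x. (\<lambda>u. X u x) ` V) i x) = r" for i
      using dim_derived_flag_parallel[OF V(1,2) V0] by blast
    show "\<exists>s. \<forall>x\<in>Rn n. derived_flag n (Rn n) (\<lambda>x. (\<lambda>u. X u x) ` V) s x = Rn n"
      using derived_flag_parallel[OF V(1,2) V0] s image_X by metis
  qed simp
qed

end

section \<open>Left-invariant parallelisms on Lie groups\<close>

text \<open>
  For maps that are linear only on \<open>Rn n\<close>, as Lie brackets and isomorphisms of Lie algebras are.
\<close>

lemma linear_on_Rn_expand: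
  fixes L :: "rvec \<Rightarrow> rvec"
  assumes L: "\<And>a b u v. u \<in> Rn n \<Longrightarrow> v \<in> Rn n \<Longrightarrow> L (a *\<^sub>R u + b *\<^sub>R v) = a *\<^sub>R L u + b *\<^sub>R L v"
    and v: "v \<in> Rn n"
  shows "L v = (\<Sum>i<n. v i *\<^sub>R L (unit i))"
proof -
  have L0: "L 0 = 0" using L[OF v v, of 0 0] by simp
  have mem: "(\<Sum>i\<in>J. v i *\<^sub>R unit i) \<in> Rn n" if "J \<subseteq> {..<n}" for J
    using that by (intro subspace_sum[OF subspace_Rn] subspace_scale[OF subspace_Rn]) auto
  have "L (\<Sum>i\<in>J. v i *\<^sub>R unit i) = (\<Sum>i\<in>J. v i *\<^sub>R L (unit i))" if "J \<subseteq> {..<n}" for J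
    using finite_subset[OF that finite_lessThan] that
  proof (induction J rule: finite_induct)
    case empty show ?case by (simp only: sum.empty L0)
  next
    case (insert i J)
    then have "L (v i *\<^sub>R unit i + 1 *\<^sub>R (\<Sum>i\<in>J. v i *\<^sub>R unit i)) =
        v i *\<^sub>R L (unit i) + 1 *\<^sub>R L (\<Sum>i\<in>J. v i *\<^sub>R unit i)"
      by (intro L mem unit_in_Rn) auto
    moreover have "L (\<Sum>i\<in>J. v i *\<^sub>R unit i) = (\<Sum>i\<in>J. v i *\<^sub>R L (unit i))" using insert by blast
    ultimately show ?case unfolding sum.insert[OF insert.hyps] scaleR_one by argo
  qed
  from this[of "{..<n}"] show ?thesis using Rn_expand[OF v] by simp
qed

lemma linear_matrix: "linear (\<lambda>v::rvec. \<Sum>i<n. v i *\<^sub>R (c i :: rvec))"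
  by (rule linearI; rule ext)
     (simp_all add: sum_fun_apply scaleR_fun_def distrib_right sum.distrib sum_distrib_left mult.assoc)

text \<open>
  The point \<open>(x, y)\<close> of \<open>\<real>\<^sup>n \<times> \<real>\<^sup>n = \<real>\<^bsup>2n\<^esup>\<close>; inverse to \<open>fst_half\<close> and \<open>snd_half\<close>.
\<close>

definition join :: "nat \<Rightarrow> rvec \<Rightarrow> rvec \<Rightarrow> rvec" where
  "join n x y = (\<lambda>i. if i < n then x i else y (i - n))"

lemma join_in_Rn: "x \<in> Rn n \<Longrightarrow> y \<in> Rn n \<Longrightarrow> join n x y \<in> Rn (2 * n)"
  by (auto simp: join_def Rn_def)

lemma half_join: "x \<in> Rn n \<Longrightarrow> y \<in> Rn n \<Longrightarrow> fst_half n (join n x y) = x \<and> snd_half n (join n x y) = y"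
  by (auto simp: join_def fst_half_def snd_half_def Rn_def fun_eq_iff)

lemma smooth_map_join:
  assumes W: "open_in k W" and P: "smooth_map k W n P" and Q: "smooth_map k W n Q"
  shows "smooth_map k W (2 * n) (\<lambda>x. join n (P x) (Q x))"
  unfolding smooth_map_def
proof (intro conjI allI impI)
  show "(\<lambda>x. join n (P x) (Q x)) ` W \<subseteq> Rn (2 * n)"
    using join_in_Rn smooth_map_in_Rn[OF P] smooth_map_in_Rn[OF Q] by blast
  fix j
  show "smooth_fun k W (\<lambda>x. join n (P x) (Q x) j)"
    using smooth_map_component[OF P W] smooth_map_component[OF Q W] by (cases "j < n") (auto simp: join_def)
qed

locale smooth_group =
  fixes n :: nat and G :: "rvec monoid"
  assumes lie: "lie_group n G"
begin

sublocale group G using lie by (simp add: lie_group_def)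

lemma carrier_Rn [simp]: "carrier G = Rn n" using lie by (simp add: lie_group_def)

lemma mult_Rn: "x \<in> Rn n \<Longrightarrow> y \<in> Rn n \<Longrightarrow> x \<otimes>\<^bsub>G\<^esub> y \<in> Rn n" using m_closed by simp

lemma inv_Rn: "x \<in> Rn n \<Longrightarrow> inv\<^bsub>G\<^esub> x \<in> Rn n" using inv_closed by simp

lemma one_Rn: "\<one>\<^bsub>G\<^esub> \<in> Rn n" using one_closed by simp

lemma smooth_inv: "smooth_map n (Rn n) n (\<lambda>x. inv\<^bsub>G\<^esub> x)" using lie by (simp add: lie_group_def)

definition mult_map :: "rvec \<Rightarrow> rvec" where "mult_map z = fst_half n z \<otimes>\<^bsub>G\<^esub> snd_half n z"

lemma smooth_mult_map: "smooth_map (2 * n) (Rn (2 * n)) n mult_map"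
  using lie by (simp add: lie_group_def mult_map_def[abs_def])

lemma smooth_left_mult:
  assumes x: "x \<in> Rn n" shows "smooth_map n (Rn n) n (\<lambda>y. x \<otimes>\<^bsub>G\<^esub> y)"
proof -
  have J: "smooth_map n (Rn n) (2 * n) (\<lambda>y. join n x y)"
    by (rule smooth_map_join[OF open_in_Rn smooth_map_const[OF open_in_Rn x] smooth_map_id[OF open_in_Rn]])
  show ?thesis
    by (rule smooth_map_cong[OF open_in_Rn smooth_map_comp[OF open_in_Rn open_in_Rn J _ smooth_mult_map]])
       (use join_in_Rn half_join x in \<open>auto simp: mult_map_def\<close>)
qed

lemma partial_mult_map:
  assumes "x \<in> Rn n" "y \<in> Rn n" "i < n"
  shows "partial (n + i) (\<lambda>z. mult_map z j) (join n x y) = partial i (\<lambda>y. (x \<otimes>\<^bsub>G\<^esub> y) j) y"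
proof -
  have "(join n x y)(n + i := t) = join n x (y(i := t))" for t
    by (auto simp: join_def fun_eq_iff)
  then have "mult_map ((join n x y)(n + i := t)) = x \<otimes>\<^bsub>G\<^esub> y(i := t)" for t
    using half_join[OF assms(1) Rn_upd[OF assms(2,3)]] by (simp add: mult_map_def)
  moreover have "join n x y (n + i) = y i" by (simp add: join_def)
  ultimately show ?thesis by (simp add: partial_def)
qed

text \<open>
  The differential of a left translation, as a function of all its data, is made of partial
  derivatives of the multiplication by its second argument. Both the left-invariant fields and
  the coframe of the group are of this form, hence smooth.
\<close>

lemma smooth_left_translated:
  assumes W: "open_in n W" and P: "smooth_map n W n P" and Q: "smooth_map n W n Q" and V: "smooth_map n W n V"
  shows "smooth_map n W n (\<lambda>x. differential n (\<lambda>y. P x \<otimes>\<^bsub>G\<^esub> y) (Q x) (V x))"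
  unfolding smooth_map_def
proof (intro conjI allI impI)
  show "(\<lambda>x. differential n (\<lambda>y. P x \<otimes>\<^bsub>G\<^esub> y) (Q x) (V x)) ` W \<subseteq> Rn n"
    using differential_in_Rn[OF open_in_Rn smooth_left_mult] smooth_map_in_Rn[OF P] smooth_map_in_Rn[OF Q] by blast
  fix j assume j: "j < n"
  have J: "smooth_map n W (2 * n) (\<lambda>x. join n (P x) (Q x))" by (rule smooth_map_join[OF W P Q])
  have "smooth_fun n W (\<lambda>x. \<Sum>i<n. partial (n + i) (\<lambda>z. mult_map z j) (join n (P x) (Q x)) * V x i)"
  proof (intro smooth_fun_sum smooth_fun_mult W smooth_map_component[OF V])
    fix i assume "i \<in> {..<n}"
    then have "smooth_fun (2 * n) (Rn (2 * n)) (partial (n + i) (\<lambda>z. mult_map z j))"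
      by (intro smooth_fun_partial smooth_map_component[OF smooth_mult_map] open_in_Rn) auto
    then show "smooth_fun n W (\<lambda>x. partial (n + i) (\<lambda>z. mult_map z j) (join n (P x) (Q x)))"
      using smooth_map_in_Rn[OF J] by (intro smooth_fun_comp[OF W open_in_Rn J]) auto
  qed
  moreover have "(\<Sum>i<n. partial (n + i) (\<lambda>z. mult_map z j) (join n (P x) (Q x)) * V x i) =
     differential n (\<lambda>y. P x \<otimes>\<^bsub>G\<^esub> y) (Q x) (V x) j" if "x \<in> W" for x
    using partial_mult_map smooth_map_in_Rn[OF P that] smooth_map_in_Rn[OF Q that] by (simp add: differential_def)
  ultimately show "smooth_fun n W (\<lambda>x. differential n (\<lambda>y. P x \<otimes>\<^bsub>G\<^esub> y) (Q x) (V x) j)"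
    by (rule smooth_fun_cong[OF W])
qed

lemma differential_left_mult_comp:
  assumes "x \<in> Rn n" "y \<in> Rn n" "h \<in> Rn n"
  shows "differential n (\<lambda>z. x \<otimes>\<^bsub>G\<^esub> z) (y \<otimes>\<^bsub>G\<^esub> h) (differential n (\<lambda>z. y \<otimes>\<^bsub>G\<^esub> z) h v) =
    differential n (\<lambda>z. (x \<otimes>\<^bsub>G\<^esub> y) \<otimes>\<^bsub>G\<^esub> z) h v"
proof -
  have "differential n (\<lambda>z. x \<otimes>\<^bsub>G\<^esub> (y \<otimes>\<^bsub>G\<^esub> z)) h v =
    differential n (\<lambda>z. x \<otimes>\<^bsub>G\<^esub> z) (y \<otimes>\<^bsub>G\<^esub> h) (differential n (\<lambda>z. y \<otimes>\<^bsub>G\<^esub> z) h v)"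
    by (rule differential_chain[OF open_in_Rn open_in_Rn smooth_left_mult[OF assms(2)] _ smooth_left_mult[OF assms(1)] assms(3)])
       (use mult_Rn assms in blast)
  moreover have "differential n (\<lambda>z. x \<otimes>\<^bsub>G\<^esub> (y \<otimes>\<^bsub>G\<^esub> z)) h v = differential n (\<lambda>z. (x \<otimes>\<^bsub>G\<^esub> y) \<otimes>\<^bsub>G\<^esub> z) h v"
    by (rule differential_cong[OF open_in_Rn assms(3)]) (use m_assoc assms in simp)
  ultimately show ?thesis by simp
qed

lemma differential_left_one:
  assumes "h \<in> Rn n" "v \<in> Rn n" shows "differential n (\<lambda>z. \<one>\<^bsub>G\<^esub> \<otimes>\<^bsub>G\<^esub> z) h v = v"
  by (rule differential_ident[OF open_in_Rn assms(1) _ assms(2)]) simp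

lemma smooth_left_invariant_field: "v \<in> Rn n \<Longrightarrow> smooth_map n (Rn n) n (left_invariant_field n G v)"
  unfolding left_invariant_field_def[abs_def]
  by (rule smooth_left_translated[OF open_in_Rn smooth_map_id[OF open_in_Rn]
       smooth_map_const[OF open_in_Rn one_Rn] smooth_map_const[OF open_in_Rn]])

lemma left_invariance:
  assumes "x \<in> Rn n" "h \<in> Rn n"
  shows "differential n (\<lambda>z. x \<otimes>\<^bsub>G\<^esub> z) h (left_invariant_field n G v h) = left_invariant_field n G v (x \<otimes>\<^bsub>G\<^esub> h)"
  using differential_left_mult_comp[OF assms one_Rn, of v] assms(2) by (simp add: left_invariant_field_def)

text \<open>
  Every left-invariant field is related to itself under left translations, so the identity at the
  unit, which is the definition of the bracket, spreads over the group.
\<close>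

lemma commutator_left_invariant:
  assumes u: "u \<in> Rn n" and v: "v \<in> Rn n" and x: "x \<in> Rn n"
  shows "commutator n (left_invariant_field n G u) (left_invariant_field n G v) x =
    left_invariant_field n G (lie_group_bracket n G u v) x"
proof -
  have "differential n (\<lambda>z. x \<otimes>\<^bsub>G\<^esub> z) \<one>\<^bsub>G\<^esub> (commutator n (left_invariant_field n G u) (left_invariant_field n G v) \<one>\<^bsub>G\<^esub>) =
    commutator n (left_invariant_field n G u) (left_invariant_field n G v) (x \<otimes>\<^bsub>G\<^esub> \<one>\<^bsub>G\<^esub>)"
    using left_invariance[OF x] mult_Rn[OF x]
    by (intro commutator_related[OF open_in_Rn open_in_Rn smooth_left_mult[OF x]] smooth_left_invariant_field u v one_Rn) auto
  then show ?thesis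
    unfolding lie_group_bracket_def
      left_invariant_field_def[of n G "commutator n (left_invariant_field n G u) (left_invariant_field n G v) \<one>\<^bsub>G\<^esub>" x]
    using x by simp
qed

text \<open>
  The coframe at \<open>x\<close> is the differential of the left translation by the inverse of \<open>x\<close>, followed by the
  inverse of \<open>\<psi>\<close>.
\<close>

lemma parallelism_left_invariant:
  assumes bij: "bij_betw \<psi> (Rn n) (Rn n)"
    and lin: "\<And>a b u v. u \<in> Rn n \<Longrightarrow> v \<in> Rn n \<Longrightarrow> \<psi> (a *\<^sub>R u + b *\<^sub>R v) = a *\<^sub>R \<psi> u + b *\<^sub>R \<psi> v"
    and hom: "\<And>u v. u \<in> Rn n \<Longrightarrow> v \<in> Rn n \<Longrightarrow> \<psi> (br u v) = lie_group_bracket n G (\<psi> u) (\<psi> v)"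
    and br: "\<And>u v. u \<in> Rn n \<Longrightarrow> v \<in> Rn n \<Longrightarrow> br u v \<in> Rn n"
  obtains X coframe where "parallelism n X coframe br"
    "\<And>v x. v \<in> Rn n \<Longrightarrow> X v x = left_invariant_field n G (\<psi> v) x"
proof -
  define X where "X v x = left_invariant_field n G (\<Sum>i<n. v i *\<^sub>R \<psi> (unit i)) x" for v x
  define \<xi> where "\<xi> = inv_into (Rn n) \<psi>"
  define coframe where "coframe x w = \<xi> (differential n (\<lambda>z. inv\<^bsub>G\<^esub> x \<otimes>\<^bsub>G\<^esub> z) x w)" for x w
  have \<psi>R: "\<psi> v \<in> Rn n" if "v \<in> Rn n" for v using bij that by (auto simp: bij_betw_def)
  have \<xi>R: "\<xi> v \<in> Rn n" if "v \<in> Rn n" for v using bij that by (auto simp: bij_betw_def \<xi>_def inv_into_into)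
  have \<psi>\<xi>: "\<psi> (\<xi> v) = v" if "v \<in> Rn n" for v using bij that by (auto simp: bij_betw_def \<xi>_def f_inv_into_f)
  have \<xi>\<psi>: "\<xi> (\<psi> v) = v" if "v \<in> Rn n" for v using bij that by (auto simp: bij_betw_def \<xi>_def inv_into_f_f)
  have comb: "a *\<^sub>R u + b *\<^sub>R v \<in> Rn n" if "u \<in> Rn n" "v \<in> Rn n" for a b u v
    using that by (intro subspace_add[OF subspace_Rn] subspace_scale[OF subspace_Rn])
  have lin\<xi>: "\<xi> (a *\<^sub>R u + b *\<^sub>R v) = a *\<^sub>R \<xi> u + b *\<^sub>R \<xi> v" if "u \<in> Rn n" "v \<in> Rn n" for a b u v
  proof -
    have "\<psi> (a *\<^sub>R \<xi> u + b *\<^sub>R \<xi> v) = a *\<^sub>R u + b *\<^sub>R v" using lin \<xi>R \<psi>\<xi> that by simp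
    then show ?thesis using \<xi>\<psi>[OF comb[OF \<xi>R[OF that(1)] \<xi>R[OF that(2)]]] by metis
  qed
  have X_eq: "X v x = left_invariant_field n G (\<psi> v) x" if "v \<in> Rn n" for v x
  proof -
    have e: "\<psi> v = (\<Sum>i<n. v i *\<^sub>R \<psi> (unit i))" by (rule linear_on_Rn_expand[OF lin that])
    show ?thesis unfolding X_def by (simp only: e)
  qed
  have dR: "differential n (\<lambda>z. x \<otimes>\<^bsub>G\<^esub> z) h w \<in> Rn n" if "x \<in> Rn n" "h \<in> Rn n" for x h w
    using differential_in_Rn[OF open_in_Rn smooth_left_mult] that by blast
  have "parallelism n X coframe br"
  proof (rule parallelism.intro)
    show "linear (\<lambda>v. X v x)" for x
      unfolding X_def left_invariant_field_def
      using linear_compose[OF linear_matrix linear_differential] by (simp add: o_def)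
    show "smooth_map n (Rn n) n (X v)" if "v \<in> Rn n" for v
    proof -
      have "X v = left_invariant_field n G (\<psi> v)" by (rule ext) (rule X_eq[OF that])
      then show ?thesis using smooth_left_invariant_field[OF \<psi>R[OF that]] by simp
    qed
    show "smooth_map n W n (\<lambda>x. coframe x (Z x))" if W: "open_in n W" and Z: "smooth_map n W n Z" for W Z
    proof -
      have WR: "W \<subseteq> Rn n" using W openin_imp_subset by blast
      have sd: "smooth_map n W n (\<lambda>x. differential n (\<lambda>z. inv\<^bsub>G\<^esub> x \<otimes>\<^bsub>G\<^esub> z) x (Z x))" (is "smooth_map n W n ?d")
        by (rule smooth_left_translated[OF W smooth_map_subset[OF smooth_inv WR] smooth_map_id[OF W] Z])
      show ?thesis
        unfolding smooth_map_def
      proof (intro conjI allI impI)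
        show "(\<lambda>x. coframe x (Z x)) ` W \<subseteq> Rn n"
          unfolding coframe_def using \<xi>R smooth_map_in_Rn[OF sd] by blast
        fix j assume "j < n"
        have "smooth_fun n W (\<lambda>x. \<Sum>i<n. ?d x i * \<xi> (unit i) j)"
          by (intro smooth_fun_sum smooth_fun_mult smooth_map_component[OF sd] smooth_fun_const W)
        moreover have "(\<Sum>i<n. ?d x i * \<xi> (unit i) j) = coframe x (Z x) j" if "x \<in> W" for x
        proof -
          have "\<xi> (?d x) = (\<Sum>i<n. ?d x i *\<^sub>R \<xi> (unit i))"
            by (rule linear_on_Rn_expand[OF lin\<xi> smooth_map_in_Rn[OF sd that]])
          from fun_cong[OF this, of j] show ?thesis
            unfolding coframe_def by (simp only: sum_fun_apply scaleR_fun_def real_scaleR_def)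
        qed
        ultimately show "smooth_fun n W (\<lambda>x. coframe x (Z x) j)" by (rule smooth_fun_cong[OF W])
      qed
    qed
    show "X (coframe x w) x = w" if x: "x \<in> Rn n" and w: "w \<in> Rn n" for x w
    proof -
      have "X (coframe x w) x = differential n (\<lambda>z. x \<otimes>\<^bsub>G\<^esub> z) \<one>\<^bsub>G\<^esub> (differential n (\<lambda>z. inv\<^bsub>G\<^esub> x \<otimes>\<^bsub>G\<^esub> z) x w)"
        using X_eq[of "coframe x w"] dR[OF inv_Rn[OF x] x] \<xi>R \<psi>\<xi> by (simp add: coframe_def left_invariant_field_def)
      also have "\<dots> = w"
        using differential_left_mult_comp[OF x inv_Rn[OF x] x, of w] differential_left_one[OF x w] x by simp
      finally show ?thesis .
    qed
    show "coframe x (X v x) = v" if x: "x \<in> Rn n" and v: "v \<in> Rn n" for x v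
    proof -
      have "differential n (\<lambda>z. inv\<^bsub>G\<^esub> x \<otimes>\<^bsub>G\<^esub> z) x (X v x) = \<psi> v"
        using differential_left_mult_comp[OF inv_Rn[OF x] x one_Rn, of "\<psi> v"]
          differential_left_one[OF one_Rn \<psi>R[OF v]] x X_eq[OF v] by (simp add: left_invariant_field_def)
      then show ?thesis using \<xi>\<psi>[OF v] by (simp add: coframe_def)
    qed
    show "br u v \<in> Rn n" if "u \<in> Rn n" "v \<in> Rn n" for u v using br that .
    show "commutator n (X u) (X v) x = X (br u v) x" if "u \<in> Rn n" "v \<in> Rn n" "x \<in> Rn n" for u v x
    proof -
      have "X u = left_invariant_field n G (\<psi> u)" "X v = left_invariant_field n G (\<psi> v)"
        by (rule ext, rule X_eq, rule that)+
      then show ?thesis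
        using commutator_left_invariant[OF \<psi>R \<psi>R] X_eq[OF br] hom that by simp
    qed
  qed
  then show ?thesis using that X_eq by blast
qed

end

section \<open>The parallelism of the Hilbert--Cartan equation\<close>

text \<open>
  The field \<open>v\<^sub>0 X + v\<^sub>1 Z + v\<^sub>2 W + v\<^sub>3 Y + v\<^sub>4 T\<close>, with \<open>W = [Z, X] = 2 z\<^sub>2 \<partial>\<^sub>y + \<partial>\<^bsub>z\<^sub>1\<^esub>\<close>, \<open>Y = \<partial>\<^sub>y\<close> and
  \<open>T = \<partial>\<^sub>z\<close>, where \<open>X\<close> and \<open>Z\<close> are the generators of the Hilbert--Cartan distribution.
\<close>

definition hc_field :: "rvec \<Rightarrow> rvec \<Rightarrow> rvec" where
  "hc_field v p = (\<lambda>_. 0)(0 := v 0, 1 := v 0 * (p 4)\<^sup>2 + 2 * v 2 * p 4 + v 3, 2 := v 0 * p 3 + v 4,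
     3 := v 0 * p 4 + v 2, 4 := v 1)"

definition hc_coframe :: "rvec \<Rightarrow> rvec \<Rightarrow> rvec" where
  "hc_coframe p w = (\<lambda>_. 0)(0 := w 0, 1 := w 4, 2 := w 3 - w 0 * p 4,
     3 := w 1 - w 0 * (p 4)\<^sup>2 - 2 * (w 3 - w 0 * p 4) * p 4, 4 := w 2 - w 0 * p 3)"

text \<open>
  The free nilpotent Lie algebra of step 3 on two generators in the basis \<open>X, Z, W, Y, T\<close>:
  \<open>[Z, X] = W\<close>, \<open>[Z, W] = 2 Y\<close>, \<open>[X, W] = - T\<close>.
\<close>

definition hc_bracket :: "rvec \<Rightarrow> rvec \<Rightarrow> rvec" where
  "hc_bracket u v = (\<lambda>_. 0)(2 := u 1 * v 0 - u 0 * v 1, 3 := 2 * (u 1 * v 2 - u 2 * v 1), 4 := u 2 * v 0 - u 0 * v 2)"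

definition hc_plane :: "rvec set" where "hc_plane = span {unit 0, unit 1}"

lemma sum_lessThan_5: "(\<Sum>i<5. f i) = f 0 + f 1 + f 2 + f 3 + f (4::nat)" for f :: "nat \<Rightarrow> 'a::comm_monoid_add"
  by (simp add: eval_nat_numeral)

lemma Rn_5_eqI:
  assumes "u \<in> Rn 5" "v \<in> Rn 5" "u 0 = v 0" "u 1 = v 1" "u 2 = v 2" "u 3 = v 3" "u 4 = v 4"
  shows "u = v"
proof
  fix i :: nat
  have "i = 0 \<or> i = 1 \<or> i = 2 \<or> i = 3 \<or> i = 4 \<or> i \<ge> 5" by arith
  then show "u i = v i" using assms by (auto simp: Rn_def)
qed

lemma hc_in_Rn: "hc_field v p \<in> Rn 5" "hc_coframe p w \<in> Rn 5" "hc_bracket u v \<in> Rn 5"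
  by (auto simp: Rn_def hc_field_def hc_coframe_def hc_bracket_def)

lemma smooth_quadratic: "smooth_fun 5 (Rn 5) (\<lambda>p. \<alpha> * (p 4)\<^sup>2 + \<beta> * p 4 + \<gamma> * p 3 + \<delta>)"
  unfolding power2_eq_square
  by (intro smooth_fun_add smooth_fun_mult smooth_fun_const smooth_fun_coord open_in_Rn)

text \<open>
  Every component of every field in the frame is a polynomial of this shape, so this one formula
  gives all brackets.
\<close>

lemma dir_deriv_quadratic: "dir_deriv 5 (\<lambda>p. \<alpha> * (p 4)\<^sup>2 + \<beta> * p 4 + \<gamma> * p 3 + \<delta>) p w = (2 * \<alpha> * p 4 + \<beta>) * w 4 + \<gamma> * w 3"
proof -
  have "partial i (\<lambda>p. \<alpha> * (p 4)\<^sup>2 + \<beta> * p 4 + \<gamma> * p 3 + \<delta>) p =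
     (if i = 4 then 2 * \<alpha> * p 4 + \<beta> else if i = 3 then \<gamma> else 0)" for i
    by (rule partial_eqI) (auto intro!: derivative_eq_intros)
  then show ?thesis by (simp add: dir_deriv_def sum_lessThan_5)
qed

lemma hc_field_quadratic:
  "hc_field v p 0 = 0 * (p 4)\<^sup>2 + 0 * p 4 + 0 * p 3 + v 0"
  "hc_field v p 1 = v 0 * (p 4)\<^sup>2 + (2 * v 2) * p 4 + 0 * p 3 + v 3"
  "hc_field v p 2 = 0 * (p 4)\<^sup>2 + 0 * p 4 + v 0 * p 3 + v 4"
  "hc_field v p 3 = 0 * (p 4)\<^sup>2 + v 0 * p 4 + 0 * p 3 + v 2"
  "hc_field v p 4 = 0 * (p 4)\<^sup>2 + 0 * p 4 + 0 * p 3 + v 1"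
  by (simp_all add: hc_field_def)

lemma linear_hc_field: "linear (\<lambda>v. hc_field v p)"
  by (rule linearI) (auto simp: hc_field_def fun_eq_iff scaleR_fun_def algebra_simps)

lemma smooth_hc_field: "smooth_map 5 (Rn 5) 5 (hc_field v)"
  unfolding smooth_map_def
proof (intro conjI allI impI)
  fix j :: nat assume "j < 5"
  then have "j = 0 \<or> j = 1 \<or> j = 2 \<or> j = 3 \<or> j = 4" by arith
  then show "smooth_fun 5 (Rn 5) (\<lambda>p. hc_field v p j)"
    by (elim disjE) (simp_all only: hc_field_quadratic smooth_quadratic)
qed (use hc_in_Rn in auto)

lemma commutator_hc_field: "commutator 5 (hc_field u) (hc_field v) p = hc_field (hc_bracket u v) p" if "p \<in> Rn 5"
proof (rule Rn_5_eqI)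
  show "commutator 5 (hc_field u) (hc_field v) p \<in> Rn 5"
    by (rule commutator_in_Rn[OF open_in_Rn smooth_hc_field smooth_hc_field that])
qed (simp_all only: commutator_dir_deriv hc_field_quadratic dir_deriv_quadratic hc_in_Rn,
     simp_all add: hc_bracket_def algebra_simps)

lemma parallelism_hc: "parallelism 5 hc_field hc_coframe hc_bracket"
proof (rule parallelism.intro)
  show "smooth_map 5 W 5 (\<lambda>x. hc_coframe x (Z x))" if W: "open_in 5 W" and Z: "smooth_map 5 W 5 Z" for W Z
    unfolding smooth_map_def
  proof (intro conjI allI impI)
    fix j :: nat assume "j < 5"
    then have "j = 0 \<or> j = 1 \<or> j = 2 \<or> j = 3 \<or> j = 4" by arith
    then show "smooth_fun 5 W (\<lambda>x. hc_coframe x (Z x) j)"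
      by (elim disjE) (simp_all add: hc_coframe_def power2_eq_square smooth_map_component[OF Z W] smooth_fun_add[OF W] smooth_fun_diff[OF W] smooth_fun_mult[OF W]
         smooth_fun_const[OF W] smooth_fun_coord[OF W])
  qed (use hc_in_Rn in auto)
  show "hc_field (hc_coframe x w) x = w" if "w \<in> Rn 5" for x w
    by (rule Rn_5_eqI) (simp_all only: that hc_in_Rn, simp_all add: hc_field_def hc_coframe_def algebra_simps)
  show "hc_coframe x (hc_field v x) = v" if "v \<in> Rn 5" for x v
    by (rule Rn_5_eqI) (simp_all only: that hc_in_Rn, simp_all add: hc_field_def hc_coframe_def algebra_simps)
qed (use linear_hc_field smooth_hc_field hc_in_Rn commutator_hc_field in auto)

interpretation hc: parallelism 5 hc_field hc_coframe hc_bracket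
  by (rule parallelism_hc)

lemma hilbert_cartan_parallel: "hilbert_cartan = (\<lambda>p. (\<lambda>u. hc_field u p) ` hc_plane)"
proof
  fix p
  have "hc_field (unit 0) p = (\<lambda>_. 0)(0 := 1, 1 := (p 4)\<^sup>2, 2 := p 3, 3 := p 4)"
    "hc_field (unit 1) p = (\<lambda>_. 0)(4 := 1)"
    by (auto simp: hc_field_def unit_apply fun_eq_iff)
  then show "hilbert_cartan p = (\<lambda>u. hc_field u p) ` hc_plane"
    unfolding hilbert_cartan_def hc_plane_def linear_span_image[OF linear_hc_field, symmetric] by simp
qed

lemma distribution_hilbert_cartan: "distribution 2 5 (Rn 5) hilbert_cartan"
  unfolding hilbert_cartan_parallel
proof (rule hc.distribution_parallel)
  show V: "subspace hc_plane" by (simp add: hc_plane_def)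
  show VR: "hc_plane \<subseteq> Rn 5" unfolding hc_plane_def by (rule span_minimal[OF _ subspace_Rn]) auto
  have ne: "unit 0 \<noteq> unit 1" by (auto simp: unit_def fun_eq_iff)
  have "unit 1 \<noteq> k *\<^sub>R unit 0" for k
  proof
    assume "unit 1 = k *\<^sub>R unit 0"
    then have "unit 1 1 = (k *\<^sub>R unit 0) 1" by (rule fun_cong)
    then show False by (simp add: unit_apply scaleR_fun_def)
  qed
  then have "unit 1 \<notin> span {unit 0}" by (auto simp: span_singleton)
  moreover have "unit 0 \<noteq> 0" by (auto simp: unit_apply fun_eq_iff)
  ultimately have "independent {unit 1, unit 0}"
    using ne by (simp add: independent_insert)
  then show "dim hc_plane = 2" using ne by (simp add: hc_plane_def dim_eq_card_independent insert_commute)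
  let ?F = "bracket_flag hc_bracket hc_plane 3"
  have F3: "?F = bracket_flag hc_bracket hc_plane (Suc (Suc (Suc 0)))" by (simp add: numeral_3_eq_3)
  have e: "unit 0 \<in> hc_plane" "unit 1 \<in> hc_plane" by (auto simp: hc_plane_def intro: span_base)
  have b2: "hc_bracket (unit 1) (unit 0) = unit 2" by (auto simp: hc_bracket_def unit_apply fun_eq_iff)
  have e2: "unit 2 \<in> bracket_flag hc_bracket hc_plane (Suc (Suc 0))"
    unfolding bracket_flag.simps using e b2[symmetric] by (intro span_base) auto
  have sub: "subspace ?F" by (rule hc.bracket_flag_subspace[OF V])
  have mem2: "hc_bracket u (unit 2) \<in> ?F" if "u \<in> hc_plane" for u
    unfolding F3 bracket_flag.simps(3)[of _ _ "Suc 0"] using e2 that by (intro span_base) blast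
  have e3: "unit 3 \<in> ?F"
  proof -
    have "unit 3 = (1/2) *\<^sub>R hc_bracket (unit 1) (unit 2)"
      by (auto simp: hc_bracket_def unit_apply fun_eq_iff scaleR_fun_def)
    then show ?thesis using subspace_scale[OF sub mem2[OF e(2)]] by metis
  qed
  have e4: "unit 4 \<in> ?F"
  proof -
    have "unit 4 = (-1) *\<^sub>R hc_bracket (unit 0) (unit 2)"
      by (auto simp: hc_bracket_def unit_apply fun_eq_iff scaleR_fun_def)
    then show ?thesis using subspace_scale[OF sub mem2[OF e(1)]] by metis
  qed
  have "hc_plane \<subseteq> ?F" "bracket_flag hc_bracket hc_plane (Suc (Suc 0)) \<subseteq> ?F"
    unfolding F3 using hc.bracket_flag_Suc[OF V] by blast+
  then have "unit i \<in> ?F" if "i < 5" for i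
  proof -
    have "i = 0 \<or> i = 1 \<or> i = 2 \<or> i = 3 \<or> i = 4" using that by arith
    then show ?thesis using e e2 e3 e4 \<open>hc_plane \<subseteq> ?F\<close> \<open>bracket_flag hc_bracket hc_plane (Suc (Suc 0)) \<subseteq> ?F\<close> by blast
  qed
  then have "(\<Sum>i<5. v i *\<^sub>R unit i) \<in> ?F" for v :: rvec
    by (intro subspace_sum[OF sub] subspace_scale[OF sub]) auto
  then have "Rn 5 \<subseteq> ?F" using Rn_expand by (metis subsetI)
  then show "?F = Rn 5" using hc.bracket_flag_Rn[OF VR] by blast
qed

section \<open>Graded Lie algebras with growth (2,1,2)\<close>

lemma span_2: "x \<in> span {a, b} \<longleftrightarrow> (\<exists>p q. x = p *\<^sub>R a + q *\<^sub>R b)" for a b :: "'a::real_vector"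
  by (auto simp: span_insert span_singleton algebra_simps)

lemma span_3: "x \<in> span {a, b, c} \<longleftrightarrow> (\<exists>p q r. x = p *\<^sub>R a + q *\<^sub>R b + r *\<^sub>R c)" for a b c :: "'a::real_vector"
proof -
  have "x \<in> span {a, b, c} \<longleftrightarrow> (\<exists>k. x - k *\<^sub>R a \<in> span {b, c})" by (rule span_insert[THEN eqset_imp_iff, simplified])
  also have "\<dots> \<longleftrightarrow> (\<exists>k p q. x - k *\<^sub>R a = p *\<^sub>R b + q *\<^sub>R c)" unfolding span_2 ..
  also have "\<dots> \<longleftrightarrow> (\<exists>p q r. x = p *\<^sub>R a + q *\<^sub>R b + r *\<^sub>R c)"
    by (simp only: diff_eq_eq) (simp add: algebra_simps)
  finally show ?thesis .
qed

locale graded_algebra =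
  fixes n :: nat and g :: "nat \<Rightarrow> rvec set" and br :: "rvec \<Rightarrow> rvec \<Rightarrow> rvec"
  assumes graded: "graded_lie_algebra n g br"
begin

lemma g_zero: "g 0 = {0}" and g_subspace: "subspace (g i)" and g_Rn: "v \<in> g i \<Longrightarrow> v \<in> Rn n"
  and br_g: "u \<in> g i \<Longrightarrow> v \<in> g j \<Longrightarrow> br u v \<in> g (i + j)"
  using graded by (auto simp: graded_lie_algebra_def)

lemma decomp: "v \<in> Rn n \<Longrightarrow> \<exists>!y. (\<forall>i. y i \<in> g i) \<and> finite {i. y i \<noteq> 0} \<and> v = (\<Sum>i | y i \<noteq> 0. y i)"
  using graded by (simp add: graded_lie_algebra_def)

lemma br_Rn: "u \<in> Rn n \<Longrightarrow> v \<in> Rn n \<Longrightarrow> br u v \<in> Rn n"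
  and br_self: "u \<in> Rn n \<Longrightarrow> br u u = 0"
  and br_left: "u \<in> Rn n \<Longrightarrow> v \<in> Rn n \<Longrightarrow> w \<in> Rn n \<Longrightarrow> br (a *\<^sub>R u + b *\<^sub>R v) w = a *\<^sub>R br u w + b *\<^sub>R br v w"
  and br_right: "u \<in> Rn n \<Longrightarrow> v \<in> Rn n \<Longrightarrow> w \<in> Rn n \<Longrightarrow> br w (a *\<^sub>R u + b *\<^sub>R v) = a *\<^sub>R br w u + b *\<^sub>R br w v"
  using graded by (auto simp: graded_lie_algebra_def lie_algebra_def)

lemma Rn_lincomb: "u \<in> Rn n \<Longrightarrow> v \<in> Rn n \<Longrightarrow> a *\<^sub>R u + b *\<^sub>R v \<in> Rn n"
  by (intro subspace_add[OF subspace_Rn] subspace_scale[OF subspace_Rn])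

lemma zero_Rn: "0 \<in> Rn n" by (rule subspace_0[OF subspace_Rn])

lemma br_scale_left: "u \<in> Rn n \<Longrightarrow> w \<in> Rn n \<Longrightarrow> br (a *\<^sub>R u) w = a *\<^sub>R br u w"
  using br_left[of u u w a 0] by (simp only: scaleR_zero_left add_0_right)

lemma br_scale_right: "u \<in> Rn n \<Longrightarrow> w \<in> Rn n \<Longrightarrow> br w (a *\<^sub>R u) = a *\<^sub>R br w u"
  using br_right[of u u w a 0] by (simp only: scaleR_zero_left add_0_right)

lemma br_zero_left: "w \<in> Rn n \<Longrightarrow> br 0 w = 0"
  using br_scale_left[of w w 0] by (simp only: scaleR_zero_left)

lemma br_zero_right: "w \<in> Rn n \<Longrightarrow> br w 0 = 0"
  using br_scale_right[of w w 0] by (simp only: scaleR_zero_left)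

lemma br_add_left: "u \<in> Rn n \<Longrightarrow> v \<in> Rn n \<Longrightarrow> w \<in> Rn n \<Longrightarrow> br (u + v) w = br u w + br v w"
  using br_left[of u v w 1 1] by (simp only: scaleR_one)

lemma br_add_right: "u \<in> Rn n \<Longrightarrow> v \<in> Rn n \<Longrightarrow> w \<in> Rn n \<Longrightarrow> br w (u + v) = br w u + br w v"
  using br_right[of u v w 1 1] by (simp only: scaleR_one)

lemma br_antisym:
  assumes "u \<in> Rn n" "v \<in> Rn n" shows "br u v = - br v u"
proof -
  have s: "u + v \<in> Rn n" using assms by (rule subspace_add[OF subspace_Rn])
  have "0 = br (u + v) (u + v)" using br_self[OF s] by simp
  also have "\<dots> = (br u u + br v u) + (br u v + br v v)"
    using assms s by (simp only: br_add_left br_add_right)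
  also have "\<dots> = br v u + br u v" unfolding br_self[OF assms(1)] br_self[OF assms(2)] by (simp only: add_0_left add_0_right)
  finally show ?thesis using minus_unique by metis
qed

lemma sum_Rn: "(\<And>i. i \<in> J \<Longrightarrow> f i \<in> Rn n) \<Longrightarrow> sum f J \<in> Rn n"
  by (rule subspace_sum[OF subspace_Rn])

lemma br_sum_left:
  assumes "finite J" "\<And>i. i \<in> J \<Longrightarrow> f i \<in> Rn n" "w \<in> Rn n"
  shows "br (\<Sum>i\<in>J. f i) w = (\<Sum>i\<in>J. br (f i) w)"
  using assms
proof (induction J rule: finite_induct)
  case empty then show ?case using br_zero_left[of w] by (simp only: sum.empty)
next
  case (insert i J)
  have "br (f i + (\<Sum>i\<in>J. f i)) w = br (f i) w + br (\<Sum>i\<in>J. f i) w"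
    using insert.prems by (intro br_add_left sum_Rn) auto
  also have "br (\<Sum>i\<in>J. f i) w = (\<Sum>i\<in>J. br (f i) w)" using insert by blast
  finally show ?case by (simp only: sum.insert[OF insert.hyps])
qed

lemma br_sum_right:
  assumes "finite J" "\<And>i. i \<in> J \<Longrightarrow> f i \<in> Rn n" "w \<in> Rn n"
  shows "br w (\<Sum>i\<in>J. f i) = (\<Sum>i\<in>J. br w (f i))"
  using assms
proof (induction J rule: finite_induct)
  case empty then show ?case using br_zero_right[of w] by (simp only: sum.empty)
next
  case (insert i J)
  have "br w (f i + (\<Sum>i\<in>J. f i)) = br w (f i) + br w (\<Sum>i\<in>J. f i)"
    using insert.prems by (intro br_add_right sum_Rn) auto
  also have "br w (\<Sum>i\<in>J. f i) = (\<Sum>i\<in>J. br w (f i))" using insert by blast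
  finally show ?case by (simp only: sum.insert[OF insert.hyps])
qed

definition component :: "rvec \<Rightarrow> nat \<Rightarrow> rvec" where
  "component v = (THE y. (\<forall>i. y i \<in> g i) \<and> finite {i. y i \<noteq> 0} \<and> v = (\<Sum>i | y i \<noteq> 0. y i))"

lemma component_props:
  assumes "v \<in> Rn n"
  shows component_g: "component v i \<in> g i" and "finite {i. component v i \<noteq> 0}" and "v = (\<Sum>i | component v i \<noteq> 0. component v i)"
proof -
  have "(\<forall>i. component v i \<in> g i) \<and> finite {i. component v i \<noteq> 0} \<and> v = (\<Sum>i | component v i \<noteq> 0. component v i)"
    unfolding component_def by (rule theI'[OF decomp[OF assms]])
  then show "component v i \<in> g i" "finite {i. component v i \<noteq> 0}" "v = (\<Sum>i | component v i \<noteq> 0. component v i)" by auto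
qed

lemma component_Rn: "v \<in> Rn n \<Longrightarrow> component v i \<in> Rn n"
  using component_g g_Rn by blast

lemma component_unique:
  assumes v: "v \<in> Rn n" and y: "\<And>i. y i \<in> g i" and J: "finite J" "\<And>i. i \<notin> J \<Longrightarrow> y i = 0" and sum: "v = (\<Sum>i\<in>J. y i)"
  shows "component v = y"
proof -
  have sub: "{i. y i \<noteq> 0} \<subseteq> J" using J(2) by blast
  have "(\<Sum>i | y i \<noteq> 0. y i) = (\<Sum>i\<in>J. y i)"
    by (rule sum.mono_neutral_left[OF J(1) sub]) auto
  then have "v = (\<Sum>i | y i \<noteq> 0. y i)" using sum by (simp only:)
  then have "(\<forall>i. y i \<in> g i) \<and> finite {i. y i \<noteq> 0} \<and> v = (\<Sum>i | y i \<noteq> 0. y i)"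
    using y finite_subset[OF sub J(1)] by blast
  then show ?thesis unfolding component_def by (rule the1_equality[OF decomp[OF v]])
qed

lemma component_sum:
  assumes "v \<in> Rn n"
  obtains N where "\<And>i. i > N \<Longrightarrow> component v i = 0" "v = (\<Sum>i\<le>N. component v i)"
proof -
  obtain N where N: "\<And>i. component v i \<noteq> 0 \<Longrightarrow> i \<le> N"
    using component_props(2)[OF assms] unfolding finite_nat_set_iff_bounded_le by blast
  have "(\<Sum>i | component v i \<noteq> 0. component v i) = (\<Sum>i\<le>N. component v i)"
    using N by (intro sum.mono_neutral_left) auto
  then have "v = (\<Sum>i\<le>N. component v i)" using component_props(3)[OF assms] by (rule trans[rotated])
  moreover have "component v i = 0" if "i > N" for i using N that by (meson not_le)
  ultimately show ?thesis using that by blast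
qed

lemma component_lin:
  assumes u: "u \<in> Rn n" and v: "v \<in> Rn n"
  shows "component (a *\<^sub>R u + b *\<^sub>R v) i = a *\<^sub>R component u i + b *\<^sub>R component v i"
proof -
  obtain N where N: "\<And>i. i > N \<Longrightarrow> component u i = 0" "u = (\<Sum>i\<le>N. component u i)" using component_sum[OF u] by blast
  obtain K where K: "\<And>i. i > K \<Longrightarrow> component v i = 0" "v = (\<Sum>i\<le>K. component v i)" using component_sum[OF v] by blast
  have uN: "u = (\<Sum>i\<le>max N K. component u i)"
    by (rule trans[OF N(2)], rule sum.mono_neutral_left) (use N(1) in auto)
  have vK: "v = (\<Sum>i\<le>max N K. component v i)"
    by (rule trans[OF K(2)], rule sum.mono_neutral_left) (use K(1) in auto)
  have "component (a *\<^sub>R u + b *\<^sub>R v) = (\<lambda>i. a *\<^sub>R component u i + b *\<^sub>R component v i)"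
  proof (rule component_unique[OF Rn_lincomb[OF u v], of _ "{..max N K}"])
    show "a *\<^sub>R component u i + b *\<^sub>R component v i \<in> g i" for i
      by (intro subspace_add[OF g_subspace] subspace_scale[OF g_subspace] component_g u v)
    show "a *\<^sub>R component u i + b *\<^sub>R component v i = 0" if "i \<notin> {..max N K}" for i
      using N(1)[of i] K(1)[of i] that by simp
    have "a *\<^sub>R u + b *\<^sub>R v = a *\<^sub>R (\<Sum>i\<le>max N K. component u i) + b *\<^sub>R (\<Sum>i\<le>max N K. component v i)"
      using uN vK by metis
    then show "a *\<^sub>R u + b *\<^sub>R v = (\<Sum>i\<le>max N K. a *\<^sub>R component u i + b *\<^sub>R component v i)"
      by (simp only: scaleR_sum_right sum.distrib)
  qed simp
  then show ?thesis by (rule fun_cong)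
qed

lemma component_homogeneous:
  assumes "v \<in> g k" shows "component v i = (if i = k then v else 0)"
proof -
  have "component v = (\<lambda>i. if i = k then v else 0)"
    by (rule component_unique[OF g_Rn[OF assms], of _ "{k}"]) (use assms subspace_0[OF g_subspace] in auto)
  then show ?thesis by (rule fun_cong)
qed

lemma component_zero: "component 0 i = 0"
  using component_homogeneous[OF subspace_0[OF g_subspace, of 0], of i] by metis

lemma component_fun_sum:
  assumes "finite J" "\<And>j. j \<in> J \<Longrightarrow> f j \<in> Rn n"
  shows "component (\<Sum>j\<in>J. f j) i = (\<Sum>j\<in>J. component (f j) i)"
  using assms
proof (induction J rule: finite_induct)
  case empty show ?case by (simp only: sum.empty component_zero)
next
  case (insert j J)
  have "component (1 *\<^sub>R f j + 1 *\<^sub>R (\<Sum>j\<in>J. f j)) i = 1 *\<^sub>R component (f j) i + 1 *\<^sub>R component (\<Sum>j\<in>J. f j) i"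
    using insert.prems by (intro component_lin sum_Rn) auto
  moreover have "component (\<Sum>j\<in>J. f j) i = (\<Sum>j\<in>J. component (f j) i)" using insert by blast
  ultimately show ?case by (simp only: sum.insert[OF insert.hyps] scaleR_one)
qed

lemma component_bracket:
  assumes u: "u \<in> Rn n" and v: "v \<in> Rn n" and k: "k \<le> 3"
  shows "component (br u v) k = (\<Sum>i\<le>3. \<Sum>j\<le>3. if i + j = k then br (component u i) (component v j) else 0)"
proof -
  obtain N where N: "\<And>i. i > N \<Longrightarrow> component u i = 0" "u = (\<Sum>i\<le>N. component u i)" using component_sum[OF u] by blast
  obtain K where K: "\<And>i. i > K \<Longrightarrow> component v i = 0" "v = (\<Sum>i\<le>K. component v i)" using component_sum[OF v] by blast
  define M where "M = max 3 (max N K)"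
  have uN: "u = (\<Sum>i\<le>M. component u i)"
    by (rule trans[OF N(2)], rule sum.mono_neutral_left) (use N(1) in \<open>auto simp: M_def\<close>)
  have vK: "v = (\<Sum>i\<le>M. component v i)"
    by (rule trans[OF K(2)], rule sum.mono_neutral_left) (use K(1) in \<open>auto simp: M_def\<close>)
  have "br u v = br (\<Sum>i\<le>M. component u i) v" using uN by metis
  also have "\<dots> = (\<Sum>i\<le>M. br (component u i) v)" by (intro br_sum_left component_Rn u v) auto
  also have "\<dots> = (\<Sum>i\<le>M. br (component u i) (\<Sum>j\<le>M. component v j))" using vK by metis
  also have "\<dots> = (\<Sum>i\<le>M. \<Sum>j\<le>M. br (component u i) (component v j))"
    by (intro sum.cong refl br_sum_right component_Rn u v) auto
  finally have "component (br u v) k = component (\<Sum>i\<le>M. \<Sum>j\<le>M. br (component u i) (component v j)) k" by (rule arg_cong)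
  also have "\<dots> = (\<Sum>i\<le>M. component (\<Sum>j\<le>M. br (component u i) (component v j)) k)"
    by (intro component_fun_sum sum_Rn br_Rn component_Rn u v) auto
  also have "\<dots> = (\<Sum>i\<le>M. \<Sum>j\<le>M. component (br (component u i) (component v j)) k)"
    by (intro sum.cong refl component_fun_sum br_Rn component_Rn u v) auto
  also have "\<dots> = (\<Sum>i\<le>M. \<Sum>j\<le>M. if i + j = k then br (component u i) (component v j) else 0)"
    using component_homogeneous[OF br_g[OF component_g[OF u] component_g[OF v]]] by (intro sum.cong refl) auto
  also have "\<dots> = (\<Sum>i\<le>3. \<Sum>j\<le>M. if i + j = k then br (component u i) (component v j) else 0)"
    using k by (intro sum.mono_neutral_right) (auto simp: M_def intro!: sum.neutral)
  also have "\<dots> = (\<Sum>i\<le>3. \<Sum>j\<le>3. if i + j = k then br (component u i) (component v j) else 0)"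
    using k by (intro sum.cong refl sum.mono_neutral_right) (auto simp: M_def)
  finally show ?thesis .
qed

lemma component_0: "v \<in> Rn n \<Longrightarrow> component v 0 = 0"
  using component_g[of v 0] g_zero by blast

lemma sum_atMost_3: "(\<Sum>i\<le>3. f i) = f 0 + f 1 + f 2 + f (3::nat)" for f :: "nat \<Rightarrow> 'a::comm_monoid_add"
  by (simp add: eval_nat_numeral)

text \<open>
  The bracket modulo degree \<open>4\<close>. As there is nothing in degree \<open>0\<close>, it involves only the components of
  degree \<open>1\<close> and \<open>2\<close>.
\<close>

lemma component_bracket_123:
  assumes u: "u \<in> Rn n" and v: "v \<in> Rn n"
  shows "component (br u v) 1 = 0" "component (br u v) 2 = br (component u 1) (component v 1)"
    "component (br u v) 3 = br (component u 1) (component v 2) + br (component u 2) (component v 1)"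
proof -
  have z: "br 0 (component v i) = 0" "br (component u i) 0 = 0" for i
    using br_zero_left[OF component_Rn[OF v]] br_zero_right[OF component_Rn[OF u]] by auto
  note simps = sum_atMost_3 component_0[OF u] component_0[OF v] z
  show "component (br u v) 1 = 0" "component (br u v) 2 = br (component u 1) (component v 1)"
    "component (br u v) 3 = br (component u 1) (component v 2) + br (component u 2) (component v 1)"
    using component_bracket[OF assms, of 1] component_bracket[OF assms, of 2] component_bracket[OF assms, of 3]
    by (simp_all add: simps del: One_nat_def)
qed

end

context graded_algebra begin

text \<open>
  Modulo degree \<open>4\<close> the algebra is spanned by \<open>e\<^sub>1, e\<^sub>2\<close>, \<open>w = [e\<^sub>2, e\<^sub>1]\<close>, \<open>t\<^sub>1 = [e\<^sub>1, w]\<close> and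
  \<open>t\<^sub>2 = [e\<^sub>2, w]\<close>. The third member of the flag of brackets lies in the span of these vectors and has
  dimension \<open>5\<close>, so they are independent, and the brackets among them are those of the frame
  \<open>X, Z, W, Y, T\<close> under \<open>e\<^sub>1 \<mapsto> X\<close>, \<open>e\<^sub>2 \<mapsto> Z\<close>, \<open>w \<mapsto> W\<close>, \<open>t\<^sub>1 \<mapsto> - T\<close>, \<open>t\<^sub>2 \<mapsto> 2 Y\<close>. The homomorphism
  discards the components of degree at least \<open>4\<close>.
\<close>

lemma ex_hom_to_hc_bracket:
  assumes d1: "dim (g 1) = 2" and d3: "dim (bracket_flag br (g 1) 3) = 5" and s: "bracket_flag br (g 1) s = Rn n"
  shows "\<exists>\<Lambda>. linear \<Lambda> \<and>
    (\<forall>u\<in>Rn n. \<forall>v\<in>Rn n. \<Lambda> (br u v) = hc_bracket (\<Lambda> u) (\<Lambda> v)) \<and>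
    \<Lambda> ` Rn n = Rn 5 \<and> \<Lambda> ` g 1 = hc_plane \<and> (\<forall>v\<in>bracket_flag br (g 1) 2. \<Lambda> v = 0 \<longrightarrow> v = 0)"
proof -
  obtain B where B: "B \<subseteq> g 1" "independent B" "g 1 \<subseteq> span B" "card B = 2"
    using basis_exists[of "g 1"] d1 by metis
  then obtain e1 e2 where "B = {e1, e2}" by (meson card_2_iff)
  then have e: "e1 \<in> g 1" "e2 \<in> g 1" and g1: "g 1 \<subseteq> span {e1, e2}" using B by auto
  define w t1 t2 where "w = br e2 e1" and "t1 = br e1 w" and "t2 = br e2 w"
  have w: "w \<in> g 2" using br_g[OF e(2,1)] unfolding w_def one_add_one .
  have t: "t1 \<in> g 3" "t2 \<in> g 3" using br_g[OF e(1) w] br_g[OF e(2) w] unfolding t1_def t2_def by (simp_all add: numeral_3_eq_3)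
  have R: "e1 \<in> Rn n" "e2 \<in> Rn n" "w \<in> Rn n" "t1 \<in> Rn n" "t2 \<in> Rn n" using e w t g_Rn by auto
  have br11: "br (a *\<^sub>R e1 + b *\<^sub>R e2) (a' *\<^sub>R e1 + b' *\<^sub>R e2) = (b * a' - a * b') *\<^sub>R w" for a b a' b'
  proof -
    have "br (a *\<^sub>R e1 + b *\<^sub>R e2) (a' *\<^sub>R e1 + b' *\<^sub>R e2) =
      a' *\<^sub>R (a *\<^sub>R br e1 e1 + b *\<^sub>R br e2 e1) + b' *\<^sub>R (a *\<^sub>R br e1 e2 + b *\<^sub>R br e2 e2)"
      using R by (simp only: br_left br_right Rn_lincomb)
    also have "\<dots> = (b * a' - a * b') *\<^sub>R w"
      unfolding br_self[OF R(1)] br_self[OF R(2)] br_antisym[OF R(1,2)] w_def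
      by (rule ext) (simp add: scaleR_fun_def algebra_simps)
    finally show ?thesis .
  qed
  have br12: "br (a *\<^sub>R e1 + b *\<^sub>R e2) (c *\<^sub>R w) = (a * c) *\<^sub>R t1 + (b * c) *\<^sub>R t2" for a b c
  proof -
    have "br (a *\<^sub>R e1 + b *\<^sub>R e2) (c *\<^sub>R w) = a *\<^sub>R (c *\<^sub>R t1) + b *\<^sub>R (c *\<^sub>R t2)"
      unfolding t1_def t2_def using R by (simp only: br_left br_scale_right subspace_scale[OF subspace_Rn])
    then show ?thesis by (simp only: scaleR_scaleR)
  qed
  have br21: "br (c *\<^sub>R w) (a *\<^sub>R e1 + b *\<^sub>R e2) = - ((a * c) *\<^sub>R t1 + (b * c) *\<^sub>R t2)" for a b c
    using br_antisym[OF subspace_scale[OF subspace_Rn R(3)] Rn_lincomb[OF R(1,2)]] unfolding br12 .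
  let ?F = "bracket_flag br (g 1)"
  define S where "S = {e1, e2, w, t1, t2}"
  have F2: "?F 2 \<subseteq> span {e1, e2, w}"
  proof -
    have "br u v \<in> span {e1, e2, w}" if uv: "u \<in> g 1" "v \<in> g 1" for u v
    proof -
      obtain a b a' b' where "u = a *\<^sub>R e1 + b *\<^sub>R e2" "v = a' *\<^sub>R e1 + b' *\<^sub>R e2"
        using uv[THEN subsetD[OF g1]] unfolding span_2 by blast
      then have "br u v = (b * a' - a * b') *\<^sub>R w" using br11 by simp
      then show ?thesis by (auto intro: span_scale span_base)
    qed
    moreover have "g 1 \<subseteq> span {e1, e2, w}" using g1 span_mono[of "{e1, e2}" "{e1, e2, w}"] by blast
    ultimately have "span (g 1 \<union> {br u v |u v. u \<in> g 1 \<and> v \<in> g 1}) \<subseteq> span {e1, e2, w}"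
      by (intro span_minimal) auto
    then show ?thesis by (simp add: numeral_2_eq_2)
  qed
  have F3: "?F 3 \<subseteq> span S"
  proof -
    have sub: "span {e1, e2, w} \<subseteq> span S" unfolding S_def by (rule span_mono) auto
    have "br u v \<in> span S" if uv: "u \<in> g 1" "v \<in> ?F 2" for u v
    proof -
      obtain a b where u: "u = a *\<^sub>R e1 + b *\<^sub>R e2" using uv(1)[THEN subsetD[OF g1]] unfolding span_2 by blast
      obtain a' b' c where v: "v = a' *\<^sub>R e1 + b' *\<^sub>R e2 + c *\<^sub>R w" using uv(2)[THEN subsetD[OF F2]] unfolding span_3 by blast
      have "br u v = br u (a' *\<^sub>R e1 + b' *\<^sub>R e2) + br u (c *\<^sub>R w)"
        unfolding v using R by (intro br_add_right Rn_lincomb subspace_scale[OF subspace_Rn] g_Rn[OF uv(1)])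
      also have "\<dots> = (b * a' - a * b') *\<^sub>R w + ((a * c) *\<^sub>R t1 + (b * c) *\<^sub>R t2)"
        unfolding u br11 br12 ..
      also have "\<dots> \<in> span S"
        by (intro span_add span_scale span_base) (auto simp: S_def)
      finally show ?thesis .
    qed
    then have "span (?F 2 \<union> {br u v |u v. u \<in> g 1 \<and> v \<in> ?F 2}) \<subseteq> span S"
      using F2 sub by (intro span_minimal) auto
    then show ?thesis by (simp add: numeral_3_eq_3 numeral_2_eq_2)
  qed
  have cS: "card S \<le> 5" using card_length[of "[e1, e2, w, t1, t2]"] by (simp add: S_def)
  (* Five spanning vectors of a space of dimension 5 are distinct and independent. *)
  have "5 \<le> card S" using dim_le_card[OF F3] d3 by (simp add: S_def)
  then have cardS: "card S = 5" using cS by simp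
  have indS: "independent S"
    unfolding dependent_def
  proof (rule notI, elim bexE)
    fix x assume x: "x \<in> S" "x \<in> span (S - {x})"
    then have "span S \<subseteq> span (S - {x})"
      by (intro span_minimal) (auto intro: span_base)
    then have "dim (?F 3) \<le> card (S - {x})" using F3 by (intro dim_le_card) (auto simp: S_def)
    then show False using d3 cardS x(1) by simp
  qed
  have distinct: "distinct [e1, e2, w, t1, t2]"
    using cardS card_distinct[of "[e1, e2, w, t1, t2]"] by (simp add: S_def)
  define f where "f x = (if x = e1 then unit 0 else if x = e2 then unit 1 else if x = w then unit 2 else
    if x = t1 then - unit 4 else 2 *\<^sub>R unit 3)" for x
  obtain l where l: "linear l" "\<And>x. x \<in> S \<Longrightarrow> l x = f x"
    using linear_independent_extend[OF indS, of f] by blast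
  have le: "l e1 = unit 0" "l e2 = unit 1" "l w = unit 2" "l t1 = - unit 4" "l t2 = 2 *\<^sub>R unit 3"
    using l(2) distinct by (auto simp: S_def f_def)
  define q where "q v = component v 1 + component v 2 + component v 3" for v
  have q_lin: "q (a *\<^sub>R u + b *\<^sub>R v) = a *\<^sub>R q u + b *\<^sub>R q v" if "u \<in> Rn n" "v \<in> Rn n" for a b u v
    unfolding q_def component_lin[OF that] by (rule ext) (simp add: scaleR_fun_def algebra_simps)
  (* The matrix of l composed with q; this is linear on the whole type, not only on Rn n. *)
  define \<Lambda> where "\<Lambda> v = (\<Sum>i<n. v i *\<^sub>R l (q (unit i)))" for v
  have lin: "linear \<Lambda>" unfolding \<Lambda>_def by (rule linear_matrix)
  have \<Lambda>: "\<Lambda> v = l (q v)" if "v \<in> Rn n" for v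
  proof -
    have "l (q (a *\<^sub>R u + b *\<^sub>R v)) = a *\<^sub>R l (q u) + b *\<^sub>R l (q v)" if "u \<in> Rn n" "v \<in> Rn n" for a b u v
      unfolding q_lin[OF that] linear_add[OF l(1)] linear_scale[OF l(1)] ..
    from linear_on_Rn_expand[of n "\<lambda>v. l (q v)", OF this \<open>v \<in> Rn n\<close>] show ?thesis
      unfolding \<Lambda>_def by metis
  qed
  (* Generation by degree 1: U contains g 1 and is closed under brackets with it, so it is everything. *)
  define U where "U = {v \<in> Rn n. component v 2 \<in> span {w} \<and> component v 3 \<in> span {t1, t2}}"
  have U: "subspace U"
    unfolding subspace_def
  proof (intro conjI ballI allI)
    show "0 \<in> U" unfolding U_def mem_Collect_eq component_zero by (intro conjI zero_Rn span_zero)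
    fix x assume x: "x \<in> U"
    show "x + y \<in> U" if y: "y \<in> U" for y
    proof -
      have xy: "x \<in> Rn n" "y \<in> Rn n" using x y by (auto simp: U_def)
      have "component (x + y) i = component x i + component y i" for i
        using component_lin[OF xy, of 1 1] by (simp only: scaleR_one)
      then show ?thesis using x y subspace_add[OF subspace_Rn xy] unfolding U_def mem_Collect_eq
        by (simp only: span_add)
    qed
    show "c *\<^sub>R x \<in> U" for c
    proof -
      have xR: "x \<in> Rn n" using x by (auto simp: U_def)
      have "component (c *\<^sub>R x) i = c *\<^sub>R component x i" for i
        using component_lin[OF xR xR, of c 0] by (simp only: scaleR_zero_left add_0_right)
      then show ?thesis using x subspace_scale[OF subspace_Rn xR] unfolding U_def mem_Collect_eq
        by (simp only: span_scale)
    qed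
  qed
  have g1U: "g 1 \<subseteq> U"
  proof
    fix v assume v: "v \<in> g 1"
    have "component v 2 = 0" "component v 3 = 0" using component_homogeneous[OF v] by auto
    then show "v \<in> U" using g_Rn[OF v] unfolding U_def mem_Collect_eq by (simp only: span_zero)
  qed
  have brU: "br u v \<in> U" if u: "u \<in> g 1" and v: "v \<in> U" for u v
  proof -
    have vR: "v \<in> Rn n" and uR: "u \<in> Rn n" using u v g_Rn by (auto simp: U_def)
    have gu: "component u 1 = u" "component u 2 = 0" using component_homogeneous[OF u] by auto
    obtain a b where ua: "u = a *\<^sub>R e1 + b *\<^sub>R e2" using u[THEN subsetD[OF g1]] unfolding span_2 by blast
    obtain a' b' where va: "component v 1 = a' *\<^sub>R e1 + b' *\<^sub>R e2" using component_g[OF vR, of 1, THEN subsetD[OF g1]] unfolding span_2 by blast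
    obtain c where vc: "component v 2 = c *\<^sub>R w" using v by (auto simp: U_def span_singleton)
    have "component (br u v) 2 = (b * a' - a * b') *\<^sub>R w"
      unfolding component_bracket_123[OF uR vR] gu va by (simp only: ua br11)
    moreover have "component (br u v) 3 = (a * c) *\<^sub>R t1 + (b * c) *\<^sub>R t2"
      unfolding component_bracket_123[OF uR vR] gu vc br_zero_left[OF component_Rn[OF vR]] by (simp only: ua br12 add_0_right)
    ultimately have "component (br u v) 2 \<in> span {w}" "component (br u v) 3 \<in> span {t1, t2}"
      by (auto intro!: span_add span_scale intro: span_base)
    then show ?thesis using br_Rn[OF uR vR] unfolding U_def by blast
  qed
  have "?F i \<subseteq> U" for i
  proof (induction i rule: induct_nat_012)
    case 0 then show ?case using subspace_0[OF U] by simp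
  next
    case 1 then show ?case using g1U by simp
  next
    case (ge2 i)
    show ?case unfolding bracket_flag.simps by (rule span_minimal[OF _ U]) (use ge2 brU in blast)
  qed
  then have allU: "v \<in> U" if "v \<in> Rn n" for v using s that by blast
  have coords: "\<exists>a b c d e. component v 1 = a *\<^sub>R e1 + b *\<^sub>R e2 \<and> component v 2 = c *\<^sub>R w \<and> component v 3 = d *\<^sub>R t1 + e *\<^sub>R t2"
    if "v \<in> Rn n" for v
  proof -
    have "component v 1 \<in> span {e1, e2}" using component_g[OF that, of 1, THEN subsetD[OF g1]] .
    moreover have "component v 2 \<in> span {w}" "component v 3 \<in> span {t1, t2}" using allU[OF that] by (auto simp: U_def)
    ultimately show ?thesis unfolding span_2 span_singleton by blast
  qed
  have l_comb: "l ((a *\<^sub>R e1 + b *\<^sub>R e2) + c *\<^sub>R w + (d *\<^sub>R t1 + e *\<^sub>R t2)) = (\<lambda>_. 0)(0 := a, 1 := b, 2 := c, 3 := 2 * e, 4 := - d)" for a b c d e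
    unfolding linear_add[OF l(1)] linear_scale[OF l(1)] le
    by (rule ext) (auto simp: scaleR_fun_def unit_apply)
  have \<Lambda>5: "\<Lambda> v \<in> Rn 5" if v: "v \<in> Rn n" for v
  proof -
    obtain a b c d e where "component v 1 = a *\<^sub>R e1 + b *\<^sub>R e2" "component v 2 = c *\<^sub>R w" "component v 3 = d *\<^sub>R t1 + e *\<^sub>R t2"
      using coords[OF v] by blast
    then have "\<Lambda> v = (\<lambda>_. 0)(0 := a, 1 := b, 2 := c, 3 := 2 * e, 4 := - d)"
      unfolding \<Lambda>[OF v] q_def by (simp only: l_comb)
    then show ?thesis by (auto simp: Rn_def)
  qed
  have hom: "\<Lambda> (br u v) = hc_bracket (\<Lambda> u) (\<Lambda> v)" if u: "u \<in> Rn n" and v: "v \<in> Rn n" for u v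
  proof -
    obtain a b c d e where uc: "component u 1 = a *\<^sub>R e1 + b *\<^sub>R e2" "component u 2 = c *\<^sub>R w" "component u 3 = d *\<^sub>R t1 + e *\<^sub>R t2"
      using coords[OF u] by blast
    obtain a' b' c' d' e' where vc: "component v 1 = a' *\<^sub>R e1 + b' *\<^sub>R e2" "component v 2 = c' *\<^sub>R w" "component v 3 = d' *\<^sub>R t1 + e' *\<^sub>R t2"
      using coords[OF v] by blast
    have \<Lambda>u: "\<Lambda> u = (\<lambda>_. 0)(0 := a, 1 := b, 2 := c, 3 := 2 * e, 4 := - d)"
      unfolding \<Lambda>[OF u] q_def uc by (rule l_comb)
    have \<Lambda>v: "\<Lambda> v = (\<lambda>_. 0)(0 := a', 1 := b', 2 := c', 3 := 2 * e', 4 := - d')"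
      unfolding \<Lambda>[OF v] q_def vc by (rule l_comb)
    have "q (br u v) = (0 *\<^sub>R e1 + 0 *\<^sub>R e2) + (b * a' - a * b') *\<^sub>R w + ((a * c' - a' * c) *\<^sub>R t1 + (b * c' - b' * c) *\<^sub>R t2)"
      unfolding q_def component_bracket_123[OF u v] uc vc br11 br12 br21
      by (rule ext) (simp add: scaleR_fun_def algebra_simps)
    then have "\<Lambda> (br u v) = (\<lambda>_. 0)(0 := 0, 1 := 0, 2 := b * a' - a * b', 3 := 2 * (b * c' - b' * c), 4 := - (a * c' - a' * c))"
      unfolding \<Lambda>[OF br_Rn[OF u v]] by (simp only: l_comb)
    then show ?thesis unfolding \<Lambda>u \<Lambda>v by (auto simp: hc_bracket_def fun_eq_iff)
  qed
  have \<Lambda>_low: "\<Lambda> (a *\<^sub>R e1 + b *\<^sub>R e2 + c *\<^sub>R w + (d *\<^sub>R t1 + e *\<^sub>R t2)) = (\<lambda>_. 0)(0 := a, 1 := b, 2 := c, 3 := 2 * e, 4 := - d)" for a b c d e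
  proof -
    have q_id: "q x = x" if "x \<in> g 1 \<or> x \<in> g 2 \<or> x \<in> g 3" for x
      using that component_homogeneous[of x] by (auto simp: q_def)
    have "\<Lambda> x = l x" if "x \<in> S" for x
      using \<Lambda>[of x] q_id[of x] that e w t R by (auto simp: S_def)
    then have "\<Lambda> e1 = l e1" "\<Lambda> e2 = l e2" "\<Lambda> w = l w" "\<Lambda> t1 = l t1" "\<Lambda> t2 = l t2" by (auto simp: S_def)
    then show ?thesis
      unfolding linear_add[OF lin] linear_scale[OF lin] l_comb[symmetric] linear_add[OF l(1)] linear_scale[OF l(1)] by simp
  qed
  have surj: "\<Lambda> ` Rn n = Rn 5"
  proof (rule subset_antisym)
    show "\<Lambda> ` Rn n \<subseteq> Rn 5" using \<Lambda>5 by blast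
    show "Rn 5 \<subseteq> \<Lambda> ` Rn n"
    proof
      fix p assume p: "p \<in> Rn 5"
      let ?x = "p 0 *\<^sub>R e1 + p 1 *\<^sub>R e2 + p 2 *\<^sub>R w + ((- p 4) *\<^sub>R t1 + (p 3 / 2) *\<^sub>R t2)"
      have "?x \<in> Rn n" using R by (intro subspace_add[OF subspace_Rn] subspace_scale[OF subspace_Rn])
      moreover have "\<Lambda> ?x = p"
        unfolding \<Lambda>_low by (rule Rn_5_eqI) (use p in \<open>auto simp: Rn_def\<close>)
      ultimately show "p \<in> \<Lambda> ` Rn n" by (metis imageI)
    qed
  qed
  have le12: "\<Lambda> e1 = unit 0" "\<Lambda> e2 = unit 1"
    using \<Lambda>_low[of 1 0 0 0 0] \<Lambda>_low[of 0 1 0 0 0] by (auto simp: unit_def fun_eq_iff)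
  have "g 1 = span {e1, e2}" using g1 e span_minimal[OF _ g_subspace, of "{e1, e2}" 1] by blast
  then have plane: "\<Lambda> ` g 1 = hc_plane"
    using linear_span_image[OF lin, of "{e1, e2}"] le12 by (simp add: hc_plane_def)
  have inj: "v = 0" if v: "v \<in> ?F 2" "\<Lambda> v = 0" for v
  proof -
    obtain a b c where vc: "v = a *\<^sub>R e1 + b *\<^sub>R e2 + c *\<^sub>R w" using v(1)[THEN subsetD[OF F2]] unfolding span_3 by blast
    have "\<Lambda> v = (\<lambda>_. 0)(0 := a, 1 := b, 2 := c, 3 := 2 * 0, 4 := - 0)"
      unfolding vc using \<Lambda>_low[of a b c 0 0] by (simp only: scaleR_zero_left add_0_right)
    from fun_cong[OF this, of 0] fun_cong[OF this, of 1] fun_cong[OF this, of 2] v(2)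
    have "a = 0" "b = 0" "c = 0" by auto
    then show ?thesis unfolding vc by (simp only: scaleR_zero_left add_0_right)
  qed
  show ?thesis
  proof (intro exI[of _ \<Lambda>] conjI ballI impI)
    show "v = 0" if "v \<in> ?F 2" "\<Lambda> v = 0" for v by (rule inj[OF that])
  qed (rule lin hom surj plane; assumption)+
qed

end

section \<open>The extension\<close>

lemma dir_deriv_affine:
  assumes "open_in n U" "smooth_fun n U f" "x \<in> U"
  shows "dir_deriv n (\<lambda>p. \<alpha> * f p + \<beta>) x w = \<alpha> * dir_deriv n f x w"
proof -
  have "smooth_fun n U (\<lambda>p. \<alpha> * f p)" by (intro smooth_fun_mult smooth_fun_const assms)
  then have "dir_deriv n (\<lambda>p. \<alpha> * f p + \<beta>) x w = dir_deriv n (\<lambda>p. \<alpha> * f p) x w + dir_deriv n (\<lambda>p. \<beta>) x w"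
    by (rule dir_deriv_plus[OF _ smooth_fun_const[OF assms(1)] assms(3)])
  also have "dir_deriv n (\<lambda>p. \<alpha> * f p) x w = dir_deriv n (\<lambda>_. \<alpha>) x w * f x + \<alpha> * dir_deriv n f x w"
    by (rule dir_deriv_mult[OF smooth_fun_const[OF assms(1)] assms(2,3)])
  finally show ?thesis by simp
qed

lemma linear_component: "linear (\<lambda>v. \<Lambda> v i)" if "linear \<Lambda>" for \<Lambda> :: "rvec \<Rightarrow> rvec"
  by (rule linearI) (simp_all add: linear_add[OF that] linear_scale[OF that] scaleR_fun_def[of _ "\<Lambda> v" for v])

lemma linear_times_const: "linear L \<Longrightarrow> linear (\<lambda>v. L v * c)" for L :: "rvec \<Rightarrow> real"
  by (rule linearI) (simp_all add: linear_add linear_scale distrib_right)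

context parallelism begin

text \<open>
  The derivatives of the components of \<open>\<pi>\<close> along the frame are prescribed by those of the field
  \<open>hc_field (\<Lambda> v)\<close>: for \<open>x\<close> and \<open>z\<^sub>2\<close> they are constant, for \<open>z\<^sub>1\<close> they involve \<open>z\<^sub>2\<close>, for \<open>z\<close> they involve
  \<open>z\<^sub>1\<close>, and for \<open>y\<close> they are quadratic in \<open>z\<^sub>2\<close>. So the system is triangular and is solved in this
  order by \<open>frame_poincare\<close>; at each step the integrability condition is one component of the
  assumption that \<open>\<Lambda>\<close> is a homomorphism.
\<close>

lemma ex_map_to_hilbert_cartan:
  assumes lin: "linear \<Lambda>"
    and hom: "\<And>u v. u \<in> Rn n \<Longrightarrow> v \<in> Rn n \<Longrightarrow> \<Lambda> (br u v) = hc_bracket (\<Lambda> u) (\<Lambda> v)"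
  obtains \<pi> where "smooth_map n (Rn n) 5 \<pi>"
    "\<And>v x. v \<in> Rn n \<Longrightarrow> x \<in> Rn n \<Longrightarrow> differential n \<pi> x (X v x) = hc_field (\<Lambda> v) (\<pi> x)"
proof -
  note lins = linear_compose_add linear_times_const linear_component[OF lin]
  have b: "\<Lambda> (br u v) 0 = 0" "\<Lambda> (br u v) 1 = 0" "\<Lambda> (br u v) 2 = \<Lambda> u 1 * \<Lambda> v 0 - \<Lambda> u 0 * \<Lambda> v 1"
    "\<Lambda> (br u v) 3 = 2 * (\<Lambda> u 1 * \<Lambda> v 2 - \<Lambda> u 2 * \<Lambda> v 1)" "\<Lambda> (br u v) 4 = \<Lambda> u 2 * \<Lambda> v 0 - \<Lambda> u 0 * \<Lambda> v 2"
    if "u \<in> Rn n" "v \<in> Rn n" for u v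
    using hom[OF that] by (auto simp: hc_bracket_def)
  note const = smooth_fun_const[OF open_in_Rn]
  obtain fx where fx: "smooth_fun n (Rn n) fx" "\<And>v x. v \<in> Rn n \<Longrightarrow> x \<in> Rn n \<Longrightarrow> dir_deriv n fx x (X v x) = \<Lambda> v 0"
    using frame_poincare[of "\<lambda>v x. \<Lambda> v 0"] lins const b by auto
  obtain fz2 where fz2: "smooth_fun n (Rn n) fz2" "\<And>v x. v \<in> Rn n \<Longrightarrow> x \<in> Rn n \<Longrightarrow> dir_deriv n fz2 x (X v x) = \<Lambda> v 1"
    using frame_poincare[of "\<lambda>v x. \<Lambda> v 1"] lins const b by auto
  have aff: "smooth_fun n (Rn n) (\<lambda>p. \<alpha> * f p + \<beta>)" if "smooth_fun n (Rn n) f" for f \<alpha> \<beta>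
    by (intro smooth_fun_add smooth_fun_mult const that open_in_Rn)
  have "\<exists>f. smooth_fun n (Rn n) f \<and> (\<forall>v\<in>Rn n. \<forall>x\<in>Rn n. dir_deriv n f x (X v x) = \<Lambda> v 0 * fz2 x + \<Lambda> v 2)"
  proof (rule frame_poincare[of "\<lambda>v x. \<Lambda> v 0 * fz2 x + \<Lambda> v 2"])
    show "linear (\<lambda>v. \<Lambda> v 0 * fz2 x + \<Lambda> v 2)" for x by (intro lins)
    show "smooth_fun n (Rn n) (\<lambda>x. \<Lambda> v 0 * fz2 x + \<Lambda> v 2)" for v by (rule aff[OF fz2(1)])
    show "dir_deriv n (\<lambda>x. \<Lambda> v 0 * fz2 x + \<Lambda> v 2) x (X u x) - dir_deriv n (\<lambda>x. \<Lambda> u 0 * fz2 x + \<Lambda> u 2) x (X v x) =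
      \<Lambda> (br u v) 0 * fz2 x + \<Lambda> (br u v) 2" if uv: "u \<in> Rn n" "v \<in> Rn n" "x \<in> Rn n" for u v x
      unfolding dir_deriv_affine[OF open_in_Rn fz2(1) uv(3)] fz2(2)[OF uv(1,3)] fz2(2)[OF uv(2,3)] b[OF uv(1,2)]
      by (simp add: algebra_simps)
  qed
  then obtain fz1 where fz1: "smooth_fun n (Rn n) fz1"
    "\<And>v x. v \<in> Rn n \<Longrightarrow> x \<in> Rn n \<Longrightarrow> dir_deriv n fz1 x (X v x) = \<Lambda> v 0 * fz2 x + \<Lambda> v 2" by blast
  have "\<exists>f. smooth_fun n (Rn n) f \<and> (\<forall>v\<in>Rn n. \<forall>x\<in>Rn n. dir_deriv n f x (X v x) = \<Lambda> v 0 * fz1 x + \<Lambda> v 4)"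
  proof (rule frame_poincare[of "\<lambda>v x. \<Lambda> v 0 * fz1 x + \<Lambda> v 4"])
    show "linear (\<lambda>v. \<Lambda> v 0 * fz1 x + \<Lambda> v 4)" for x by (intro lins)
    show "smooth_fun n (Rn n) (\<lambda>x. \<Lambda> v 0 * fz1 x + \<Lambda> v 4)" for v by (rule aff[OF fz1(1)])
    show "dir_deriv n (\<lambda>x. \<Lambda> v 0 * fz1 x + \<Lambda> v 4) x (X u x) - dir_deriv n (\<lambda>x. \<Lambda> u 0 * fz1 x + \<Lambda> u 4) x (X v x) =
      \<Lambda> (br u v) 0 * fz1 x + \<Lambda> (br u v) 4" if uv: "u \<in> Rn n" "v \<in> Rn n" "x \<in> Rn n" for u v x
      unfolding dir_deriv_affine[OF open_in_Rn fz1(1) uv(3)] fz1(2)[OF uv(1,3)] fz1(2)[OF uv(2,3)] b[OF uv(1,2)]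
      by (simp add: algebra_simps)
  qed
  then obtain fz where fz: "smooth_fun n (Rn n) fz"
    "\<And>v x. v \<in> Rn n \<Longrightarrow> x \<in> Rn n \<Longrightarrow> dir_deriv n fz x (X v x) = \<Lambda> v 0 * fz1 x + \<Lambda> v 4" by blast
  (* The part of the derivative of y that depends on z2. *)
  define \<sigma> where "\<sigma> v x = (\<Lambda> v 0 * fz2 x + 2 * \<Lambda> v 2) * fz2 x" for v x
  have s\<sigma>: "smooth_fun n (Rn n) (\<sigma> v)" for v
    unfolding \<sigma>_def[abs_def] by (intro smooth_fun_mult aff fz2(1) open_in_Rn)
  have d\<sigma>: "dir_deriv n (\<sigma> v) x w = (2 * \<Lambda> v 0 * fz2 x + 2 * \<Lambda> v 2) * dir_deriv n fz2 x w" if "x \<in> Rn n" for v x w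
    unfolding \<sigma>_def[abs_def] dir_deriv_mult[OF aff[OF fz2(1)] fz2(1) that] dir_deriv_affine[OF open_in_Rn fz2(1) that]
    by (simp add: algebra_simps)
  have "\<exists>f. smooth_fun n (Rn n) f \<and> (\<forall>v\<in>Rn n. \<forall>x\<in>Rn n. dir_deriv n f x (X v x) = 1 * \<sigma> v x + \<Lambda> v 3)"
  proof (rule frame_poincare[of "\<lambda>v x. 1 * \<sigma> v x + \<Lambda> v 3"])
    have "\<sigma> v x = \<Lambda> v 0 * (fz2 x * fz2 x) + \<Lambda> v 2 * (2 * fz2 x)" for v x
      by (simp add: \<sigma>_def algebra_simps)
    then show "linear (\<lambda>v. 1 * \<sigma> v x + \<Lambda> v 3)" for x by (simp only: mult_1) (intro lins)
    show "smooth_fun n (Rn n) (\<lambda>x. 1 * \<sigma> v x + \<Lambda> v 3)" for v by (rule aff[OF s\<sigma>])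
    show "dir_deriv n (\<lambda>x. 1 * \<sigma> v x + \<Lambda> v 3) x (X u x) - dir_deriv n (\<lambda>x. 1 * \<sigma> u x + \<Lambda> u 3) x (X v x) =
      1 * \<sigma> (br u v) x + \<Lambda> (br u v) 3" if uv: "u \<in> Rn n" "v \<in> Rn n" "x \<in> Rn n" for u v x
      unfolding dir_deriv_affine[OF open_in_Rn s\<sigma> uv(3)] d\<sigma>[OF uv(3)] fz2(2)[OF uv(1,3)] fz2(2)[OF uv(2,3)]
      unfolding \<sigma>_def b[OF uv(1,2)]
      by (simp add: algebra_simps)
  qed
  then obtain fy where fy: "smooth_fun n (Rn n) fy"
    "\<And>v x. v \<in> Rn n \<Longrightarrow> x \<in> Rn n \<Longrightarrow> dir_deriv n fy x (X v x) = 1 * \<sigma> v x + \<Lambda> v 3" by blast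
  define \<pi> :: "rvec \<Rightarrow> rvec" where "\<pi> x = (\<lambda>_. 0)(0 := fx x, 1 := fy x, 2 := fz x, 3 := fz1 x, 4 := fz2 x)" for x
  have comps: "(\<lambda>x. \<pi> x 0) = fx" "(\<lambda>x. \<pi> x 1) = fy" "(\<lambda>x. \<pi> x 2) = fz" "(\<lambda>x. \<pi> x 3) = fz1" "(\<lambda>x. \<pi> x 4) = fz2"
    by (simp_all add: \<pi>_def)
  have s\<pi>: "smooth_map n (Rn n) 5 \<pi>"
    unfolding smooth_map_def
  proof (intro conjI allI impI)
    show "\<pi> ` Rn n \<subseteq> Rn 5" by (auto simp: \<pi>_def Rn_def)
    fix j :: nat assume "j < 5"
    then have "j = 0 \<or> j = 1 \<or> j = 2 \<or> j = 3 \<or> j = 4" by arith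
    then show "smooth_fun n (Rn n) (\<lambda>x. \<pi> x j)"
      using comps fx(1) fy(1) fz(1) fz1(1) fz2(1) by (elim disjE) (simp_all only:)
  qed
  have "differential n \<pi> x (X v x) = hc_field (\<Lambda> v) (\<pi> x)" if v: "v \<in> Rn n" and x: "x \<in> Rn n" for v x
    by (rule Rn_5_eqI[OF differential_in_Rn[OF open_in_Rn s\<pi> x] hc_in_Rn(1)])
       (simp_all only: differential_dir_deriv comps fx(2)[OF v x] fy(2)[OF v x] fz(2)[OF v x] fz1(2)[OF v x] fz2(2)[OF v x],
        simp_all add: hc_field_def \<pi>_def \<sigma>_def power2_eq_square algebra_simps)
  then show ?thesis using that s\<pi> by blast
qed

text \<open>
  The map \<open>\<pi>\<close> of \<open>ex_map_to_hilbert_cartan\<close> is at each point the map \<open>\<Lambda>\<close> read in the two frames, so each pointwise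
  condition on an integrable extension is a property of \<open>\<Lambda>\<close>.
\<close>

lemma integrable_extension_of_hom:
  assumes V: "subspace V" "V \<subseteq> Rn n" "V \<noteq> {0}" and lin: "linear \<Lambda>"
    and hom: "\<And>u v. u \<in> Rn n \<Longrightarrow> v \<in> Rn n \<Longrightarrow> \<Lambda> (br u v) = hc_bracket (\<Lambda> u) (\<Lambda> v)"
    and surj: "\<Lambda> ` Rn n = Rn 5" and plane: "\<Lambda> ` V = hc_plane"
    and inj: "\<And>v. v \<in> bracket_flag br V 2 \<Longrightarrow> \<Lambda> v = 0 \<Longrightarrow> v = 0"
  shows "\<exists>\<pi>. integrable_extension n (Rn n) (\<lambda>x. (\<lambda>u. X u x) ` V) 5 (Rn 5) hilbert_cartan \<pi>"
proof -
  obtain \<pi> where \<pi>: "smooth_map n (Rn n) 5 \<pi>"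
    "\<And>v x. v \<in> Rn n \<Longrightarrow> x \<in> Rn n \<Longrightarrow> differential n \<pi> x (X v x) = hc_field (\<Lambda> v) (\<pi> x)"
    using ex_map_to_hilbert_cartan[OF lin hom] by blast
  have \<Lambda>R: "\<Lambda> v \<in> Rn 5" if "v \<in> Rn n" for v using surj that by blast
  have V2: "V \<subseteq> bracket_flag br V 2" using bracket_flag_Suc(1)[OF V(1), of "Suc 0"] by (simp add: numeral_2_eq_2)
  have zero: "v = 0" if v: "v \<in> bracket_flag br V 2" and x: "x \<in> Rn n" and d: "differential n \<pi> x (X v x) = 0" for v x
  proof -
    have vR: "v \<in> Rn n" using bracket_flag_Rn[OF V(2)] v by blast
    have "hc_field (\<Lambda> v) (\<pi> x) = hc_field 0 (\<pi> x)"
      using \<pi>(2)[OF vR x] d hc.X_zero by metis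
    then have "\<Lambda> v = 0"
      using inj_onD[OF hc.inj_X[OF smooth_map_in_Rn[OF \<pi>(1) x]] _ \<Lambda>R[OF vR] subspace_0[OF subspace_Rn]] by blast
    then show ?thesis by (rule inj[OF v])
  qed
  have "integrable_extension n (Rn n) (\<lambda>x. (\<lambda>u. X u x) ` V) 5 (Rn 5) hilbert_cartan \<pi>"
    unfolding integrable_extension_def
  proof (intro conjI ballI)
    show "\<pi> ` Rn n \<subseteq> Rn 5" using smooth_map_in_Rn[OF \<pi>(1)] by blast
    fix x assume x: "x \<in> Rn n"
    let ?d = "differential n \<pi> x"
    have px: "\<pi> x \<in> Rn 5" using smooth_map_in_Rn[OF \<pi>(1) x] .
    have img: "?d ` (\<lambda>v. X v x) ` A = (\<lambda>v. hc_field v (\<pi> x)) ` \<Lambda> ` A" if "A \<subseteq> Rn n" for A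
      unfolding image_image using \<pi>(2)[OF _ x] that by (intro image_cong) auto
    show "?d ` Rn n = Rn 5"
      using img[of "Rn n"] surj image_X[OF x] hc.image_X[OF px] by simp
    show "bij_betw ?d ((\<lambda>u. X u x) ` V) (hilbert_cartan (\<pi> x))"
      unfolding bij_betw_def
    proof
      show "?d ` (\<lambda>u. X u x) ` V = hilbert_cartan (\<pi> x)"
        unfolding img[OF V(2)] plane hilbert_cartan_parallel ..
      show "inj_on ?d ((\<lambda>u. X u x) ` V)"
      proof (rule inj_onI, elim imageE)
        fix a b u v assume ab: "?d a = ?d b" "a = X u x" "b = X v x" "u \<in> V" "v \<in> V"
        have "?d (X (u - v) x) = ?d a - ?d b"
          unfolding X_diff ab(2,3) by (rule linear_diff[OF linear_differential])
        then have "?d (X (u - v) x) = 0" using ab(1) by simp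
        moreover have "u - v \<in> bracket_flag br V 2" using V2 subspace_diff[OF V(1)] ab by blast
        ultimately have "u - v = 0" using zero[OF _ x] by blast
        then show "a = b" using ab by simp
      qed
    qed
    show "derived_flag n (Rn n) (\<lambda>x. (\<lambda>u. X u x) ` V) 2 x \<inter> {v \<in> Rn n. ?d v = 0} = {0}"
    proof (rule subset_antisym)
      show "derived_flag n (Rn n) (\<lambda>x. (\<lambda>u. X u x) ` V) 2 x \<inter> {v \<in> Rn n. ?d v = 0} \<subseteq> {0}"
        unfolding derived_flag_parallel[OF V x] using zero[OF _ x] X_zero by blast
      have "X 0 x \<in> (\<lambda>u. X u x) ` bracket_flag br V 2"
        using subspace_0[OF bracket_flag_subspace[OF V(1)]] by blast
      then show "{0} \<subseteq> derived_flag n (Rn n) (\<lambda>x. (\<lambda>u. X u x) ` V) 2 x \<inter> {v \<in> Rn n. ?d v = 0}"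
        unfolding derived_flag_parallel[OF V x] X_zero
        using subspace_0[OF subspace_Rn] linear_0[OF linear_differential[of n \<pi> x]] by blast
    qed
  qed (rule \<pi>(1))
  then show ?thesis by (intro exI[of _ \<pi>])
qed

end

theorem theorem3:
  fixes n :: nat and M :: "rvec set" and D :: "rvec \<Rightarrow> rvec set"
  assumes "distribution 2 n M D"
    and "flat n M D"
    and "\<forall>x\<in>M. growth n M D x 1 = 2 \<and> growth n M D x 2 = 1 \<and> growth n M D x 3 = 2"
  shows "result_of_extensions_of_hilbert_cartan n M D"
proof (cases "M = {}")
  (* The empty manifold is locally equivalent to anything, so the chain without extensions will do. *)
  case True
  then show ?thesis
    unfolding result_of_extensions_of_hilbert_cartan_def
    using distribution_hilbert_cartan
    by (intro exI[of _ 0] exI[of _ "\<lambda>_. 5"] exI[of _ "\<lambda>_. Rn 5"] exI[of _ "\<lambda>_. hilbert_cartan"] exI[of _ undefined])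
       (auto simp: locally_equivalent_def)
next
  case False
  then obtain p where p: "p \<in> M" by blast
  obtain g br G \<psi> where flat: "graded_lie_algebra n g br \<and>
      (\<forall>x\<in>M. \<exists>\<phi>. carnot_iso n M D x g br \<phi>) \<and> lie_group n G \<and> bij_betw \<psi> (Rn n) (Rn n) \<and>
      (\<forall>a b. \<forall>u\<in>Rn n. \<forall>v\<in>Rn n. \<psi> (a *\<^sub>R u + b *\<^sub>R v) = a *\<^sub>R \<psi> u + b *\<^sub>R \<psi> v) \<and>
      (\<forall>u\<in>Rn n. \<forall>v\<in>Rn n. \<psi> (br u v) = lie_group_bracket n G (\<psi> u) (\<psi> v)) \<and>
      locally_equivalent n M D n (Rn n) (\<lambda>x. (\<lambda>u. left_invariant_field n G (\<psi> u) x) ` g 1)"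
    using assms(2) unfolding flat_def by (elim exE) (rule that)
  then have gla: "graded_lie_algebra n g br" and G: "lie_group n G" and bij: "bij_betw \<psi> (Rn n) (Rn n)"
    and le: "locally_equivalent n M D n (Rn n) (\<lambda>x. (\<lambda>u. left_invariant_field n G (\<psi> u) x) ` g 1)"
    by - (elim conjE, assumption)+
  have lin: "\<psi> (a *\<^sub>R u + b *\<^sub>R v) = a *\<^sub>R \<psi> u + b *\<^sub>R \<psi> v" if "u \<in> Rn n" "v \<in> Rn n" for a b u v
    using flat that by metis
  have hom: "\<psi> (br u v) = lie_group_bracket n G (\<psi> u) (\<psi> v)" if "u \<in> Rn n" "v \<in> Rn n" for u v
    using flat that by metis
  interpret A: graded_algebra n g br using gla by unfold_locales
  interpret H: smooth_group n G using G by unfold_locales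
  obtain X coframe where par: "parallelism n X coframe br"
    and X: "\<And>v x. v \<in> Rn n \<Longrightarrow> X v x = left_invariant_field n G (\<psi> v) x"
    using H.parallelism_left_invariant[OF bij lin hom A.br_Rn] by blast
  interpret P: parallelism n X coframe br by (rule par)
  let ?V = "g 1" and ?E = "\<lambda>x. (\<lambda>u. X u x) ` g 1"
  have VR: "?V \<subseteq> Rn n" using A.g_Rn by blast
  have "(\<lambda>x. (\<lambda>u. left_invariant_field n G (\<psi> u) x) ` g 1) = ?E"
    by (rule ext, rule image_cong) (use X VR in auto)
  then have le: "locally_equivalent n M D n (Rn n) ?E" using le by simp
  from this[unfolded locally_equivalent_def, THEN bspec, OF p]
  obtain U W f where "open_in n U \<and> p \<in> U \<and> U \<subseteq> M \<and> open_in n W \<and> W \<subseteq> Rn n \<and>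
      diffeo n U n W f \<and> (\<forall>x\<in>U. differential n f x ` D x = ?E (f x))"
    by (elim exE) (rule that)
  then have U: "open_in n U" "p \<in> U" "U \<subseteq> M" and W: "open_in n W" "W \<subseteq> Rn n"
    and f: "diffeo n U n W f" and DE': "\<forall>x\<in>U. differential n f x ` D x = ?E (f x)"
    by - (elim conjE, assumption)+
  have DE: "differential n f x ` D x = ?E (f x)" if "x \<in> U" for x using DE' that by blast
  have sub: "smooth_subbundle 2 n M D" using assms(1) by (simp add: distribution_def)
  have fp: "f p \<in> Rn n" using f U W by (auto simp: diffeo_def bij_betw_def)
  have ER: "?E y \<subseteq> Rn n" if "y \<in> W" for y using P.X_in_Rn VR W that by blast
  have DR: "D x \<subseteq> Rn n" if "x \<in> U" for x using subbundle_in_Rn(2)[OF sub] U that by blast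
  note dif = derived_flag_diffeo[where D = D and E = ?E, OF U(1,3) W f DE DR ER U(2)]
  have dims: "dim (derived_flag n (Rn n) ?E i (f p)) = dim (derived_flag n M D i p)" for i
  proof -
    have "derived_flag n M D i p \<subseteq> Rn n" by (rule derived_flag_in_Rn) (rule DR[OF U(2)])
    moreover have "subspace (derived_flag n M D i p)"
      by (rule derived_flag_subspace) (rule subbundle_in_Rn(1)[OF sub p])
    ultimately have "dim (differential n f p ` derived_flag n M D i p) = dim (derived_flag n M D i p)"
      using inj_on_subset[OF dif(2)] by (intro dim_linear_image[OF linear_differential])
    then show ?thesis by (simp only: dif(1))
  qed
  have "dim (?E (f p)) = dim ?V"
    by (rule dim_linear_image[OF P.lin_X A.g_subspace inj_on_subset[OF P.inj_X[OF fp] VR]])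
  then have d1: "dim ?V = 2" using dims[of 1] subbundle_in_Rn(3)[OF sub p] by simp
  have V0: "?V \<noteq> {0}"
  proof
    assume "?V = {0}"
    then have "dim ?V \<le> card ({} :: rvec set)" by (intro dim_le_card) auto
    then show False using d1 by simp
  qed
  have dflag: "dim (bracket_flag br ?V i) = dim (derived_flag n M D i p)" for i
    using P.dim_derived_flag_parallel[OF A.g_subspace VR V0 fp] dims by simp
  (* The growth vector enters as 2 + 1 + 2. *)
  have d3: "dim (bracket_flag br ?V 3) = 5"
  proof -
    have "dim (derived_flag n M D 1 p) = 2" using subbundle_in_Rn(3)[OF sub p] by simp
    moreover have "dim (derived_flag n M D 2 p) - dim (derived_flag n M D 1 p) = 1"
      "dim (derived_flag n M D 3 p) - dim (derived_flag n M D 2 p) = 2"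
      using bspec[OF assms(3) p] by (simp_all add: growth_def)
    ultimately show ?thesis unfolding dflag by linarith
  qed
  obtain s where s: "derived_flag n M D s p = Rn n" using assms(1) p by (auto simp: distribution_def)
  have full: "bracket_flag br ?V s = Rn n"
  proof -
    have "(\<lambda>u. X u (f p)) ` bracket_flag br ?V s = Rn n"
      using dif(1)[of s] dif(3) s P.derived_flag_parallel[OF A.g_subspace VR V0 fp, of s] by simp
    then have "(\<lambda>u. X u (f p)) ` bracket_flag br ?V s = (\<lambda>u. X u (f p)) ` Rn n"
      using P.image_X[OF fp] by simp
    then show ?thesis
      using inj_on_image_eq_iff[OF P.inj_X[OF fp] P.bracket_flag_Rn[OF VR]] by blast
  qed
  from A.ex_hom_to_hc_bracket[OF d1 d3 full]
  obtain \<Lambda> where \<Lambda>: "linear \<Lambda> \<and>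
    (\<forall>u\<in>Rn n. \<forall>v\<in>Rn n. \<Lambda> (br u v) = hc_bracket (\<Lambda> u) (\<Lambda> v)) \<and>
    \<Lambda> ` Rn n = Rn 5 \<and> \<Lambda> ` ?V = hc_plane \<and> (\<forall>v\<in>bracket_flag br ?V 2. \<Lambda> v = 0 \<longrightarrow> v = 0)"
    by (elim exE) (rule that)
  have "\<exists>\<pi>. integrable_extension n (Rn n) ?E 5 (Rn 5) hilbert_cartan \<pi>"
    by (rule P.integrable_extension_of_hom[OF A.g_subspace VR V0, of \<Lambda>]) (use \<Lambda> in auto)
  then obtain \<pi> where \<pi>: "integrable_extension n (Rn n) ?E 5 (Rn 5) hilbert_cartan \<pi>" by (elim exE) (rule that)
  have dist: "distribution 2 n (Rn n) ?E"
    by (rule P.distribution_parallel[OF A.g_subspace VR d1 full])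
  (* The chain consists of the Hilbert--Cartan equation and the group, with one extension between. *)
  show ?thesis
    unfolding result_of_extensions_of_hilbert_cartan_def
    by (rule exI[of _ 1], rule exI[of _ "\<lambda>k. if k = 0 then 5 else n"], rule exI[of _ "\<lambda>k. if k = 0 then Rn 5 else Rn n"],
        rule exI[of _ "\<lambda>k. if k = 0 then hilbert_cartan else ?E"], rule exI[of _ "\<lambda>_. \<pi>"])
      (use distribution_hilbert_cartan dist \<pi> le in auto)
qed

end
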